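(* Let $V\subset\mathbb{R}^n$ be open and connected, let $f_0,f_1,\dots,f_{n_u}$ be smooth vector fields on $V$, let $g:V\to\mathbb{R}^{n\times d}$ be smooth, and let $N=n+\frac{n(n+1)}{2}$. If for every $m\in V$ $$\dim\left\{\begin{pmatrix} h(m)\\ Dh(m)+Dh(m)^\top\end{pmatrix}:h\in\mathrm{Lie}(f_1,\dots,f_{n_u})\right\}=N,$$ then the control-affine system $$\dot X=F_{f_0,g}(X)+\sum_{i=1}^{n_u}u_iF_{f_i}(X),\qquad X\in V\times\mathrm{Sym}^+(n),\ u\in\mathbb{R}^{n_u},$$ is controllable on $V\times\mathrm{Sym}^+(n)$ in free and fixed time.
   Context: $\mathrm{Sym}^+(n)$ is the set of real symmetric positive definite $n\times n$ matrices; $Dh$ is the Jacobian matrix of $h$. For $X=(m,P)\in V\times\mathrm{Sym}^+(n)$, $$F_{f_0,g}(X)=\begin{pmatrix} f_0(m)\\ Df_0(m)P+PDf_0(m)^\top+g(m)g(m)^\top\end{pmatrix},\qquad F_{f_i}(X)=\begin{pmatrix} f_i(m)\\ Df_i(m)P+PDf_i(m)^\top\end{pmatrix},\ i=1,\dots,n_u .$$ $\mathrm{Lie}(f_1,\dots,f_{n_u})$ is the real Lie algebra of vector fields on $V$ generated by $f_1,\dots,f_{n_u}$ for the bracket $[h_1,h_2]=Dh_2\,h_1-Dh_1\,h_2$. For $X\in V\times\mathrm{Sym}^+(n)$ and $T\ge0$, $\mathcal{A}(X,T)$ is the set of endpoints at time $T$ of the trajectories of the system in $V\times\mathrm{Sym}^+(n)$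 starting at $X$ at time $0$ (defined on $[0,T]$, with piecewise constant controls valued in $\mathbb{R}^{n_u}$), and $\mathcal{A}(X)=\bigcup_{T\ge0}\mathcal{A}(X,T)$. The system is controllable on $V\times\mathrm{Sym}^+(n)$ in free and fixed time if for every $X\in V\times\mathrm{Sym}^+(n)$ one has $\mathcal{A}(X)=V\times\mathrm{Sym}^+(n)$ and $\mathcal{A}(X,T)=V\times\mathrm{Sym}^+(n)$ for all $T>0$ small enough. *)

theory Defs
  imports "HOL-Analysis.Analysis"
begin

text \<open>
  Vector fields on an open set \<open>V\<close> are represented by total functions on the ambient space.
  Since derivatives at a point of \<open>V\<close> only depend on the values on \<open>V\<close>, the values chosen
  outside \<open>V\<close> do not matter, also in \<open>lie_generated\<close>.
\<close>

text \<open>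
  The differentiability class \<open>C\<^sup>k\<close>. Derivatives are taken in the ambient space, so this
  is the usual notion only for open \<open>S\<close>.
\<close>

primrec Ck_on :: "nat \<Rightarrow> ('a::real_normed_vector \<Rightarrow> 'b::real_normed_vector) \<Rightarrow> 'a set \<Rightarrow> bool" where
  "Ck_on 0 f S \<longleftrightarrow> continuous_on S f"
| "Ck_on (Suc k) f S \<longleftrightarrow>
     (\<forall>x\<in>S. f differentiable (at x)) \<and>
     (\<forall>v. Ck_on k (\<lambda>x. frechet_derivative f (at x) v) S)"

definition smooth_on :: "('a::real_normed_vector \<Rightarrow> 'b::real_normed_vector) \<Rightarrow> 'a set \<Rightarrow> bool" where
  "smooth_on f S \<longleftrightarrow> (\<forall>k. Ck_on k f S)"

definition Sym_pos :: "(real^'n^'n) set" where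
  "Sym_pos = {P. transpose P = P \<and> (\<forall>x. x \<noteq> 0 \<longrightarrow> x \<bullet> (P *v x) > 0)}"

definition lie_bracket ::
    "(real^'n \<Rightarrow> real^'n) \<Rightarrow> (real^'n \<Rightarrow> real^'n) \<Rightarrow> real^'n \<Rightarrow> real^'n" where
  "lie_bracket h1 h2 = (\<lambda>x. jacobian h2 (at x) *v h1 x - jacobian h1 (at x) *v h2 x)"

inductive_set lie_generated :: "(real^'n \<Rightarrow> real^'n) set \<Rightarrow> (real^'n \<Rightarrow> real^'n) set"
  for G :: "(real^'n \<Rightarrow> real^'n) set" where
  generator: "h \<in> G \<Longrightarrow> h \<in> lie_generated G"
| zero: "(\<lambda>x. 0) \<in> lie_generated G"
| add: "h1 \<in> lie_generated G \<Longrightarrow> h2 \<in> lie_generated G \<Longrightarrow> (\<lambda>x. h1 x + h2 x) \<in> lie_generated G"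
| scale: "h \<in> lie_generated G \<Longrightarrow> (\<lambda>x. c *\<^sub>R h x) \<in> lie_generated G"
| bracket: "h1 \<in> lie_generated G \<Longrightarrow> h2 \<in> lie_generated G \<Longrightarrow> lie_bracket h1 h2 \<in> lie_generated G"

definition F_drift ::
    "(real^'n \<Rightarrow> real^'n) \<Rightarrow> (real^'n \<Rightarrow> real^'d^'n) \<Rightarrow>
     (real^'n) \<times> (real^'n^'n) \<Rightarrow> (real^'n) \<times> (real^'n^'n)" where
  "F_drift f g = (\<lambda>(m, P).
     (f m,
      jacobian f (at m) ** P + P ** transpose (jacobian f (at m)) + g m ** transpose (g m)))"

definition F_field ::
    "(real^'n \<Rightarrow> real^'n) \<Rightarrow> (real^'n) \<times> (real^'n^'n) \<Rightarrow> (real^'n) \<times> (real^'n^'n)" where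
  "F_field f = (\<lambda>(m, P).
     (f m, jacobian f (at m) ** P + P ** transpose (jacobian f (at m))))"

text \<open>The values at the finitely many switching times are unconstrained.\<close>

definition piecewise_constant_on :: "(real \<Rightarrow> 'a) \<Rightarrow> real \<Rightarrow> real \<Rightarrow> bool" where
  "piecewise_constant_on u a b \<longleftrightarrow>
     (\<exists>S. finite S \<and>
       (\<forall>c d. {c<..<d} \<subseteq> {a..b} - S \<longrightarrow> u constant_on {c<..<d}))"

text \<open>
  The trajectories on \<open>[0,T]\<close>, with values in \<open>M\<close>, of the control-affine system
  with drift \<open>F0\<close>, controlled fields \<open>F i\<close> and control \<open>u\<close>: continuous functions that
  satisfy the differential equation off a finite set of times.
\<close>

definition trajectory ::
    "'s::real_normed_vector set \<Rightarrow> ('s \<Rightarrow> 's) \<Rightarrow> ('u::finite \<Rightarrow> 's \<Rightarrow> 's) \<Rightarrow>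
     real \<Rightarrow> (real \<Rightarrow> real^'u) \<Rightarrow> (real \<Rightarrow> 's) \<Rightarrow> bool" where
  "trajectory M F0 F T u X \<longleftrightarrow>
     continuous_on {0..T} X \<and> X ` {0..T} \<subseteq> M \<and>
     (\<exists>S. finite S \<and>
       (\<forall>t\<in>{0..T} - S.
         (X has_vector_derivative (F0 (X t) + (\<Sum>i\<in>UNIV. (u t $ i) *\<^sub>R F i (X t))))
           (at t within {0..T})))"

definition attainable_at ::
    "'s::real_normed_vector set \<Rightarrow> ('s \<Rightarrow> 's) \<Rightarrow> ('u::finite \<Rightarrow> 's \<Rightarrow> 's) \<Rightarrow> 's \<Rightarrow> real \<Rightarrow> 's set" where
  "attainable_at M F0 F x T =
     {X T | u X. piecewise_constant_on u 0 T \<and> trajectory M F0 F T u X \<and> X 0 = x}"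

definition attainable ::
    "'s::real_normed_vector set \<Rightarrow> ('s \<Rightarrow> 's) \<Rightarrow> ('u::finite \<Rightarrow> 's \<Rightarrow> 's) \<Rightarrow> 's \<Rightarrow> 's set" where
  "attainable M F0 F x = (\<Union>T\<in>{0..}. attainable_at M F0 F x T)"

definition controllable_free_fixed_time ::
    "'s::real_normed_vector set \<Rightarrow> ('s \<Rightarrow> 's) \<Rightarrow> ('u::finite \<Rightarrow> 's \<Rightarrow> 's) \<Rightarrow> bool" where
  "controllable_free_fixed_time M F0 F \<longleftrightarrow>
     (\<forall>x\<in>M. attainable M F0 F x = M \<and>
       (\<forall>\<^sub>F T in at_right 0. attainable_at M F0 F x T = M))"

end

theory Submission
  imports Defs
begin

text \<open>
  Write \<open>M = V \<times> Sym\<^sup>+\<close>. The map \<open>h \<mapsto> F\<^sub>h\<close> is a Lie algebra homomorphism, so the brackets of the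
  controlled fields are the \<open>F\<^sub>h\<close> with \<open>h\<close> in the generated Lie algebra, and the hypothesis says that
  they span the tangent space at the points \<open>(m, I)\<close>. At other points \<open>(m, P)\<close> consider the isotropy
  algebra \<open>L = {Dh(m) | h(m) = 0}\<close>, for which \<open>A \<mapsto> A + A\<^sup>T\<close> maps onto the symmetric matrices. On the
  closed set of invertible \<open>B\<close> with \<open>B L B\<inverse> \<subseteq> L\<close> the coercive function
  \<open>tr(B\<inverse> P B\<^sup>-\<^sup>T) + tr(B\<^sup>T P\<inverse> B)\<close> has a minimum; varying \<open>B\<close> along \<open>B exp(tA)\<close> with \<open>A \<in> L\<close> shows that
  \<open>Q = B\<inverse> P B\<^sup>-\<^sup>T\<close> satisfies \<open>Q = Q\<inverse>\<close> there, so \<open>P = B B\<^sup>T\<close>, and conjugation by \<open>B\<close> carries the rank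
  condition from \<open>I\<close> to \<open>P\<close>.

  Locally, the driftless system approximates the flow of every bracket: commutators of flows move by
  \<open>s [A, B] + o(s)\<close>, and iterating such steps converges to the flow of \<open>[A, B]\<close>. The approximating words of
  controls depend continuously on the parameters, so a fixed word of controls, run for a short time with
  large amplitude, has an endpoint map that is a small perturbation of \<open>z \<mapsto> x + s z\<close>, even in the presence
  of the drift. By Brouwer's theorem it hits every target near \<open>x\<close>. Hence nearby points
  are mutually reachable in every small time; connectedness of \<open>M\<close> and waiting along short loops
  give the claim.
\<close>

section \<open>Global solutions of Lipschitz differential equations\<close>

text \<open>A word that follows a bracket for time s has letters of size sqrt s, so its endpoint
  need not be differentiable in s at 0. An inverse function argument is therefore out of reach, and
  all estimates are inequalities, uniform on a ball and backed only by continuity. Each carries two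
  errors: one proportional to the time, and an additive one of free size, since flows of brackets
  are only approximated. Iterating a short step accumulates the additive error, so it has to be
  adjustable after the number of steps is fixed. The drift stays out of this analysis: as controls
  are unbounded, a word of n letters can be run in total time n \<epsilon>, during which the drift
  moves the endpoint by O(\<epsilon>). Since n does not depend on \<epsilon>, every small total time
  is realised, which is what the fixed-time claim asks. Controls take both signs, so backward flows
  are words as well. The ambient space of matrices is too large for the rank N, so the analysis runs
  inside the subspace of symmetric second components, where N is full rank.\<close>

definition solves :: "('a::real_normed_vector \<Rightarrow> 'a) \<Rightarrow> (real \<Rightarrow> 'a) \<Rightarrow> bool" where
  "solves G X \<longleftrightarrow> (\<forall>t\<ge>0. (X has_vector_derivative G (X t)) (at t within {0..}))"

definition sol :: "('a::real_normed_vector \<Rightarrow> 'a) \<Rightarrow> 'a \<Rightarrow> real \<Rightarrow> 'a" where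
  "sol G x = (SOME X. X 0 = x \<and> solves G X)"

text \<open>Time t is encoded by scaling the field by t. A negative factor then gives the backward
  flow, although \<open>solves\<close> looks only at nonnegative times.\<close>

definition flow1 :: "('a::real_normed_vector \<Rightarrow> 'a) \<Rightarrow> 'a \<Rightarrow> 'a" where
  "flow1 G x = sol G x 1"

text \<open>The unknown is \<open>Z t = exp (- 2 L t) (X t - x)\<close>; with this weight the Picard operator contracts on the whole half-line.\<close>

lemma weighted_picard_fixpoint:
  fixes G :: "'a::euclidean_space \<Rightarrow> 'a"
  assumes lip: "L-lipschitz_on UNIV G" and L: "L > 0"
  shows "\<exists>Z :: real \<Rightarrow>\<^sub>C 'a. \<forall>t\<ge>0. Z t =
      exp (- 2 * L * t) *\<^sub>R integral {0..t} (\<lambda>s. G (x + exp (2 * L * s) *\<^sub>R Z s))"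
proof -
  define I where "I = (\<lambda>(Z :: real \<Rightarrow>\<^sub>C 'a) t. integral {0..t} (\<lambda>s. G (x + exp (2 * L * s) *\<^sub>R Z s)))"
  \<comment> \<open>\<open>max 0 t\<close> extends the operator by a constant to negative times,
    because the bounded continuous functions used here live on the whole real line.\<close>
  define Q where "Q = (\<lambda>Z t. exp (- 2 * L * max 0 t) *\<^sub>R I Z (max 0 t))"
  have contG: "continuous_on UNIV G"
    using lip by (rule lipschitz_on_continuous_on)
  have cont: "continuous_on S (\<lambda>s. G (x + exp (2 * L * s) *\<^sub>R (Z :: real \<Rightarrow>\<^sub>C 'a) s))" for Z S
    by (rule continuous_on_compose2[OF contG]) (auto intro!: continuous_intros)
  have int: "(\<lambda>s. G (x + exp (2 * L * s) *\<^sub>R (Z :: real \<Rightarrow>\<^sub>C 'a) s)) integrable_on {0..t}" for Z t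
    using integrable_continuous_real[OF cont] .
  have expint: "((\<lambda>s. L * exp (2 * L * s)) has_integral (exp (2 * L * t) - 1) / 2) {0..t}" if "t \<ge> 0" for t
  proof -
    have "((\<lambda>s. L * exp (2 * L * s)) has_integral exp (2 * L * t) / 2 - exp (2 * L * 0) / 2) {0..t}"
      using that by (intro fundamental_theorem_of_calculus)
        (auto intro!: derivative_eq_intros simp: has_real_derivative_iff_has_vector_derivative[symmetric])
    then show ?thesis by (simp add: diff_divide_distrib)
  qed
  have diff: "norm (I Z t - I Z' t) \<le> exp (2 * L * t) / 2 * dist Z Z'" if t: "t \<ge> 0" for Z Z' t
  proof -
    have "norm (I Z t - I Z' t) = norm (integral {0..t}
       (\<lambda>s. G (x + exp (2 * L * s) *\<^sub>R Z s) - G (x + exp (2 * L * s) *\<^sub>R Z' s)))"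
      unfolding I_def by (subst integral_diff[OF int int]) simp
    also have "\<dots> \<le> integral {0..t} (\<lambda>s. L * exp (2 * L * s) * dist Z Z')"
    proof (rule integral_norm_bound_integral)
      show "(\<lambda>s. G (x + exp (2 * L * s) *\<^sub>R Z s) - G (x + exp (2 * L * s) *\<^sub>R Z' s)) integrable_on {0..t}"
        by (intro integrable_diff int)
      show "(\<lambda>s. L * exp (2 * L * s) * dist Z Z') integrable_on {0..t}"
        by (intro integrable_continuous_real continuous_intros)
      fix s
      have "norm (G (x + exp (2 * L * s) *\<^sub>R Z s) - G (x + exp (2 * L * s) *\<^sub>R Z' s))
        \<le> L * dist (x + exp (2 * L * s) *\<^sub>R Z s) (x + exp (2 * L * s) *\<^sub>R Z' s)"
        using lipschitz_onD[OF lip, of "x + exp (2 * L * s) *\<^sub>R Z s" "x + exp (2 * L * s) *\<^sub>R Z' s"]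
        by (simp add: dist_norm del: add_diff_cancel_left)
      also have "\<dots> = L * exp (2 * L * s) * dist (Z s) (Z' s)"
        by (simp add: dist_norm scaleR_diff_right[symmetric])
      also have "\<dots> \<le> L * exp (2 * L * s) * dist Z Z'"
        using L by (intro mult_left_mono dist_bounded) auto
      finally show "norm (G (x + exp (2 * L * s) *\<^sub>R Z s) - G (x + exp (2 * L * s) *\<^sub>R Z' s))
        \<le> L * exp (2 * L * s) * dist Z Z'" .
    qed
    also have "\<dots> = (exp (2 * L * t) - 1) / 2 * dist Z Z'"
    proof -
      have "((\<lambda>s. L * exp (2 * L * s) * dist Z Z') has_integral (exp (2 * L * t) - 1) / 2 * dist Z Z') {0..t}"
        using has_integral_mult_left[OF expint[OF t], of "dist Z Z'"] .
      then show ?thesis by (rule integral_unique)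
    qed
    also have "\<dots> \<le> exp (2 * L * t) / 2 * dist Z Z'"
      by (intro mult_right_mono) auto
    finally show ?thesis .
  qed
  \<comment> \<open>The weight grows at rate 2 L while the integrand has Lipschitz constant L;
    integrating leaves L / (2 L), the contraction factor 1/2.\<close>
  have Qdiff: "norm (Q Z t - Q Z' t) \<le> 1 / 2 * dist Z Z'" for Z Z' t
  proof -
    have "norm (Q Z t - Q Z' t) = exp (- 2 * L * max 0 t) * norm (I Z (max 0 t) - I Z' (max 0 t))"
      unfolding Q_def by (simp add: scaleR_diff_right[symmetric])
    also have "\<dots> \<le> exp (- 2 * L * max 0 t) * (exp (2 * L * max 0 t) / 2 * dist Z Z')"
      by (intro mult_left_mono diff) auto
    also have "\<dots> = 1 / 2 * dist Z Z'"
      by (simp add: exp_minus field_simps)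
    finally show ?thesis .
  qed
  have texp: "t * exp (- 2 * L * t) \<le> 1 / (2 * L)" if "t \<ge> 0" for t
  proof -
    have "2 * L * t \<le> exp (2 * L * t)" using exp_ge_add_one_self[of "2 * L * t"] by linarith
    then show ?thesis using L by (simp add: exp_minus field_simps)
  qed
  have I0: "norm (I 0 t) \<le> t * norm (G x)" if "t \<ge> 0" for t
    unfolding I_def using that by (simp)
  \<comment> \<open>One bounded image is enough: \<open>Qdiff\<close> bounds every other image
    relative to it.\<close>
  have Q0: "norm (Q 0 t) \<le> norm (G x) / (2 * L)" for t
  proof -
    have "norm (Q 0 t) \<le> exp (- 2 * L * max 0 t) * (max 0 t * norm (G x))"
      unfolding Q_def using I0[of "max 0 t"] by (simp add: mult_left_mono)
    also have "\<dots> \<le> 1 / (2 * L) * norm (G x)"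
      using mult_right_mono[OF texp[of "max 0 t"], of "norm (G x)"] by (simp add: mult_ac)
    finally show ?thesis by simp
  qed
  have Qcont: "continuous_on UNIV (Q Z)" for Z
  proof -
    have "continuous_on {0..} (I Z)"
    proof (clarsimp simp: continuous_on_eq_continuous_within)
      fix t :: real assume t: "0 \<le> t"
      have "continuous_on {0..t+1} (I Z)"
        unfolding I_def by (rule indefinite_integral_continuous_1[OF int])
      then have "continuous (at t within {0..t+1}) (I Z)"
        using t by (auto simp: continuous_on_eq_continuous_within)
      moreover have "at t within {0..t+1} = at t within {0..}"
        by (rule at_within_nhd[of _ "{..<t+1}"]) auto
      ultimately show "continuous (at t within {0..}) (I Z)" by simp
    qed
    then have "continuous_on UNIV (\<lambda>t. I Z (max 0 t))"
      by (rule continuous_on_compose2) (auto intro!: continuous_intros)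
    then show ?thesis unfolding Q_def by (intro continuous_intros)
  qed
  have Qb: "Q Z \<in> bcontfun" for Z
  proof -
    have "norm (Q Z t) \<le> norm (G x) / (2 * L) + 1 / 2 * dist Z 0" for t
      using Q0[of t] Qdiff[of Z t 0] norm_triangle_ineq2[of "Q Z t" "Q 0 t"] by linarith
    then have "bounded (range (Q Z))" by (auto intro!: boundedI)
    then show ?thesis using Qcont by (auto simp: bcontfun_def)
  qed
  define P where "P = (\<lambda>Z. Bcontfun (Q Z))"
  have P: "apply_bcontfun (P Z) = Q Z" for Z
    unfolding P_def using Qb by (simp add: Bcontfun_inverse)
  have "\<exists>!Z. P Z = Z"
  proof (rule banach_fix_type[of "1/2"])
    show "\<forall>Z Z'. dist (P Z) (P Z') \<le> 1 / 2 * dist Z Z'"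
      by (intro allI dist_bound) (simp only: P dist_norm[of "Q _ _"] Qdiff)
  qed auto
  then obtain Z where Z: "P Z = Z" by (elim ex1E)
  have "Z t = Q Z t" for t using P[of Z] unfolding Z by (rule fun_cong)
  then have "Z t = exp (- 2 * L * t) *\<^sub>R I Z t" if "t \<ge> 0" for t
    using that unfolding Q_def by (simp add: max_absorb2)
  then show ?thesis unfolding I_def by (intro exI[of _ Z] allI impI)
qed

lemma solves_exists:
  fixes G :: "'a::euclidean_space \<Rightarrow> 'a"
  assumes lip: "L-lipschitz_on UNIV G"
  shows "\<exists>X. X 0 = x \<and> solves G X"
proof -
  \<comment> \<open>The weighted fixpoint argument needs a positive constant, and \<open>L\<close>
    may be 0.\<close>
  define K where "K = L + 1"
  have K: "K > 0" "K-lipschitz_on UNIV G"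
    using lip lipschitz_on_nonneg[OF lip] lipschitz_on_mono[OF lip, of UNIV "L+1"] by (auto simp: K_def)
  obtain Z :: "real \<Rightarrow>\<^sub>C 'a" where Z: "\<And>t. t \<ge> 0 \<Longrightarrow> Z t =
      exp (- 2 * K * t) *\<^sub>R integral {0..t} (\<lambda>s. G (x + exp (2 * K * s) *\<^sub>R Z s))"
    using weighted_picard_fixpoint[OF K(2,1), of x] by (elim exE) (rule that, elim allE impE)
  define X where "X = (\<lambda>t. x + exp (2 * K * t) *\<^sub>R Z t)"
  have X: "X t = x + integral {0..t} (\<lambda>s. G (X s))" if "t \<ge> 0" for t
    using Z[OF that] unfolding X_def by (simp add: exp_minus)
  have contX: "continuous_on S X" for S unfolding X_def by (intro continuous_intros) auto
  have contGX: "continuous_on S (\<lambda>s. G (X s))" for S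
    by (rule continuous_on_compose2[OF lipschitz_on_continuous_on[OF lip] contX]) auto
  have "(X has_vector_derivative G (X t)) (at t within {0..})" if t: "t \<ge> 0" for t
  proof -
    have "((\<lambda>u. integral {0..u} (\<lambda>s. G (X s))) has_vector_derivative G (X t)) (at t within {0..t+1})"
      using integral_has_vector_derivative[OF contGX, of t 0 "t+1"] t by auto
    then have "((\<lambda>u. x + integral {0..u} (\<lambda>s. G (X s))) has_vector_derivative G (X t)) (at t within {0..t+1})"
      by (auto intro!: derivative_eq_intros)
    then have "(X has_vector_derivative G (X t)) (at t within {0..t+1})"
      by (rule has_vector_derivative_transform[rotated 2]) (use t X in auto)
    moreover have "at t within {0..t+1} = at t within {0..}"
      by (rule at_within_nhd[of _ "{..<t+1}"]) auto
    ultimately show ?thesis by simp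
  qed
  moreover have "X 0 = x" using X[of 0] by simp
  ultimately show ?thesis unfolding solves_def by (intro exI[of _ X] conjI allI impI)
qed

lemma sol_solves:
  fixes G :: "'a::euclidean_space \<Rightarrow> 'a"
  assumes "L-lipschitz_on UNIV G"
  shows "sol G x 0 = x" "solves G (sol G x)"
  using someI_ex[OF solves_exists[OF assms, of x]] unfolding sol_def by auto

section \<open>Gronwall estimate, uniqueness, and scaling of flows\<close>

lemma has_vector_derivative_at_of_within_Ici:
  fixes X :: "real \<Rightarrow> 'a::real_normed_vector"
  assumes "(X has_vector_derivative D) (at t within {0..})" "t > 0"
  shows "(X has_vector_derivative D) (at t)"
proof -
  have "at t within {0..} = at t"
    by (rule at_within_interior) (use assms in \<open>simp add: interior_Ici[of "-1"]\<close>)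
  then show ?thesis using assms by simp
qed

lemma solves_continuous_on:
  assumes "solves G X" shows "continuous_on {0..} X"
  using assms unfolding solves_def
  by (auto simp: continuous_on_eq_continuous_within intro: has_vector_derivative_continuous)

text \<open>The squared distance is differentiable even where the curves meet. Adding d^2 to it
  makes the quantity weighted by exp (- K t) nonincreasing: K = 2 L + 1 absorbs the Lipschitz part
  and the mixed term, by 2 |D| d \<le> |D|^2 + d^2. Taking the root and rounding K up to 2 (L + 1)
  gives the stated rate.\<close>

lemma gronwall_perturbed:
  fixes X Y :: "real \<Rightarrow> 'a::euclidean_space"
  assumes X: "continuous_on {0..T} X" "\<And>t. 0 < t \<Longrightarrow> t < T \<Longrightarrow> (X has_vector_derivative X' t) (at t)"
    and Y: "continuous_on {0..T} Y" "\<And>t. 0 < t \<Longrightarrow> t < T \<Longrightarrow> (Y has_vector_derivative Y' t) (at t)"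
    and b: "\<And>t. 0 < t \<Longrightarrow> t < T \<Longrightarrow> norm (X' t - Y' t) \<le> L * norm (X t - Y t) + d"
    and t: "0 \<le> t" "t \<le> T" and "d \<ge> 0" "L \<ge> 0"
  shows "norm (X t - Y t) \<le> exp ((L + 1) * t) * (norm (X 0 - Y 0) + d)"
proof -
  define K where "K = 2 * L + 1"
  define D where "D = (\<lambda>t. X t - Y t)"
  define q where "q = (\<lambda>t. exp (- K * t) * (D t \<bullet> D t + d\<^sup>2))"
  have "q t \<le> q 0"
  proof (rule DERIV_nonpos_imp_decreasing_open[OF t(1)])
    show "continuous_on {0..t} q"
      unfolding q_def D_def
      by (intro continuous_intros continuous_on_subset[OF X(1)] continuous_on_subset[OF Y(1)]) (use t in auto)
    fix s assume s: "0 < s" "s < t"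
    have D': "(D has_vector_derivative (X' s - Y' s)) (at s)"
      unfolding D_def using s t by (intro derivative_intros X(2) Y(2)) auto
    have "((\<lambda>t. D t \<bullet> D t) has_real_derivative 2 * (D s \<bullet> (X' s - Y' s))) (at s)"
      using has_derivative_inner[OF D'[unfolded has_vector_derivative_def] D'[unfolded has_vector_derivative_def]]
      unfolding has_field_derivative_def
      by (rule has_derivative_eq_rhs) (auto simp: inner_commute algebra_simps)
    then have q': "(q has_real_derivative (exp (- K * s) * (2 * (D s \<bullet> (X' s - Y' s)))
        + (- K * exp (- K * s)) * (D s \<bullet> D s + d\<^sup>2))) (at s)"
      unfolding q_def by (auto intro!: derivative_eq_intros)
    have "D s \<bullet> (X' s - Y' s) \<le> norm (D s) * norm (X' s - Y' s)"
      by (rule norm_cauchy_schwarz)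
    also have "\<dots> \<le> norm (D s) * (L * norm (D s) + d)"
      using b[of s] s t by (intro mult_left_mono) (auto simp: D_def)
    finally have 1: "2 * (D s \<bullet> (X' s - Y' s)) \<le> 2 * L * (norm (D s))\<^sup>2 + 2 * norm (D s) * d"
      by (simp add: algebra_simps power2_eq_square)
    have "2 * norm (D s) * d \<le> (norm (D s))\<^sup>2 + d\<^sup>2" by (rule sum_squares_bound)
    with 1 have "2 * (D s \<bullet> (X' s - Y' s)) \<le> (2 * L + 1) * (norm (D s))\<^sup>2 + 1 * d\<^sup>2"
      by (simp add: algebra_simps)
    also have "\<dots> \<le> K * (norm (D s))\<^sup>2 + K * d\<^sup>2"
      unfolding K_def using \<open>L \<ge> 0\<close> by (intro add_mono mult_right_mono) auto
    finally have "2 * (D s \<bullet> (X' s - Y' s)) - K * (D s \<bullet> D s + d\<^sup>2) \<le> 0"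
      by (simp add: power2_norm_eq_inner algebra_simps)
    then have "exp (- K * s) * (2 * (D s \<bullet> (X' s - Y' s)) - K * (D s \<bullet> D s + d\<^sup>2)) \<le> 0"
      by (intro mult_nonneg_nonpos) auto
    then show "\<exists>y. (q has_real_derivative y) (at s) \<and> y \<le> 0"
      using q' by (intro exI conjI) (auto simp: algebra_simps)
  qed
  then have "D t \<bullet> D t + d\<^sup>2 \<le> exp (K * t) * (D 0 \<bullet> D 0 + d\<^sup>2)"
  proof -
    assume "q t \<le> q 0"
    then have "exp (K * t) * q t \<le> exp (K * t) * q 0" by (intro mult_left_mono) auto
    then show ?thesis unfolding q_def by (simp add: mult.assoc[symmetric] exp_add[symmetric])
  qed
  then have "(norm (D t))\<^sup>2 \<le> exp (K * t) * ((norm (D 0))\<^sup>2 + d\<^sup>2)"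
    using zero_le_power2[of d] unfolding power2_norm_eq_inner by linarith
  also have "\<dots> \<le> exp (2 * ((L + 1) * t)) * (norm (D 0) + d)\<^sup>2"
    using t \<open>d \<ge> 0\<close> by (intro mult_mono) (auto simp: K_def power2_sum algebra_simps)
  also have "\<dots> = (exp ((L + 1) * t) * (norm (D 0) + d))\<^sup>2"
    by (simp add: power_mult_distrib exp_double)
  finally show ?thesis
    unfolding D_def by (rule power2_le_imp_le) (use \<open>d \<ge> 0\<close> in auto)
qed

lemma solves_unique:
  fixes G :: "'a::euclidean_space \<Rightarrow> 'a"
  assumes lip: "L-lipschitz_on UNIV G" and T: "0 \<le> t" "t \<le> T"
    and X: "continuous_on {0..T} X" "\<And>t. 0 < t \<Longrightarrow> t < T \<Longrightarrow> (X has_vector_derivative G (X t)) (at t)"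
  shows "X t = sol G (X 0) t"
proof -
  note s = sol_solves[OF lip, of "X 0"]
  have "norm (X t - sol G (X 0) t) \<le> exp ((L + 1) * t) * (norm (X 0 - sol G (X 0) 0) + 0)"
  proof (rule gronwall_perturbed[where T=T, OF X])
    show "continuous_on {0..T} (sol G (X 0))"
      using continuous_on_subset[OF solves_continuous_on[OF s(2)]] by auto
    show "(sol G (X 0) has_vector_derivative G (sol G (X 0) t)) (at t)" if "0 < t" for t
      using s(2) that by (auto simp: solves_def intro!: has_vector_derivative_at_of_within_Ici)
    show "norm (G (X t) - G (sol G (X 0) t)) \<le> L * norm (X t - sol G (X 0) t) + 0" for t
      using lipschitz_onD[OF lip] by (simp add: dist_norm)
  qed (use T lipschitz_on_nonneg[OF lip] in auto)
  then show ?thesis using s(1) by simp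
qed

lemma flow1_dist:
  fixes G H :: "'a::euclidean_space \<Rightarrow> 'a"
  assumes G: "L-lipschitz_on UNIV G" and H: "L'-lipschitz_on UNIV H"
    and d: "\<And>y. norm (G y - H y) \<le> d"
  shows "norm (flow1 G x - flow1 H y) \<le> exp (L + 1) * (norm (x - y) + d)"
proof -
  note s = sol_solves[OF G, of x] sol_solves[OF H, of y]
  have "norm (sol G x 1 - sol H y 1) \<le> exp ((L + 1) * 1) * (norm (sol G x 0 - sol H y 0) + d)"
  proof (rule gronwall_perturbed[where T=1])
    show "continuous_on {0..1} (sol G x)" "continuous_on {0..1} (sol H y)"
      using s(2,4) by (auto intro: continuous_on_subset[OF solves_continuous_on])
    show "(sol G x has_vector_derivative G (sol G x t)) (at t)" if "0 < t" for t
      using s that by (auto simp: solves_def intro!: has_vector_derivative_at_of_within_Ici)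
    show "(sol H y has_vector_derivative H (sol H y t)) (at t)" if "0 < t" for t
      using s that by (auto simp: solves_def intro!: has_vector_derivative_at_of_within_Ici)
    show "norm (G (sol G x t) - H (sol H y t)) \<le> L * norm (sol G x t - sol H y t) + d" for t
    proof -
      have "norm (G (sol G x t) - H (sol H y t)) \<le> norm (G (sol G x t) - G (sol H y t)) + norm (G (sol H y t) - H (sol H y t))"
        using norm_triangle_ineq[of "G (sol G x t) - G (sol H y t)" "G (sol H y t) - H (sol H y t)"] by simp
      then show ?thesis using d[of "sol H y t"] lipschitz_onD[OF G, of "sol G x t" "sol H y t"] by (simp add: dist_norm)
    qed
  qed (use lipschitz_on_nonneg[OF G] order_trans[OF norm_ge_zero d] in auto)
  then show ?thesis using s unfolding flow1_def by simp
qed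

lemma solves_scale_shift:
  assumes "solves G X" "c \<ge> 0" "a \<ge> 0"
  shows "solves (\<lambda>y. c *\<^sub>R G y) (\<lambda>t. X (c * t + a))"
  unfolding solves_def
proof clarify
  fix t :: real assume t: "t \<ge> 0"
  have "(X has_vector_derivative G (X (c * t + a))) (at (c * t + a) within {0..})"
    using assms t by (auto simp: solves_def)
  then have "(X has_vector_derivative G (X (c * t + a))) (at (c * t + a) within (\<lambda>t. c * t + a) ` {0..})"
    by (rule has_vector_derivative_within_subset) (use assms in auto)
  moreover have "((\<lambda>t. c * t + a) has_vector_derivative c) (at t within {0..})"
    by (auto intro!: derivative_eq_intros)
  ultimately show "((\<lambda>t. X (c * t + a)) has_vector_derivative c *\<^sub>R G (X (c * t + a))) (at t within {0..})"
    using vector_diff_chain_within[of "\<lambda>t. c * t + a" c t "{0..}" X] by (simp add: o_def)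
qed

lemma solves_eq_sol:
  fixes G :: "'a::euclidean_space \<Rightarrow> 'a"
  assumes "L-lipschitz_on UNIV G" "solves G X" "t \<ge> 0"
  shows "X t = sol G (X 0) t"
proof (rule solves_unique[where T="t", OF assms(1)])
  show "continuous_on {0..t} X"
    by (rule continuous_on_subset[OF solves_continuous_on[OF assms(2)]]) auto
  show "(X has_vector_derivative G (X s)) (at s)" if "0 < s" for s
    using assms(2) that by (intro has_vector_derivative_at_of_within_Ici) (auto simp: solves_def)
qed (use assms in auto)

lemma lipschitz_on_scaleR_field:
  fixes G :: "'a::metric_space \<Rightarrow> 'b::real_normed_vector"
  assumes "L-lipschitz_on U G"
  shows "(\<bar>c\<bar> * L)-lipschitz_on U (\<lambda>y. c *\<^sub>R G y)"
proof (rule lipschitz_onI)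
  fix x y assume "x \<in> U" "y \<in> U"
  then have "\<bar>c\<bar> * dist (G x) (G y) \<le> \<bar>c\<bar> * (L * dist x y)"
    by (intro mult_left_mono lipschitz_onD[OF assms]) auto
  then show "dist (c *\<^sub>R G x) (c *\<^sub>R G y) \<le> \<bar>c\<bar> * L * dist x y"
  proof -
    assume *: "\<bar>c\<bar> * dist (G x) (G y) \<le> \<bar>c\<bar> * (L * dist x y)"
    have "dist (c *\<^sub>R G x) (c *\<^sub>R G y) = \<bar>c\<bar> * dist (G x) (G y)"
      by (simp add: dist_norm scaleR_diff_right[symmetric])
    then show ?thesis using * by (simp add: mult.assoc)
  qed
qed (use lipschitz_on_nonneg[OF assms] in auto)

lemma sol_eq_flow1:
  fixes G :: "'a::euclidean_space \<Rightarrow> 'a"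
  assumes "L-lipschitz_on UNIV G" "t \<ge> 0"
  shows "sol G x t = flow1 (\<lambda>y. t *\<^sub>R G y) x"
proof -
  note s = sol_solves[OF assms(1), of x]
  have "solves (\<lambda>y. t *\<^sub>R G y) (\<lambda>\<sigma>. sol G x (t * \<sigma> + 0))"
    by (rule solves_scale_shift) (use assms s in auto)
  from solves_eq_sol[OF lipschitz_on_scaleR_field[OF assms(1)] this, of 1] s(1) show ?thesis
    by (simp add: flow1_def)
qed

lemma sol_Suc:
  fixes G :: "'a::euclidean_space \<Rightarrow> 'a"
  assumes "L-lipschitz_on UNIV G"
  shows "sol G x (real (Suc k)) = flow1 G (sol G x (real k))"
proof -
  note s = sol_solves[OF assms(1), of x]
  have "solves (\<lambda>y. 1 *\<^sub>R G y) (\<lambda>\<sigma>. sol G x (1 * \<sigma> + real k))"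
    by (rule solves_scale_shift) (use assms s in auto)
  then have "solves G (\<lambda>\<sigma>. sol G x (\<sigma> + real k))" by simp
  from solves_eq_sol[OF assms(1) this, of 1] show ?thesis
    by (simp add: flow1_def add.commute)
qed

lemma flow1_zero:
  "flow1 (\<lambda>y::'a::euclidean_space. 0) x = x"
proof -
  have "solves (\<lambda>y. 0) (\<lambda>t. x)" by (auto simp: solves_def)
  moreover have "0-lipschitz_on UNIV (\<lambda>y::'a. 0::'a)" by (auto intro: lipschitz_onI)
  ultimately show ?thesis using solves_eq_sol[of 0 "\<lambda>y. 0" "\<lambda>t. x" 1] by (simp add: flow1_def)
qed

lemma norm_flow1_diff_le:
  fixes G :: "'a::euclidean_space \<Rightarrow> 'a"
  assumes lip: "L-lipschitz_on UNIV G" and b: "\<And>y. norm (G y) \<le> B"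
  shows "norm (flow1 G x - x) \<le> B"
proof -
  note s = sol_solves[OF lip, of x]
  have "norm (sol G x 1 - sol G x 0) \<le> B * norm (1 - 0 :: real)"
  proof (rule differentiable_bound[of "{0..1}"])
    fix t :: real assume t: "t \<in> {0..1}"
    have "(sol G x has_derivative (\<lambda>h. h *\<^sub>R G (sol G x t))) (at t within {0..})"
      using s(2) t by (auto simp: solves_def has_vector_derivative_def)
    then show "(sol G x has_derivative (\<lambda>h. h *\<^sub>R G (sol G x t))) (at t within {0..1})"
      by (rule has_derivative_subset) auto
    show "onorm (\<lambda>h. h *\<^sub>R G (sol G x t)) \<le> B"
      by (rule onorm_bound) (use b order_trans[OF norm_ge_zero b] in \<open>auto simp: mult.commute[of B] intro!: mult_left_mono\<close>)
  qed auto
  then show ?thesis using s by (simp add: flow1_def)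
qed

text \<open>Composing \<open>G\<close> with the nearest point projection onto \<open>W\<close> gives
  a Lipschitz field with all values in \<open>W\<close>. Its solution never leaves \<open>W\<close>,
  so there the two fields agree along it, and uniqueness identifies it with the solution for
  \<open>G\<close>.\<close>

lemma sol_in_subspace:
  fixes G :: "'a::euclidean_space \<Rightarrow> 'a"
  assumes lip: "L-lipschitz_on UNIV G" and W: "subspace W" and G: "\<And>y. y \<in> W \<Longrightarrow> G y \<in> W"
    and x: "x \<in> W" and t: "t \<ge> 0"
  shows "sol G x t \<in> W"
proof -
  have ne: "W \<noteq> {}" "closed W" "convex W" using x W closed_subspace subspace_imp_convex by auto
  define G' where "G' = (\<lambda>y. G (closest_point W y))"
  have lip': "L-lipschitz_on UNIV G'"
  proof (rule lipschitz_onI)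
    fix y z
    have "dist (G' y) (G' z) \<le> L * dist (closest_point W y) (closest_point W z)"
      unfolding G'_def using lipschitz_onD[OF lip] by auto
    also have "\<dots> \<le> L * dist y z"
      by (intro mult_left_mono closest_point_lipschitz ne lipschitz_on_nonneg[OF lip])
    finally show "dist (G' y) (G' z) \<le> L * dist y z" .
  qed (rule lipschitz_on_nonneg[OF lip])
  have G': "G' y \<in> W" for y
    unfolding G'_def using ne by (intro G closest_point_in_set)
  note s = sol_solves[OF lip', of x]
  \<comment> \<open>A vector orthogonal to \<open>W\<close> has constant inner product with this
    solution. The residual \<open>w\<close> of the projection is such a vector, hence it is
    orthogonal to the solution and then to itself.\<close>
  have inW: "sol G' x t \<in> W" if "t \<ge> 0" for t
  proof -
    have "w \<bullet> sol G' x t = w \<bullet> x" if w: "\<And>y. y \<in> W \<Longrightarrow> w \<bullet> y = 0" for w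
    proof -
      have "\<exists>c. \<forall>t\<in>{0..}. w \<bullet> sol G' x t = c"
      proof (rule has_derivative_zero_constant)
        fix s :: real assume "s \<in> {0..}"
        then have "(sol G' x has_derivative (\<lambda>h. h *\<^sub>R G' (sol G' x s))) (at s within {0..})"
          using s(2) by (auto simp: solves_def has_vector_derivative_def)
        from has_derivative_inner_right[OF this, of w]
        show "((\<lambda>t. w \<bullet> sol G' x t) has_derivative (\<lambda>h. 0)) (at s within {0..})"
          using w[OF G'] by simp
      qed auto
      then obtain c where c: "\<And>t. t \<ge> 0 \<Longrightarrow> w \<bullet> sol G' x t = c" by auto
      from c[of 0] c[OF \<open>t \<ge> 0\<close>] show ?thesis using s(1) by simp
    qed
    note 1 = this
    define w where "w = sol G' x t - closest_point W (sol G' x t)"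
    have cw: "closest_point W (sol G' x t) \<in> W" using ne by (intro closest_point_in_set)
    have orth: "w \<bullet> y = 0" if "y \<in> W" for y
    proof -
      have le: "w \<bullet> (z - closest_point W (sol G' x t)) \<le> 0" if "z \<in> W" for z
        unfolding w_def by (rule closest_point_dot[OF ne(3,2) that])
      have "w \<bullet> y \<le> 0" using le[of "closest_point W (sol G' x t) + y"] W cw that by (simp add: subspace_add)
      moreover have "w \<bullet> y \<ge> 0" using le[of "closest_point W (sol G' x t) - y"] W cw that by (simp add: subspace_diff)
      ultimately show ?thesis by simp
    qed
    have "w \<bullet> sol G' x t = 0" using 1[OF orth] orth[OF x] by simp
    then have "w \<bullet> w = 0" using orth[OF cw] by (simp add: w_def inner_diff_right)
    then show ?thesis using cw by (simp add: w_def)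
  qed
  have "closest_point W y = y" if "y \<in> W" for y using that by (rule closest_point_self)
  then have "solves G (sol G' x)"
    using s(2) inW unfolding solves_def G'_def by auto
  from solves_eq_sol[OF lip this t] show ?thesis using inW[OF t] s(1) by simp
qed

section \<open>Transporting the rank condition along the fibre\<close>

lemma bounded_bilinear_matrix_mult:
  "bounded_bilinear ((**) :: real^'n^'m \<Rightarrow> real^'k^'n \<Rightarrow> real^'k^'m)"
proof -
  have "bilinear ((**) :: real^'n^'m \<Rightarrow> real^'k^'n \<Rightarrow> real^'k^'m)"
    unfolding bilinear_def
    by (intro conjI allI linearI)
      (simp_all add: matrix_matrix_mult_def vec_eq_iff sum.distrib algebra_simps sum_distrib_left)
  then show ?thesis using bilinear_conv_bounded_bilinear by blast
qed

lemma bounded_bilinear_matrix_vector_mult: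
  "bounded_bilinear ((*v) :: real^'n^'m \<Rightarrow> real^'n \<Rightarrow> real^'m)"
proof -
  have "bilinear ((*v) :: real^'n^'m \<Rightarrow> real^'n \<Rightarrow> real^'m)"
    unfolding bilinear_def
    by (intro conjI allI linearI)
      (simp_all add: matrix_vector_mult_add_rdistrib scaleR_matrix_vector_assoc matrix_vector_right_distrib matrix_vector_mult_scaleR)
  then show ?thesis using bilinear_conv_bounded_bilinear by blast
qed

text \<open>The inner product of the matrix type is the trace form tr (A^T B). Moving factors across
  it is how the derivative of the trace functional is computed later.\<close>

lemma inner_matrix_mult_left:
  "(A :: real^'n^'m) \<bullet> ((B :: real^'k^'m) ** C) = (transpose B ** A) \<bullet> C"
proof -
  have "A \<bullet> (B ** C) = (\<Sum>i\<in>UNIV. \<Sum>j\<in>UNIV. \<Sum>k\<in>UNIV. A$i$j * (B$i$k * C$k$j))"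
    by (simp add: inner_vec_def matrix_matrix_mult_def sum_distrib_left)
  also have "\<dots> = (\<Sum>j\<in>UNIV. \<Sum>i\<in>UNIV. \<Sum>k\<in>UNIV. A$i$j * (B$i$k * C$k$j))" by (rule sum.swap)
  also have "\<dots> = (\<Sum>j\<in>UNIV. \<Sum>k\<in>UNIV. \<Sum>i\<in>UNIV. A$i$j * (B$i$k * C$k$j))"
    by (rule sum.cong[OF refl], rule sum.swap)
  also have "\<dots> = (\<Sum>k\<in>UNIV. \<Sum>j\<in>UNIV. \<Sum>i\<in>UNIV. A$i$j * (B$i$k * C$k$j))" by (rule sum.swap)
  also have "\<dots> = (transpose B ** A) \<bullet> C"
    by (simp add: inner_vec_def matrix_matrix_mult_def transpose_def sum_distrib_right) (simp add: mult_ac)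
  finally show ?thesis .
qed

lemma inner_transpose: "transpose (A :: real^'n^'m) \<bullet> transpose B = A \<bullet> B"
  by (simp add: inner_vec_def transpose_def) (rule sum.swap)

lemma inner_matrix_mult_right:
  "(A :: real^'n^'m) \<bullet> ((B :: real^'k^'m) ** C) = (A ** transpose C) \<bullet> B"
proof -
  have "A \<bullet> (B ** C) = transpose A \<bullet> (transpose C ** transpose B)"
    by (simp add: matrix_transpose_mul[symmetric] inner_transpose)
  also have "\<dots> = (C ** transpose A) \<bullet> transpose B" by (simp add: inner_matrix_mult_left transpose_transpose)
  also have "\<dots> = transpose (A ** transpose C) \<bullet> transpose B" by (simp add: matrix_transpose_mul transpose_transpose)
  also have "\<dots> = (A ** transpose C) \<bullet> B" by (rule inner_transpose)
  finally show ?thesis .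
qed

text \<open>The quadratic form attains a positive minimum on the unit sphere, and homogeneity of
  degree two spreads it to all vectors.\<close>

lemma Sym_pos_coercive:
  assumes P: "(P :: real^'n^'n) \<in> Sym_pos"
  obtains c where "c > 0" "\<And>x. c * (norm x)\<^sup>2 \<le> x \<bullet> (P *v x)"
proof -
  have cont: "continuous_on (sphere 0 1) (\<lambda>x. x \<bullet> (P *v x))"
    by (intro continuous_intros matrix_vector_mult_linear_continuous_on)
  obtain u :: "real^'n" where u: "norm u = 1" using vector_choose_size[of 1] by auto
  have "sphere (0 :: real^'n) 1 \<noteq> {}" using u by auto
  then obtain x0 where x0: "x0 \<in> sphere 0 1" "\<And>x. x \<in> sphere 0 1 \<Longrightarrow> x0 \<bullet> (P *v x0) \<le> x \<bullet> (P *v x)"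
    using continuous_attains_inf[OF compact_sphere _ cont] by blast
  define c where "c = x0 \<bullet> (P *v x0)"
  have "x0 \<noteq> 0" using x0(1) by auto
  then have "c > 0" using P unfolding c_def Sym_pos_def by blast
  moreover have "c * (norm x)\<^sup>2 \<le> x \<bullet> (P *v x)" for x
  proof (cases "x = 0")
    case False
    define y where "y = (1 / norm x) *\<^sub>R x"
    have y: "y \<in> sphere 0 1" "x = norm x *\<^sub>R y" unfolding y_def using False by auto
    have "x \<bullet> (P *v x) = (norm x)\<^sup>2 * (y \<bullet> (P *v y))"
      by (subst (1 2) y(2)) (simp add: matrix_vector_mult_scaleR power2_eq_square)
    then show ?thesis using mult_left_mono[OF x0(2)[OF y(1)], of "(norm x)\<^sup>2"] unfolding c_def by (simp add: mult.commute)
  qed simp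
  ultimately show ?thesis by (rule that)
qed

text \<open>Since \<open>P\<close> is symmetric, the rows of \<open>Z ** P\<close> are
  \<open>P\<close> applied to the rows of \<open>Z\<close>; the form splits into the quadratic forms
  of the rows.\<close>

lemma inner_mult_coercive:
  assumes P: "\<And>x :: real^'n. c * (norm x)\<^sup>2 \<le> x \<bullet> (P *v x)" and sym: "transpose P = P"
  shows "c * (norm (Z :: real^'n^'m))\<^sup>2 \<le> Z \<bullet> (Z ** P)"
proof -
  have row: "(Z ** P) $ i = P *v (Z $ i)" for i
  proof -
    have "(Z ** P) $ i = transpose P *v (Z $ i)"
      by (simp add: matrix_matrix_mult_def matrix_vector_mult_def transpose_def vec_eq_iff mult.commute)
    then show ?thesis using sym by simp
  qed
  have "c * (norm Z)\<^sup>2 = (\<Sum>i\<in>UNIV. c * (norm (Z $ i))\<^sup>2)"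
    unfolding power2_norm_eq_inner inner_vec_def[of Z] by (simp add: sum_distrib_left)
  also have "\<dots> \<le> (\<Sum>i\<in>UNIV. Z $ i \<bullet> (P *v (Z $ i)))" by (rule sum_mono) (rule P)
  also have "\<dots> = Z \<bullet> (Z ** P)" unfolding inner_vec_def[of Z] row ..
  finally show ?thesis .
qed

lemma Sym_pos_inverse:
  assumes P: "(P :: real^'n^'n) \<in> Sym_pos"
  obtains Pi where "Pi \<in> Sym_pos" "P ** Pi = mat 1" "Pi ** P = mat 1"
proof -
  have sym: "transpose P = P" and pos: "\<And>x. x \<noteq> 0 \<Longrightarrow> x \<bullet> (P *v x) > 0" using P by (auto simp: Sym_pos_def)
  have "\<forall>x. P *v x = 0 \<longrightarrow> x = 0" using pos by force
  then obtain Pi where Pi: "Pi ** P = mat 1" using matrix_left_invertible_ker[of P] by blast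
  then have PPi: "P ** Pi = mat 1" by (rule matrix_left_right_inverse[THEN iffD1])
  have "transpose Pi ** P = mat 1"
    using arg_cong[OF PPi, of transpose] by (simp add: matrix_transpose_mul sym transpose_mat)
  then have "transpose Pi ** P ** Pi = Pi" by simp
  then have sPi: "transpose Pi = Pi" by (simp add: matrix_mul_assoc[symmetric] PPi)
  have "x \<bullet> (Pi *v x) > 0" if "x \<noteq> 0" for x
  proof -
    have x: "x = P *v (Pi *v x)" by (simp add: matrix_vector_mul_assoc PPi)
    then have "Pi *v x \<noteq> 0" using that by auto
    from pos[OF this] show ?thesis using x by (simp add: inner_commute)
  qed
  then have "Pi \<in> Sym_pos" using sPi by (simp add: Sym_pos_def)
  then show ?thesis using PPi Pi by (rule that)
qed

section \<open>One-parameter groups and the factorization of P inside a normalizer\<close>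

lemma bounded_linear_imp_lipschitz:
  assumes "bounded_linear G"
  obtains L where "L-lipschitz_on UNIV G"
proof -
  obtain L where "\<And>x. norm (G x) \<le> norm x * L" "0 < L" using bounded_linear.pos_bounded[OF assms] by blast
  then have L: "norm (G (x - y)) \<le> L * norm (x - y)" "0 < L" for x y by (auto simp: mult.commute)
  have "L-lipschitz_on UNIV G"
  proof (rule lipschitz_onI)
    fix x y
    have "dist (G x) (G y) = norm (G (x - y))"
      by (simp add: dist_norm linear_diff[OF bounded_linear.linear[OF assms]])
    then show "dist (G x) (G y) \<le> L * dist x y" using L(1)[of x y] by (simp add: dist_norm)
  qed (use L(2) in simp)
  then show ?thesis by (rule that)
qed

lemmas mult_deriv = bounded_bilinear.has_vector_derivative[OF bounded_bilinear_matrix_mult]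
lemmas bl_left = bounded_bilinear.bounded_linear_left[OF bounded_bilinear_matrix_mult]
lemmas bl_right = bounded_bilinear.bounded_linear_right[OF bounded_bilinear_matrix_mult]

lemma matrix_mult_minus: "(- A) ** B = - (A ** (B :: real^'k^'n))" "A ** (- B) = - (A ** B)" for A :: "real^'n^'m"
  by (simp_all add: matrix_matrix_mult_def vec_eq_iff sum_negf)

text \<open>\<open>X\<close> is exp (t A) and \<open>Y\<close> is exp (- t A), both obtained as
  solutions of linear equations. The conjugate \<open>X t ** C ** Y t\<close> solves Z' = A Z - Z A,
  whose right-hand side maps \<open>g\<close> to itself, so \<open>sol_in_subspace\<close> keeps it
  in \<open>g\<close>.\<close>

lemma matrix_one_parameter_curve:
  fixes A :: "real^'n^'n"
  assumes g: "subspace g" "\<And>B C. B \<in> g \<Longrightarrow> C \<in> g \<Longrightarrow> B ** C - C ** B \<in> g" and A: "A \<in> g"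
  obtains X Y where "X 0 = mat 1" "Y 0 = mat 1"
    "\<And>t. t \<ge> 0 \<Longrightarrow> X t ** Y t = mat 1 \<and> Y t ** X t = mat 1"
    "\<And>t C. t \<ge> 0 \<Longrightarrow> C \<in> g \<Longrightarrow> X t ** C ** Y t \<in> g"
    "(X has_vector_derivative A) (at 0 within {0..})" "(Y has_vector_derivative - A) (at 0 within {0..})"
proof -
  obtain L1 where L1: "L1-lipschitz_on UNIV (\<lambda>Z :: real^'n^'n. A ** Z)"
    using bounded_linear_imp_lipschitz[OF bl_right] by blast
  obtain L2 where L2: "L2-lipschitz_on UNIV (\<lambda>Z :: real^'n^'n. Z ** (- A))"
    using bounded_linear_imp_lipschitz[OF bl_left] by blast
  obtain L3 where L3: "L3-lipschitz_on UNIV (\<lambda>Z :: real^'n^'n. A ** Z - Z ** A)"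
    using bounded_linear_imp_lipschitz[OF bounded_linear_sub[OF bl_right bl_left]] by blast
  define X where "X = sol (\<lambda>Z. A ** Z) (mat 1)"
  define Y where "Y = sol (\<lambda>Z. Z ** (- A)) (mat 1)"
  have X0: "X 0 = mat 1" unfolding X_def by (rule sol_solves(1)[OF L1])
  have Y0: "Y 0 = mat 1" unfolding Y_def by (rule sol_solves(1)[OF L2])
  have dX: "(X has_vector_derivative A ** X t) (at t within {0..})" if "t \<ge> 0" for t
    using sol_solves(2)[OF L1, of "mat 1"] that unfolding X_def solves_def by blast
  have dY: "(Y has_vector_derivative Y t ** (- A)) (at t within {0..})" if "t \<ge> 0" for t
    using sol_solves(2)[OF L2, of "mat 1"] that unfolding Y_def solves_def by blast
  \<comment> \<open>In this order the two derivative terms Y A X and - Y A X cancel at once; for X Y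
    they would not. The other order follows since a one-sided inverse of a square matrix is
    two-sided.\<close>
  have YX: "Y t ** X t = mat 1" if t: "t \<ge> 0" for t
  proof -
    have "((\<lambda>t. Y t ** X t) has_vector_derivative 0) (at s within {0..})" if "s \<in> {0..}" for s
      using mult_deriv[OF dY[of s] dX[of s]] that by (simp add: matrix_mult_minus matrix_mul_assoc)
    then have "\<exists>c. \<forall>s\<in>{0..}. Y s ** X s = c"
      by (intro has_derivative_zero_constant) (auto simp: has_vector_derivative_def)
    then obtain c where c: "\<And>s. s \<ge> 0 \<Longrightarrow> Y s ** X s = c" by auto
    show ?thesis using c[OF t] c[of 0] X0 Y0 by simp
  qed
  then have XY: "X t ** Y t = mat 1" if "t \<ge> 0" for t
    using that matrix_left_right_inverse[of "X t" "Y t"] by blast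
  have inv: "X t ** C ** Y t \<in> g" if t: "t \<ge> 0" and C: "C \<in> g" for t C
  proof -
    have "solves (\<lambda>Z. A ** Z - Z ** A) (\<lambda>t. X t ** C ** Y t)"
      unfolding solves_def
    proof (intro allI impI)
      fix s :: real assume s: "s \<ge> 0"
      have "((\<lambda>t. X t ** C) has_vector_derivative (X s ** 0 + A ** X s ** C)) (at s within {0..})"
        by (rule mult_deriv[OF dX[OF s]]) simp
      from mult_deriv[OF this dY[OF s]]
      show "((\<lambda>t. X t ** C ** Y t) has_vector_derivative A ** (X s ** C ** Y s) - X s ** C ** Y s ** A) (at s within {0..})"
        by (simp add: matrix_mult_minus matrix_mul_assoc)
    qed
    from solves_eq_sol[OF L3 this t]
    have "X t ** C ** Y t = sol (\<lambda>Z. A ** Z - Z ** A) C t" by (simp add: X0 Y0)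
    then show ?thesis using sol_in_subspace[OF L3 g(1) g(2)[OF A] C t] by simp
  qed
  show ?thesis
    by (rule that[of X Y]) (use X0 Y0 XY YX inv dX[of 0] dY[of 0] in auto)
qed

text \<open>The vector Q x - x is sent by Q to its negative, which positivity allows only for the
  zero vector.\<close>

lemma symmetric_involution_pos:
  assumes Q: "\<And>x. x \<noteq> 0 \<Longrightarrow> x \<bullet> (Q *v x) > (0::real)" and QQ: "Q ** Q = mat (1::real)"
  shows "Q = mat 1"
proof -
  have "Q *v x = x" for x
  proof -
    define y where "y = Q *v x - x"
    have "Q *v y = - y"
      unfolding y_def by (simp add: matrix_vector_mult_diff_distrib matrix_vector_mul_assoc QQ)
    then have "y \<bullet> (Q *v y) \<le> 0" by simp
    then have "y = 0" using Q[of y] by force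
    then show ?thesis by (simp add: y_def)
  qed
  then have "Q *v x = mat 1 *v x" for x by simp
  then show ?thesis using matrix_eq by blast
qed

text \<open>A polar-type decomposition with the factor constrained to the normalizer of
  \<open>g\<close>. Minimality is only tested in directions of \<open>g\<close>, and
  \<open>onto\<close> says that these see every symmetric matrix, so the constrained critical point
  equation is as strong as the unconstrained one.\<close>

lemma normalizer_factorization:
  fixes g :: "(real^'n^'n) set"
  assumes g: "subspace g" "\<And>B C. B \<in> g \<Longrightarrow> C \<in> g \<Longrightarrow> B ** C - C ** B \<in> g"
    and onto: "\<And>S. transpose S = S \<Longrightarrow> \<exists>A\<in>g. A + transpose A = S"
    and P: "P \<in> Sym_pos"
  obtains B B' where "B ** B' = mat 1" "B' ** B = mat 1" "\<And>A. A \<in> g \<Longrightarrow> B ** A ** B' \<in> g"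
    "P = B ** transpose B"
proof -
  obtain Pi where Pi: "Pi \<in> Sym_pos" "P ** Pi = mat 1" "Pi ** P = mat 1" using Sym_pos_inverse[OF P] .
  have sym: "transpose P = P" "transpose Pi = Pi" using P Pi(1) by (auto simp: Sym_pos_def)
  \<comment> \<open>The inverse is carried as a second component: this makes the set of invertible
    matrices closed, and the two halves of \<open>\<phi>\<close> bound the two components.\<close>
  define N where "N = {Z. fst Z ** snd Z = mat 1 \<and> snd Z ** fst Z = mat 1 \<and> (\<forall>A\<in>g. fst Z ** A ** snd Z \<in> g)}"
  define \<phi> where "\<phi> = (\<lambda>Z :: (real^'n^'n) \<times> (real^'n^'n). snd Z \<bullet> (snd Z ** P) + fst Z \<bullet> (Pi ** fst Z))"
  note cm = bounded_bilinear.continuous_on[OF bounded_bilinear_matrix_mult]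
  have cont: "continuous_on UNIV \<phi>" unfolding \<phi>_def by (intro continuous_intros cm)
  have closedN: "closed N"
  proof -
    have "N = {Z. fst Z ** snd Z = mat 1} \<inter> {Z. snd Z ** fst Z = mat 1} \<inter> (\<Inter>A\<in>g. (\<lambda>Z. fst Z ** A ** snd Z) -` g)"
      unfolding N_def by auto
    moreover have "closed {Z. fst Z ** snd Z = (mat 1 :: real^'n^'n)}" "closed {Z. snd Z ** fst Z = (mat 1 :: real^'n^'n)}"
      by (intro closed_Collect_eq cm continuous_intros)+
    moreover have "closed ((\<lambda>Z. fst Z ** A ** snd Z) -` g)" for A
      by (rule closed_vimage[OF closed_subspace[OF g(1)]]) (intro cm continuous_intros)
    ultimately show ?thesis by (auto intro!: closed_Int closed_INT)
  qed
  obtain c1 where c1: "c1 > 0" "\<And>x. c1 * (norm x)\<^sup>2 \<le> x \<bullet> (P *v x)" using Sym_pos_coercive[OF P] by blast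
  obtain c2 where c2: "c2 > 0" "\<And>x. c2 * (norm x)\<^sup>2 \<le> x \<bullet> (Pi *v x)" using Sym_pos_coercive[OF Pi(1)] by blast
  have lower: "c1 * (norm (snd Z))\<^sup>2 + c2 * (norm (fst Z))\<^sup>2 \<le> \<phi> Z" for Z
  proof -
    have "fst Z \<bullet> (Pi ** fst Z) = transpose (fst Z) \<bullet> (transpose (fst Z) ** Pi)"
      using inner_transpose[of "fst Z" "Pi ** fst Z"] by (simp add: matrix_transpose_mul sym)
    moreover have "norm (transpose (fst Z)) = norm (fst Z)"
      by (simp add: norm_eq_sqrt_inner inner_transpose)
    ultimately show ?thesis
      using inner_mult_coercive[OF c1(2) sym(1), of "snd Z"] inner_mult_coercive[OF c2(2) sym(2), of "transpose (fst Z)"]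
      unfolding \<phi>_def by simp
  qed
  have one: "(mat 1, mat 1) \<in> N" unfolding N_def by simp
  define v where "v = \<phi> (mat 1, mat 1)"
  define N1 where "N1 = N \<inter> {Z. \<phi> Z \<le> v}"
  have "compact N1"
    unfolding compact_eq_bounded_closed
  proof
    show "closed N1" unfolding N1_def by (intro closed_Int closedN closed_Collect_le cont) auto
    show "bounded N1"
    proof (rule boundedI)
      fix Z assume "Z \<in> N1"
      then have v: "\<phi> Z \<le> v" unfolding N1_def by simp
      have nn: "0 \<le> c1 * (norm (snd Z))\<^sup>2" "0 \<le> c2 * (norm (fst Z))\<^sup>2" using c1(1) c2(1) by auto
      then have "c1 * (norm (snd Z))\<^sup>2 \<le> v" "c2 * (norm (fst Z))\<^sup>2 \<le> v" using lower[of Z] v by linarith+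
      then have "(norm (snd Z))\<^sup>2 \<le> v / c1" "(norm (fst Z))\<^sup>2 \<le> v / c2"
        using c1(1) c2(1) by (auto simp: pos_le_divide_eq mult.commute)
      then have "norm (snd Z) \<le> sqrt (v / c1)" "norm (fst Z) \<le> sqrt (v / c2)" by (auto intro: real_le_rsqrt)
      then show "norm Z \<le> sqrt (v / c2) + sqrt (v / c1)"
        using norm_Pair_le[of "fst Z" "snd Z"] by simp
    qed
  qed
  moreover have "N1 \<noteq> {}" using one unfolding N1_def v_def by auto
  ultimately obtain Z0 where Z0: "Z0 \<in> N1" "\<And>Z. Z \<in> N1 \<Longrightarrow> \<phi> Z0 \<le> \<phi> Z"
    using continuous_attains_inf[of N1 \<phi>] continuous_on_subset[OF cont] by blast
  \<comment> \<open>The sublevel set of the value at the identity is compact, and points outside it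
    have larger values, so the minimum is global on \<open>N\<close>.\<close>
  have min: "\<phi> Z0 \<le> \<phi> Z" if "Z \<in> N" for Z
    using Z0 that unfolding N1_def by (cases "\<phi> Z \<le> v") auto
  obtain B B' where Z0B: "Z0 = (B, B')" by force
  have B: "B ** B' = mat 1" "B' ** B = mat 1" "\<And>A. A \<in> g \<Longrightarrow> B ** A ** B' \<in> g"
    using Z0(1) unfolding N1_def N_def Z0B by auto
  define Q where "Q = B' ** P ** transpose B'"
  define Q2 where "Q2 = transpose B ** Pi ** B"
  \<comment> \<open>The curve through the minimum is defined for t \<ge> 0 only, so its derivative
    at 0 is one-sided and yields an inequality. Applying it to A and to - A gives the
    equality.\<close>
  have crit: "0 \<le> A \<bullet> (Q2 - Q)" if A: "A \<in> g" for A
  proof -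
    obtain X Y where XY: "X 0 = mat 1" "Y 0 = mat 1"
      "\<And>t. t \<ge> 0 \<Longrightarrow> X t ** Y t = mat 1 \<and> Y t ** X t = mat 1"
      "\<And>t C. t \<ge> 0 \<Longrightarrow> C \<in> g \<Longrightarrow> X t ** C ** Y t \<in> g"
      "(X has_vector_derivative A) (at 0 within {0..})" "(Y has_vector_derivative - A) (at 0 within {0..})"
      using matrix_one_parameter_curve[OF g A] by blast
    have inN: "(B ** X t, Y t ** B') \<in> N" if t: "t \<ge> 0" for t
    proof -
      have "B ** X t ** (Y t ** B') = B ** (X t ** Y t) ** B'" by (simp add: matrix_mul_assoc)
      moreover have "Y t ** B' ** (B ** X t) = Y t ** (B' ** B) ** X t" by (simp add: matrix_mul_assoc)
      moreover have "B ** X t ** C ** (Y t ** B') = B ** (X t ** C ** Y t) ** B'" for C by (simp add: matrix_mul_assoc)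
      ultimately show ?thesis unfolding N_def using XY(3,4)[OF t] B by simp
    qed
    define f where "f = (\<lambda>t. \<phi> (B ** X t, Y t ** B'))"
    have dY: "((\<lambda>t. Y t ** B') has_vector_derivative (- A) ** B') (at 0 within {0..})"
      using bounded_linear.has_vector_derivative[OF bl_left XY(6)] .
    have dYP: "((\<lambda>t. Y t ** B' ** P) has_vector_derivative (- A) ** B' ** P) (at 0 within {0..})"
      using bounded_linear.has_vector_derivative[OF bl_left dY] .
    have dX: "((\<lambda>t. B ** X t) has_vector_derivative B ** A) (at 0 within {0..})"
      using bounded_linear.has_vector_derivative[OF bl_right XY(5)] .
    have dPX: "((\<lambda>t. Pi ** (B ** X t)) has_vector_derivative Pi ** (B ** A)) (at 0 within {0..})"
      using bounded_linear.has_vector_derivative[OF bl_right dX] .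
    note di = bounded_bilinear.has_vector_derivative[OF bounded_bilinear_inner]
    have "(f has_vector_derivative
        (B' \<bullet> ((- A) ** B' ** P) + ((- A) ** B') \<bullet> (B' ** P)) + (B \<bullet> (Pi ** (B ** A)) + (B ** A) \<bullet> (Pi ** B))) (at 0 within {0..})"
      unfolding f_def \<phi>_def fst_conv snd_conv
      using has_vector_derivative_add[OF di[OF dY dYP] di[OF dX dPX]] by (simp add: XY(1,2))
    moreover have "B' \<bullet> ((- A) ** B' ** P) = - (A \<bullet> Q)"
    proof -
      have "B' \<bullet> ((- A) ** B' ** P) = (B' ** P) \<bullet> ((- A) ** B')" by (subst inner_matrix_mult_right) (simp only: sym)
      also have "\<dots> = Q \<bullet> (- A)" unfolding Q_def by (rule inner_matrix_mult_right)
      finally show ?thesis by (simp add: inner_commute)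
    qed
    moreover have "((- A) ** B') \<bullet> (B' ** P) = - (A \<bullet> Q)"
    proof -
      have "((- A) ** B') \<bullet> (B' ** P) = (B' ** P) \<bullet> ((- A) ** B')" by (rule inner_commute)
      also have "\<dots> = Q \<bullet> (- A)" unfolding Q_def by (rule inner_matrix_mult_right)
      finally show ?thesis by (simp add: inner_commute)
    qed
    moreover have "B \<bullet> (Pi ** (B ** A)) = A \<bullet> Q2"
    proof -
      have "B \<bullet> (Pi ** (B ** A)) = (Pi ** B) \<bullet> (B ** A)" by (subst inner_matrix_mult_left) (simp only: sym)
      also have "\<dots> = (transpose B ** (Pi ** B)) \<bullet> A" by (rule inner_matrix_mult_left)
      finally show ?thesis unfolding Q2_def by (simp only: inner_commute matrix_mul_assoc)
    qed
    moreover have "(B ** A) \<bullet> (Pi ** B) = A \<bullet> Q2"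
    proof -
      have "(B ** A) \<bullet> (Pi ** B) = (Pi ** B) \<bullet> (B ** A)" by (rule inner_commute)
      also have "\<dots> = (transpose B ** (Pi ** B)) \<bullet> A" by (rule inner_matrix_mult_left)
      finally show ?thesis unfolding Q2_def by (simp only: inner_commute matrix_mul_assoc)
    qed
    ultimately have "(f has_real_derivative 2 * (A \<bullet> (Q2 - Q))) (at 0 within {0..})"
      unfolding has_real_derivative_iff_has_vector_derivative by (simp add: inner_diff_right)
    moreover have "f 0 \<le> f t" if "t \<ge> 0" for t
      using min[OF inN[OF that]] unfolding f_def by (simp add: XY(1,2) Z0B)
    ultimately have "0 \<le> 2 * (A \<bullet> (Q2 - Q))"
      using has_real_derivative_neg_dec_right[of f "2 * (A \<bullet> (Q2 - Q))" 0 "{0..}"]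
      by (metis add_0 atLeast_iff dense less_imp_le not_less)
    then show ?thesis by simp
  qed
  have symQ: "transpose (Q2 - Q) = Q2 - Q"
  proof -
    have "transpose Q2 = Q2" "transpose Q = Q"
      unfolding Q_def Q2_def by (simp_all add: matrix_transpose_mul sym transpose_transpose matrix_mul_assoc)
    moreover have "transpose (Q2 - Q) = transpose Q2 - transpose Q" by (simp add: transpose_def vec_eq_iff)
    ultimately show ?thesis by simp
  qed
  \<comment> \<open>The test direction is chosen so that its symmetrization is the gradient itself,
    which forces the gradient to vanish. As \<open>Q2\<close> is the inverse of \<open>Q\<close>,
    this makes \<open>Q\<close> an involution.\<close>
  obtain A where A: "A \<in> g" "A + transpose A = Q2 - Q" using onto[OF symQ] by blast
  have "A \<bullet> (Q2 - Q) = 0"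
    using crit[OF A(1)] crit[of "- A"] subspace_neg[OF g(1) A(1)] by simp
  moreover have "transpose A \<bullet> (Q2 - Q) = A \<bullet> (Q2 - Q)"
    using inner_transpose[of A "Q2 - Q"] symQ by simp
  ultimately have "(A + transpose A) \<bullet> (Q2 - Q) = 0" by (simp only: inner_add_left)
  then have "(Q2 - Q) \<bullet> (Q2 - Q) = 0" unfolding A(2) .
  then have QQ2: "Q2 = Q" by simp
  have B't: "transpose B' ** transpose B = mat 1"
    using arg_cong[OF B(1), of transpose] by (simp add: matrix_transpose_mul transpose_mat)
  have Bt: "transpose B ** transpose B' = mat 1"
    using arg_cong[OF B(2), of transpose] by (simp add: matrix_transpose_mul transpose_mat)
  have "Q ** Q2 = B' ** P ** (transpose B' ** transpose B) ** Pi ** B"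
    unfolding Q_def Q2_def by (simp add: matrix_mul_assoc)
  also have "\<dots> = B' ** (P ** Pi) ** B" unfolding B't by (simp add: matrix_mul_assoc)
  also have "\<dots> = mat 1" by (simp add: Pi B)
  finally have "Q ** Q = mat 1" using QQ2 by simp
  moreover have "x \<bullet> (Q *v x) > 0" if "x \<noteq> 0" for x
  proof -
    define y where "y = transpose B' *v x"
    have "transpose B *v y = x" unfolding y_def by (simp only: matrix_vector_mul_assoc Bt matrix_vector_mul_lid)
    then have "y \<noteq> 0" using that by auto
    then have "y \<bullet> (P *v y) > 0" using P by (simp add: Sym_pos_def)
    moreover have "x \<bullet> (Q *v x) = y \<bullet> (P *v y)"
      unfolding Q_def y_def
      by (simp only: matrix_vector_mul_assoc[symmetric] dot_lmul_matrix[symmetric] transpose_matrix_vector)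
    ultimately show ?thesis by simp
  qed
  ultimately have Q1: "Q = mat 1" using symmetric_involution_pos by blast
  have "P = B ** B' ** P ** (transpose B' ** transpose B)" by (simp add: B B't)
  also have "\<dots> = B ** Q ** transpose B" unfolding Q_def by (simp add: matrix_mul_assoc)
  finally have "P = B ** transpose B" by (simp add: Q1)
  then show ?thesis using B by (intro that[of B B']) auto
qed

text \<open>With P = B B^T, replacing A by B A B' turns A P + P A^T into B (A + A^T) B^T. So the
  equation at P reduces to the one at the identity with right-hand side B' S B'^T, and the new
  matrix is still in \<open>g\<close>.\<close>

lemma symmetrization_onto_transport:
  fixes g :: "(real^'n^'n) set"
  assumes g: "subspace g" "\<And>B C. B \<in> g \<Longrightarrow> C \<in> g \<Longrightarrow> B ** C - C ** B \<in> g"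
    and onto: "\<And>S. transpose S = S \<Longrightarrow> \<exists>A\<in>g. A + transpose A = S"
    and P: "P \<in> Sym_pos" and S: "transpose S = S"
  shows "\<exists>A\<in>g. A ** P + P ** transpose A = S"
proof -
  obtain B B' where B: "B ** B' = mat 1" "B' ** B = mat 1" "\<And>A. A \<in> g \<Longrightarrow> B ** A ** B' \<in> g"
    "P = B ** transpose B"
    using normalizer_factorization[OF g onto P] by blast
  have B't: "transpose B' ** transpose B = mat 1"
    using arg_cong[OF B(1), of transpose] by (simp add: matrix_transpose_mul transpose_mat)
  have Bt: "transpose B ** transpose B' = mat 1"
    using arg_cong[OF B(2), of transpose] by (simp add: matrix_transpose_mul transpose_mat)
  have "transpose (B' ** S ** transpose B') = B' ** S ** transpose B'"
    by (simp add: matrix_transpose_mul S transpose_transpose matrix_mul_assoc)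
  then obtain A where A: "A \<in> g" "A + transpose A = B' ** S ** transpose B'" using onto by blast
  have "B ** A ** B' ** P = B ** A ** (B' ** B) ** transpose B" unfolding B(4) by (simp add: matrix_mul_assoc)
  then have 1: "B ** A ** B' ** P = B ** A ** transpose B" by (simp add: B)
  have "P ** transpose (B ** A ** B') = B ** (transpose B ** transpose B') ** transpose A ** transpose B"
    unfolding B(4) by (simp add: matrix_transpose_mul matrix_mul_assoc)
  then have 2: "P ** transpose (B ** A ** B') = B ** transpose A ** transpose B" by (simp add: Bt)
  have "B ** A ** B' ** P + P ** transpose (B ** A ** B') = B ** (A + transpose A) ** transpose B"
    unfolding 1 2 by (simp add: bounded_bilinear.add_left[OF bounded_bilinear_matrix_mult] bounded_bilinear.add_right[OF bounded_bilinear_matrix_mult])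
  also have "\<dots> = (B ** B') ** S ** (transpose B' ** transpose B)" unfolding A(2) by (simp add: matrix_mul_assoc)
  also have "\<dots> = S" by (simp add: B B't)
  finally show ?thesis using B(3)[OF A(1)] by blast
qed

section \<open>Calculus of continuously differentiable maps\<close>

lemma Ck_on_cong:
  assumes S: "open S" and eq: "\<And>x. x \<in> S \<Longrightarrow> f x = g x" and f: "Ck_on k f S"
  shows "Ck_on k g S"
  using eq f
proof (induction k arbitrary: f g)
  case 0
  then show ?case by (simp cong: continuous_on_cong)
next
  case (Suc k)
  have d: "(f has_derivative frechet_derivative f (at x)) (at x)" if "x \<in> S" for x
    using Suc.prems(2) that by (simp add: frechet_derivative_works[symmetric])
  have g: "(g has_derivative frechet_derivative f (at x)) (at x)" if "x \<in> S" for x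
    using has_derivative_transform_within_open[OF d[OF that] S that Suc.prems(1)] by blast
  have "Ck_on k (\<lambda>x. frechet_derivative g (at x) v) S" for v
  proof (rule Suc.IH)
    show "Ck_on k (\<lambda>x. frechet_derivative f (at x) v) S" using Suc.prems(2) by simp
    show "frechet_derivative f (at x) v = frechet_derivative g (at x) v" if "x \<in> S" for x
      using frechet_derivative_at[OF g[OF that]] by simp
  qed
  then show ?case using differentiableI[OF g] by simp
qed

lemma Ck_onI:
  assumes S: "open S" and f: "\<And>x. x \<in> S \<Longrightarrow> (f has_derivative f' x) (at x)"
    and Ck: "\<And>v. Ck_on k (\<lambda>x. f' x v) S"
  shows "Ck_on (Suc k) f S"
proof -
  have "Ck_on k (\<lambda>x. frechet_derivative f (at x) v) S" for v
  proof (rule Ck_on_cong[OF S _ Ck[of v]])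
    show "f' x v = frechet_derivative f (at x) v" if "x \<in> S" for x
      using frechet_derivative_at[OF f[OF that]] by simp
  qed
  then show ?thesis using differentiableI[OF f] by simp
qed

lemma Ck_onD:
  assumes "Ck_on (Suc k) f S" "x \<in> S"
  shows "(f has_derivative frechet_derivative f (at x)) (at x)"
  using assms by (simp add: frechet_derivative_works[symmetric])

lemma Ck_on_Suc_imp: "Ck_on (Suc k) f S \<Longrightarrow> Ck_on k f S"
proof (induction k arbitrary: f)
  case 0
  then have "isCont f x" if "x \<in> S" for x using that by (simp add: differentiable_imp_continuous_within)
  then show ?case by (simp add: continuous_at_imp_continuous_on)
next
  case (Suc k)
  then show ?case by simp
qed

lemma Ck_on_const: "Ck_on k (\<lambda>x. c) S"
  by (induction k arbitrary: c) simp_all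

lemma Ck_on_linear:
  assumes S: "open S" and L: "bounded_linear L"
  shows "Ck_on k f S \<Longrightarrow> Ck_on k (\<lambda>x. L (f x)) S"
proof (induction k arbitrary: f)
  case 0
  then show ?case using bounded_linear.continuous_on[OF L] by simp
next
  case (Suc k)
  show ?case
    by (rule Ck_onI[OF S bounded_linear.has_derivative[OF L Ck_onD[OF Suc.prems]]])
      (use Suc in auto)
qed

lemma Ck_on_add:
  assumes S: "open S"
  shows "Ck_on k f S \<Longrightarrow> Ck_on k g S \<Longrightarrow> Ck_on k (\<lambda>x. f x + g x) S"
proof (induction k arbitrary: f g)
  case 0
  then show ?case by (simp add: continuous_on_add)
next
  case (Suc k)
  show ?case
    by (rule Ck_onI[OF S has_derivative_add[OF Ck_onD[OF Suc.prems(1)] Ck_onD[OF Suc.prems(2)]]])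
      (use Suc in auto)
qed

lemma Ck_on_sum:
  assumes S: "open S" and "\<And>i. i \<in> I \<Longrightarrow> Ck_on k (f i) S"
  shows "Ck_on k (\<lambda>x. \<Sum>i\<in>I. f i x) S"
  using assms(2) by (induction I rule: infinite_finite_induct) (auto simp: Ck_on_const Ck_on_add[OF S])

lemma Ck_on_bilinear:
  assumes S: "open S" and B: "bounded_bilinear B"
  shows "Ck_on k f S \<Longrightarrow> Ck_on k g S \<Longrightarrow> Ck_on k (\<lambda>x. B (f x) (g x)) S"
proof (induction k arbitrary: f g)
  case 0
  then show ?case using bounded_bilinear.continuous_on[OF B] by simp
next
  case (Suc k)
  show ?case
    by (rule Ck_onI[OF S bounded_bilinear.FDERIV[OF B Ck_onD[OF Suc.prems(1)] Ck_onD[OF Suc.prems(2)]]])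
      (use Suc Ck_on_Suc_imp[OF Suc.prems(1)] Ck_on_Suc_imp[OF Suc.prems(2)] in \<open>auto intro!: Ck_on_add[OF S]\<close>)
qed

lemma Ck_on_compose_linear:
  assumes S: "open S" and L: "bounded_linear L"
  shows "Ck_on k f S \<Longrightarrow> Ck_on k (\<lambda>z. f (L z)) (L -` S)"
proof (induction k arbitrary: f)
  case 0
  then show ?case
    by (auto intro!: continuous_on_compose2[of S f] linear_continuous_on[OF L])
next
  case (Suc k)
  have o: "open (L -` S)" using S linear_continuous_on[OF L] by (rule open_vimage)
  show ?case
  proof (rule Ck_onI[OF o])
    fix z assume "z \<in> L -` S"
    then have "(f has_derivative frechet_derivative f (at (L z))) (at (L z))" by (intro Ck_onD[OF Suc.prems]) simp
    from has_derivative_compose[OF bounded_linear_imp_has_derivative[OF L] this]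
    show "((\<lambda>z. f (L z)) has_derivative (\<lambda>v. frechet_derivative f (at (L z)) (L v))) (at z)" .
  next
    fix v
    show "Ck_on k (\<lambda>z. frechet_derivative f (at (L z)) (L v)) (L -` S)"
      using Suc.IH[of "\<lambda>x. frechet_derivative f (at x) (L v)"] Suc.prems by simp
  qed
qed

lemma Ck_on_bounded_linear:
  assumes L: "bounded_linear L"
  shows "Ck_on k L UNIV"
proof (cases k)
  case 0
  then show ?thesis using linear_continuous_on[OF L] by simp
next
  case (Suc k')
  show ?thesis unfolding Suc
    by (rule Ck_onI[OF open_UNIV bounded_linear_imp_has_derivative[OF L]]) (rule Ck_on_const)
qed

lemma Ck_on_subset: "Ck_on k f S \<Longrightarrow> T \<subseteq> S \<Longrightarrow> Ck_on k f T"
  by (induction k arbitrary: f) (auto intro: continuous_on_subset)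

text \<open>\<open>Ck_on\<close> controls the derivative only in constant directions; expanding
  \<open>w x\<close> in the basis reduces a variable direction to these.\<close>

lemma Ck_on_directional:
  fixes h :: "'a::euclidean_space \<Rightarrow> 'b::euclidean_space"
  assumes S: "open S" and h: "Ck_on (Suc k) h S" and w: "Ck_on k w S"
  shows "Ck_on k (\<lambda>x. frechet_derivative h (at x) (w x)) S"
proof -
  have eq: "frechet_derivative h (at x) (w x) = (\<Sum>b\<in>Basis. (w x \<bullet> b) *\<^sub>R frechet_derivative h (at x) b)" if "x \<in> S" for x
  proof -
    have l: "linear (frechet_derivative h (at x))" using Ck_onD[OF h that] by (rule has_derivative_linear)
    have "frechet_derivative h (at x) (w x) = frechet_derivative h (at x) (\<Sum>b\<in>Basis. (w x \<bullet> b) *\<^sub>R b)"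
      by (simp add: euclidean_representation)
    then show ?thesis by (simp add: linear_sum[OF l] linear_cmul[OF l])
  qed
  have "Ck_on k (\<lambda>x. \<Sum>b\<in>Basis. (w x \<bullet> b) *\<^sub>R frechet_derivative h (at x) b) S"
    using h
    by (intro Ck_on_sum S Ck_on_bilinear[OF S bounded_bilinear_scaleR] Ck_on_linear[OF S bounded_linear_inner_left w]) auto
  then show ?thesis by (rule Ck_on_cong[OF S, rotated]) (simp add: eq)
qed

section \<open>Uniform bounds on compact convex sets\<close>

lemma lipschitz_of_Ck_on:
  fixes f :: "'a::euclidean_space \<Rightarrow> 'b::real_normed_vector"
  assumes f: "Ck_on 1 f S" and K: "compact K" "convex K" "K \<subseteq> S"
  shows "\<exists>C\<ge>0. \<forall>x\<in>K. (\<forall>v. norm (frechet_derivative f (at x) v) \<le> C * norm v) \<and> (\<forall>y\<in>K. norm (f y - f x) \<le> C * norm (y - x))"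
proof -
  have d: "(f has_derivative frechet_derivative f (at x)) (at x)" if "x \<in> K" for x
    using Ck_onD[of 0 f S x] f that K by auto
  have "\<exists>c. \<forall>x\<in>K. norm (frechet_derivative f (at x) b) \<le> c" for b
  proof -
    have "continuous_on S (\<lambda>x. frechet_derivative f (at x) b)" using f by simp
    then have "continuous_on K (\<lambda>x. frechet_derivative f (at x) b)" using K(3) by (rule continuous_on_subset)
    then have "bounded ((\<lambda>x. frechet_derivative f (at x) b) ` K)"
      using K(1) compact_continuous_image compact_imp_bounded by blast
    then show ?thesis by (auto simp: bounded_iff)
  qed
  then obtain c where c: "\<And>b x. x \<in> K \<Longrightarrow> norm (frechet_derivative f (at x) b) \<le> c b" by metis
  define C where "C = (\<Sum>b\<in>Basis. \<bar>c b\<bar>)"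
  have C: "C \<ge> 0" unfolding C_def by (rule sum_nonneg) simp
  have b: "norm (frechet_derivative f (at x) v) \<le> C * norm v" if x: "x \<in> K" for x v
  proof -
    have l: "linear (frechet_derivative f (at x))" using d[OF x] by (rule has_derivative_linear)
    have "frechet_derivative f (at x) v = frechet_derivative f (at x) (\<Sum>b\<in>Basis. (v \<bullet> b) *\<^sub>R b)"
      by (simp add: euclidean_representation)
    also have "\<dots> = (\<Sum>b\<in>Basis. (v \<bullet> b) *\<^sub>R frechet_derivative f (at x) b)"
      by (simp add: linear_sum[OF l] linear_cmul[OF l])
    finally have "norm (frechet_derivative f (at x) v) \<le> (\<Sum>b\<in>Basis. norm ((v \<bullet> b) *\<^sub>R frechet_derivative f (at x) b))"
      using norm_sum by metis
    also have "\<dots> \<le> (\<Sum>b\<in>Basis. norm v * \<bar>c b\<bar>)"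
    proof (rule sum_mono)
      fix b :: 'a assume "b \<in> Basis"
      then have "\<bar>v \<bullet> b\<bar> \<le> norm v" by (rule Basis_le_norm)
      moreover have "norm (frechet_derivative f (at x) b) \<le> \<bar>c b\<bar>" using c[OF x, of b] by linarith
      ultimately show "norm ((v \<bullet> b) *\<^sub>R frechet_derivative f (at x) b) \<le> norm v * \<bar>c b\<bar>"
        unfolding norm_scaleR by (intro mult_mono) auto
    qed
    also have "\<dots> = C * norm v" unfolding C_def by (simp add: sum_distrib_left mult.commute)
    finally show ?thesis .
  qed
  have "norm (f y - f x) \<le> C * norm (y - x)" if "x \<in> K" "y \<in> K" for x y
  proof (rule differentiable_bound[OF K(2) _ _ that(2,1)])
    fix z assume z: "z \<in> K"
    show "(f has_derivative frechet_derivative f (at z)) (at z within K)" using d[OF z] by (rule has_derivative_at_withinI)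
    show "onorm (frechet_derivative f (at z)) \<le> C" by (rule onorm_bound[OF C b[OF z]])
  qed
  then show ?thesis using C b by blast
qed

text \<open>Quantitative C^{1,1} control with one constant for the field, its derivative, both
  Lipschitz bounds and the Taylor remainder. The derivative enters as a parameter \<open>H'\<close>,
  so the estimates below use only these inequalities on K and no differentiability in the ambient
  space.\<close>

definition C11_on :: "'a::euclidean_space set \<Rightarrow> ('a \<Rightarrow> 'a) \<Rightarrow> ('a \<Rightarrow> 'a \<Rightarrow> 'a) \<Rightarrow> real \<Rightarrow> bool" where
  "C11_on K H H' C \<longleftrightarrow> C \<ge> 0 \<and> (\<forall>x\<in>K. linear (H' x) \<and> norm (H x) \<le> C \<and> (\<forall>v. norm (H' x v) \<le> C * norm v) \<and>
     (\<forall>y\<in>K. norm (H y - H x) \<le> C * norm (y - x) \<and>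
        norm (H y - H x - H' x (y - x)) \<le> C * (norm (y - x))\<^sup>2 \<and>
        (\<forall>v. norm (H' y v - H' x v) \<le> C * norm (y - x) * norm v)))"

text \<open>Second derivatives in basis directions are bounded on the compact set; convexity turns
  this into a Lipschitz bound for the first derivative, and the mean value inequality on a segment
  into the quadratic remainder.\<close>

lemma C11_on_of_Ck_on:
  fixes H :: "'a::euclidean_space \<Rightarrow> 'a"
  assumes H: "Ck_on 2 H S" and K: "compact K" "convex K" "K \<subseteq> S"
  shows "\<exists>C. C11_on K H (\<lambda>x. frechet_derivative H (at x)) C"
proof -
  have H1: "Ck_on 1 H S" and H2: "\<And>b. Ck_on 1 (\<lambda>x. frechet_derivative H (at x) b) S"
    using H Ck_on_Suc_imp[of 1 H S] by (simp_all add: numeral_2_eq_2)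
  have d: "(H has_derivative frechet_derivative H (at x)) (at x)" if "x \<in> K" for x
    using Ck_onD[of 0 H S x] H1 that K by auto
  have l: "linear (frechet_derivative H (at x))" if "x \<in> K" for x using d[OF that] by (rule has_derivative_linear)
  obtain C1 where C1: "C1 \<ge> 0" "\<And>x v. x \<in> K \<Longrightarrow> norm (frechet_derivative H (at x) v) \<le> C1 * norm v"
    "\<And>x y. x \<in> K \<Longrightarrow> y \<in> K \<Longrightarrow> norm (H y - H x) \<le> C1 * norm (y - x)"
    using lipschitz_of_Ck_on[OF H1 K] by blast
  have "\<forall>b. \<exists>c\<ge>0. \<forall>x\<in>K. \<forall>y\<in>K. norm (frechet_derivative H (at y) b - frechet_derivative H (at x) b) \<le> c * norm (y - x)"
    using lipschitz_of_Ck_on[OF H2 K] by blast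
  then obtain c where c: "\<And>b. c b \<ge> 0"
    "\<And>b x y. x \<in> K \<Longrightarrow> y \<in> K \<Longrightarrow> norm (frechet_derivative H (at y) b - frechet_derivative H (at x) b) \<le> c b * norm (y - x)"
    by metis
  define C2 where "C2 = (\<Sum>b\<in>Basis. c b)"
  have C2: "C2 \<ge> 0" unfolding C2_def using c(1) by (intro sum_nonneg) auto
  have lip: "norm (frechet_derivative H (at y) v - frechet_derivative H (at x) v) \<le> C2 * norm (y - x) * norm v"
    if x: "x \<in> K" and y: "y \<in> K" for x y v
  proof -
    have e: "frechet_derivative H (at z) v = (\<Sum>b\<in>Basis. (v \<bullet> b) *\<^sub>R frechet_derivative H (at z) b)" if "z \<in> K" for z
    proof -
      have "frechet_derivative H (at z) v = frechet_derivative H (at z) (\<Sum>b\<in>Basis. (v \<bullet> b) *\<^sub>R b)"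
        by (simp add: euclidean_representation)
      then show ?thesis by (simp add: linear_sum[OF l[OF that]] linear_cmul[OF l[OF that]])
    qed
    have "frechet_derivative H (at y) v - frechet_derivative H (at x) v =
      (\<Sum>b\<in>Basis. (v \<bullet> b) *\<^sub>R (frechet_derivative H (at y) b - frechet_derivative H (at x) b))"
      unfolding e[OF x] e[OF y] by (simp add: sum_subtractf scaleR_diff_right)
    then have "norm (frechet_derivative H (at y) v - frechet_derivative H (at x) v) \<le>
      (\<Sum>b\<in>Basis. norm ((v \<bullet> b) *\<^sub>R (frechet_derivative H (at y) b - frechet_derivative H (at x) b)))"
      using norm_sum by metis
    also have "\<dots> \<le> (\<Sum>b\<in>Basis. norm v * (c b * norm (y - x)))"
    proof (rule sum_mono)
      fix b :: 'a assume "b \<in> Basis"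
      then have "\<bar>v \<bullet> b\<bar> \<le> norm v" by (rule Basis_le_norm)
      then show "norm ((v \<bullet> b) *\<^sub>R (frechet_derivative H (at y) b - frechet_derivative H (at x) b)) \<le> norm v * (c b * norm (y - x))"
        unfolding norm_scaleR using c(2)[OF x y, of b] by (intro mult_mono) auto
    qed
    also have "\<dots> = C2 * norm (y - x) * norm v" unfolding C2_def
      by (simp add: sum_distrib_left sum_distrib_right mult_ac)
    finally show ?thesis .
  qed
  obtain C0 where C0: "\<And>x. x \<in> K \<Longrightarrow> norm (H x) \<le> C0"
  proof -
    have "continuous_on S H" using Ck_on_Suc_imp[of 0 H S] H1 by simp
    then have "continuous_on K H" using K(3) by (rule continuous_on_subset)
    then have "bounded (H ` K)" using K(1) compact_continuous_image compact_imp_bounded by blast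
    then show ?thesis using that by (auto simp: bounded_iff)
  qed
  define C where "C = \<bar>C0\<bar> + C1 + C2"
  have C: "C \<ge> 0" "C0 \<le> C" "C1 \<le> C" "C2 \<le> C" unfolding C_def using C1(1) C2 by auto
  have "C11_on K H (\<lambda>x. frechet_derivative H (at x)) C"
    unfolding C11_on_def
  proof (intro conjI ballI allI)
    show "0 \<le> C" by (rule C)
    fix x assume x: "x \<in> K"
    show "linear (frechet_derivative H (at x))" by (rule l[OF x])
    show "norm (H x) \<le> C" using C0[OF x] C by linarith
    show "norm (frechet_derivative H (at x) v) \<le> C * norm v" for v
      using C1(2)[OF x, of v] mult_right_mono[OF C(3), of "norm v"] by simp
    fix y assume y: "y \<in> K"
    show "norm (H y - H x) \<le> C * norm (y - x)"
      using C1(3)[OF x y] mult_right_mono[OF C(3), of "norm (y - x)"] by simp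
    show "norm (frechet_derivative H (at y) v - frechet_derivative H (at x) v) \<le> C * norm (y - x) * norm v" for v
      using lip[OF x y, of v] mult_right_mono[OF C(4), of "norm (y - x) * norm v"] by (simp add: mult.assoc)
    define T where "T = closed_segment x y"
    have TK: "T \<subseteq> K" unfolding T_def using x y K(2) by (simp add: closed_segment_subset)
    have "norm (H y - H x - frechet_derivative H (at x) (y - x)) \<le> norm (y - x) * (C * norm (y - x))"
    proof (rule differentiable_bound_linearization[where S = T and f' = "\<lambda>z. frechet_derivative H (at z)" and ?x0.0 = x and a = x and b = y])
      show "x + t *\<^sub>R (y - x) \<in> T" if "t \<in> {0..1}" for t
        unfolding T_def closed_segment_def using that by (auto intro!: exI[of _ t] simp: algebra_simps)
      show "(H has_derivative frechet_derivative H (at z)) (at z within T)" if "z \<in> T" for z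
        using d[of z] TK that has_derivative_at_withinI by blast
      show "x \<in> T" unfolding T_def by simp
      show "onorm (frechet_derivative H (at z) - frechet_derivative H (at x)) \<le> C * norm (y - x)" if z: "z \<in> T" for z
      proof (rule onorm_bound)
        show "0 \<le> C * norm (y - x)" using C by simp
        fix v :: 'a
        have "norm (z - x) \<le> norm (y - x)" using z segment_bound(1)[of z x y] unfolding T_def by simp
        then have "C2 * norm (z - x) * norm v \<le> C * norm (y - x) * norm v"
          using C C2 by (intro mult_right_mono mult_mono) auto
        then show "norm ((frechet_derivative H (at z) - frechet_derivative H (at x)) v) \<le> C * norm (y - x) * norm v"
          using lip[OF x, of z v] TK z by (auto simp: fun_diff_def)
      qed
    qed
    then show "norm (H y - H x - frechet_derivative H (at x) (y - x)) \<le> C * (norm (y - x))\<^sup>2"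
      by (simp add: power2_eq_square mult_ac)
  qed
  then show ?thesis by blast
qed

text \<open>The mean value inequality is applied along the side \<open>v\<close> of the
  parallelogram only: there the derivative of the difference is t (g y1 - g y2), and
  differentiability of \<open>g\<close> at the single point \<open>x\<close> replaces it by t^2 g'
  u.\<close>

lemma second_difference_bound:
  fixes f :: "'a::euclidean_space \<Rightarrow> 'b::real_normed_vector"
  assumes f: "Ck_on 1 f S"
    and g': "((\<lambda>y. frechet_derivative f (at y) v) has_derivative g') (at x)" and S: "open S" "x \<in> S" and e: "e > 0"
  shows "\<exists>d>0. \<forall>t. 0 < t \<longrightarrow> t < d \<longrightarrow>
     norm (f (x + t *\<^sub>R u + t *\<^sub>R v) - f (x + t *\<^sub>R u) - f (x + t *\<^sub>R v) + f x - t\<^sup>2 *\<^sub>R g' u) \<le> e * t\<^sup>2"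
proof -
  define M where "M = norm u + norm v + 1"
  have M: "M > 0" "norm u + norm v \<le> M" unfolding M_def by (auto intro: add_nonneg_pos)
  define g where "g = (\<lambda>y. frechet_derivative f (at y) v)"
  \<comment> \<open>Both points compared lie within t M of \<open>x\<close>, so two errors of rate e
    / (2 M) add up to e t.\<close>
  have "e / (2 * M) > 0" using e M by simp
  then obtain d1 where d1: "d1 > 0" "\<And>y. norm (y - x) < d1 \<Longrightarrow> norm (g y - g x - g' (y - x)) \<le> e / (2 * M) * norm (y - x)"
    using g' unfolding has_derivative_at_alt g_def by blast
  obtain d2 where d2: "d2 > 0" "ball x d2 \<subseteq> S" using S open_contains_ball by blast
  define d where "d = min d1 d2 / M"
  have "d > 0" unfolding d_def using d1 d2 M by simp
  moreover have "norm (f (x + t *\<^sub>R u + t *\<^sub>R v) - f (x + t *\<^sub>R u) - f (x + t *\<^sub>R v) + f x - t\<^sup>2 *\<^sub>R g' u) \<le> e * t\<^sup>2"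
    if t: "0 < t" "t < d" for t
  proof -
    have tM: "t * M < d1" "t * M < d2" using t M unfolding d_def by (auto simp: pos_less_divide_eq)
    have lin: "linear g'" using g' by (rule has_derivative_linear)
    have near: "norm (\<sigma> *\<^sub>R t *\<^sub>R v) \<le> t * M" "norm (t *\<^sub>R u + \<sigma> *\<^sub>R t *\<^sub>R v) \<le> t * M" if "\<sigma> \<in> {0..1}" for \<sigma>
    proof -
      have "norm (\<sigma> *\<^sub>R t *\<^sub>R v) \<le> t * norm v"
        using that t mult_left_le_one_le[of "t * norm v" \<sigma>] by (simp add: mult.assoc)
      moreover have "norm (t *\<^sub>R u + \<sigma> *\<^sub>R t *\<^sub>R v) \<le> t * norm u + norm (\<sigma> *\<^sub>R t *\<^sub>R v)"
        using norm_triangle_ineq[of "t *\<^sub>R u" "\<sigma> *\<^sub>R t *\<^sub>R v"] t by (simp del: scaleR_scaleR)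
      moreover have "t * (norm u + norm v) \<le> t * M" using M t by (intro mult_left_mono) auto
      moreover have "0 \<le> t * norm u" using t by simp
      ultimately show "norm (\<sigma> *\<^sub>R t *\<^sub>R v) \<le> t * M" "norm (t *\<^sub>R u + \<sigma> *\<^sub>R t *\<^sub>R v) \<le> t * M"
        unfolding distrib_left by linarith+
    qed
    define \<psi> where "\<psi> = (\<lambda>\<sigma>. f (x + t *\<^sub>R u + \<sigma> *\<^sub>R t *\<^sub>R v) - f (x + \<sigma> *\<^sub>R t *\<^sub>R v) - \<sigma> *\<^sub>R t\<^sup>2 *\<^sub>R g' u)"
    have "norm (\<psi> 1 - \<psi> 0) \<le> (e * t\<^sup>2) * norm (1 - 0 :: real)"
    proof (rule differentiable_bound[of "{0..1}"])
      fix \<sigma> :: real assume \<sigma>: "\<sigma> \<in> {0..1}"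
      define y1 where "y1 = x + t *\<^sub>R u + \<sigma> *\<^sub>R t *\<^sub>R v"
      define y2 where "y2 = x + \<sigma> *\<^sub>R t *\<^sub>R v"
      have yx: "y1 - x = t *\<^sub>R u + \<sigma> *\<^sub>R t *\<^sub>R v" "y2 - x = \<sigma> *\<^sub>R t *\<^sub>R v" unfolding y1_def y2_def by simp_all
      have n: "norm (y1 - x) \<le> t * M" "norm (y2 - x) \<le> t * M" unfolding yx using near[OF \<sigma>] by auto
      have inS: "y1 \<in> S" "y2 \<in> S"
        using n tM d2(2) by (auto simp: subset_eq dist_norm norm_minus_commute)
      have df: "(f has_derivative frechet_derivative f (at y)) (at y)" if "y \<in> S" for y
        using Ck_onD[of 0 f S y] f that by simp
      have a1: "((\<lambda>\<sigma>. x + t *\<^sub>R u + \<sigma> *\<^sub>R t *\<^sub>R v) has_derivative (\<lambda>h. h *\<^sub>R t *\<^sub>R v)) (at \<sigma>)"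
        and a2: "((\<lambda>\<sigma>. x + \<sigma> *\<^sub>R t *\<^sub>R v) has_derivative (\<lambda>h. h *\<^sub>R t *\<^sub>R v)) (at \<sigma>)"
        by (auto intro!: derivative_eq_intros)
      have b1: "((\<lambda>\<sigma>. f (x + t *\<^sub>R u + \<sigma> *\<^sub>R t *\<^sub>R v)) has_derivative (\<lambda>h. frechet_derivative f (at y1) (h *\<^sub>R t *\<^sub>R v))) (at \<sigma>)"
        using has_derivative_compose[OF a1 df[OF inS(1)[unfolded y1_def]]] unfolding y1_def .
      have b2: "((\<lambda>\<sigma>. f (x + \<sigma> *\<^sub>R t *\<^sub>R v)) has_derivative (\<lambda>h. frechet_derivative f (at y2) (h *\<^sub>R t *\<^sub>R v))) (at \<sigma>)"
        using has_derivative_compose[OF a2 df[OF inS(2)[unfolded y2_def]]] unfolding y2_def .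
      have c: "((\<lambda>\<sigma>. \<sigma> *\<^sub>R t\<^sup>2 *\<^sub>R g' u) has_derivative (\<lambda>h. h *\<^sub>R t\<^sup>2 *\<^sub>R g' u)) (at \<sigma>)"
        by (auto intro!: derivative_eq_intros)
      have l: "linear (frechet_derivative f (at y))" if "y \<in> S" for y using df[OF that] by (rule has_derivative_linear)
      have "(\<lambda>h. frechet_derivative f (at y1) (h *\<^sub>R t *\<^sub>R v) - frechet_derivative f (at y2) (h *\<^sub>R t *\<^sub>R v) - h *\<^sub>R t\<^sup>2 *\<^sub>R g' u)
        = (\<lambda>h. h *\<^sub>R (t *\<^sub>R (g y1 - g y2) - t\<^sup>2 *\<^sub>R g' u))"
        unfolding g_def by (auto simp: linear_cmul[OF l[OF inS(1)]] linear_cmul[OF l[OF inS(2)]] scaleR_diff_right)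
      then have "(\<psi> has_derivative (\<lambda>h. h *\<^sub>R (t *\<^sub>R (g y1 - g y2) - t\<^sup>2 *\<^sub>R g' u))) (at \<sigma>)"
        using has_derivative_diff[OF has_derivative_diff[OF b1 b2] c] unfolding \<psi>_def by simp
      then show "(\<psi> has_derivative (\<lambda>h. h *\<^sub>R (t *\<^sub>R (g y1 - g y2) - t\<^sup>2 *\<^sub>R g' u))) (at \<sigma> within {0..1})"
        by (rule has_derivative_at_withinI)
      have "g y1 - g y2 - t *\<^sub>R g' u = (g y1 - g x - g' (y1 - x)) - (g y2 - g x - g' (y2 - x))"
        unfolding yx by (simp add: linear_add[OF lin] linear_cmul[OF lin])
      then have "norm (g y1 - g y2 - t *\<^sub>R g' u) \<le> norm (g y1 - g x - g' (y1 - x)) + norm (g y2 - g x - g' (y2 - x))"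
        by (simp only: norm_triangle_ineq4)
      also have "\<dots> \<le> e / (2 * M) * (t * M) + e / (2 * M) * (t * M)"
      proof (rule add_mono)
        show "norm (g y1 - g x - g' (y1 - x)) \<le> e / (2 * M) * (t * M)"
          by (rule order_trans[OF d1(2)]) (use n tM e M in \<open>auto intro!: mult_left_mono divide_right_mono simp del: times_divide_eq_left\<close>)
        show "norm (g y2 - g x - g' (y2 - x)) \<le> e / (2 * M) * (t * M)"
          by (rule order_trans[OF d1(2)]) (use n tM e M in \<open>auto intro!: mult_left_mono divide_right_mono simp del: times_divide_eq_left\<close>)
      qed
      also have "\<dots> = e * t" using M by (simp add: field_simps)
      finally have "t * norm (g y1 - g y2 - t *\<^sub>R g' u) \<le> t * (e * t)" using t by (intro mult_left_mono) auto
      moreover have "t *\<^sub>R (g y1 - g y2) - t\<^sup>2 *\<^sub>R g' u = t *\<^sub>R (g y1 - g y2 - t *\<^sub>R g' u)"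
        by (simp add: scaleR_diff_right power2_eq_square)
      ultimately have fin: "norm (t *\<^sub>R (g y1 - g y2) - t\<^sup>2 *\<^sub>R g' u) \<le> e * t\<^sup>2"
        using t by (simp add: power2_eq_square mult_ac)
      show "onorm (\<lambda>h. h *\<^sub>R (t *\<^sub>R (g y1 - g y2) - t\<^sup>2 *\<^sub>R g' u)) \<le> e * t\<^sup>2"
        by (rule onorm_bound) (use fin e in \<open>auto simp: mult.commute[of "e * t\<^sup>2"] intro!: mult_left_mono\<close>)
    qed auto
    moreover have "\<psi> 1 - \<psi> 0 = f (x + t *\<^sub>R u + t *\<^sub>R v) - f (x + t *\<^sub>R u) - f (x + t *\<^sub>R v) + f x - t\<^sup>2 *\<^sub>R g' u"
      unfolding \<psi>_def by simp
    ultimately show ?thesis by simp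
  qed
  ultimately show ?thesis by blast
qed

text \<open>The second difference over a parallelogram is symmetric in its two sides, so both
  iterated derivatives are its limit after division by t^2.\<close>

lemma frechet_derivative_commute:
  fixes f :: "'a::euclidean_space \<Rightarrow> 'b::real_normed_vector"
  assumes f: "Ck_on 2 f S" and S: "open S" "x \<in> S"
  shows "frechet_derivative (\<lambda>y. frechet_derivative f (at y) u) (at x) v = frechet_derivative (\<lambda>y. frechet_derivative f (at y) v) (at x) u"
    (is "?a = ?b")
proof -
  have f1: "Ck_on 1 f S" and f2: "\<And>w. Ck_on 1 (\<lambda>y. frechet_derivative f (at y) w) S"
    using f Ck_on_Suc_imp[of 1 f S] by (simp_all add: numeral_2_eq_2)
  have d: "((\<lambda>y. frechet_derivative f (at y) w) has_derivative frechet_derivative (\<lambda>y. frechet_derivative f (at y) w) (at x)) (at x)" for w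
    using Ck_onD[of 0 _ S x] f2[of w] S(2) by simp
  have "norm (?a - ?b) \<le> 0 + e" if e: "e > 0" for e
  proof -
    have e2: "e / 2 > 0" using e by simp
    obtain d1 where d1: "d1 > 0" "\<And>t. 0 < t \<Longrightarrow> t < d1 \<Longrightarrow>
       norm (f (x + t *\<^sub>R v + t *\<^sub>R u) - f (x + t *\<^sub>R v) - f (x + t *\<^sub>R u) + f x - t\<^sup>2 *\<^sub>R ?a) \<le> e / 2 * t\<^sup>2"
      using second_difference_bound[OF f1 d[of u] S e2, of v] by blast
    obtain d2 where d2: "d2 > 0" "\<And>t. 0 < t \<Longrightarrow> t < d2 \<Longrightarrow>
       norm (f (x + t *\<^sub>R u + t *\<^sub>R v) - f (x + t *\<^sub>R u) - f (x + t *\<^sub>R v) + f x - t\<^sup>2 *\<^sub>R ?b) \<le> e / 2 * t\<^sup>2"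
      using second_difference_bound[OF f1 d[of v] S e2, of u] by blast
    define t where "t = min d1 d2 / 2"
    have t: "0 < t" "t < d1" "t < d2" unfolding t_def using d1(1) d2(1) by auto
    have comm: "f (x + t *\<^sub>R v + t *\<^sub>R u) = f (x + t *\<^sub>R u + t *\<^sub>R v)" by (simp add: ac_simps)
    have "t\<^sup>2 *\<^sub>R (?a - ?b) = (f (x + t *\<^sub>R u + t *\<^sub>R v) - f (x + t *\<^sub>R u) - f (x + t *\<^sub>R v) + f x - t\<^sup>2 *\<^sub>R ?b)
      - (f (x + t *\<^sub>R v + t *\<^sub>R u) - f (x + t *\<^sub>R v) - f (x + t *\<^sub>R u) + f x - t\<^sup>2 *\<^sub>R ?a)"
      unfolding comm by (simp add: algebra_simps)
    then have "norm (t\<^sup>2 *\<^sub>R (?a - ?b)) \<le> e / 2 * t\<^sup>2 + e / 2 * t\<^sup>2"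
      using norm_triangle_ineq4 d1(2)[OF t(1,2)] d2(2)[OF t(1,3)] by (smt (verit))
    then have "t\<^sup>2 * norm (?a - ?b) \<le> t\<^sup>2 * e" by (simp add: mult.commute)
    then show ?thesis using t(1) by simp
  qed
  then have "norm (?a - ?b) \<le> 0" by (rule field_le_epsilon)
  then show ?thesis by simp
qed

section \<open>Second-order expansion of commutators of flows\<close>

lemma C11_onD:
  assumes "C11_on K H H' C" "x \<in> K"
  shows "linear (H' x)" "norm (H x) \<le> C" "norm (H' x v) \<le> C * norm v"
    "y \<in> K \<Longrightarrow> norm (H y - H x) \<le> C * norm (y - x)"
    "y \<in> K \<Longrightarrow> norm (H y - H x - H' x (y - x)) \<le> C * (norm (y - x))\<^sup>2"
    "y \<in> K \<Longrightarrow> norm (H' y v - H' x v) \<le> C * norm (y - x) * norm v" "C \<ge> 0"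
  using assms unfolding C11_on_def by blast+

lemma C11_on_mono:
  assumes "C11_on K H H' C" "C \<le> C'"
  shows "C11_on K H H' C'"
  unfolding C11_on_def
proof (intro conjI ballI allI)
  note D = C11_onD[OF assms(1)]
  have C: "0 \<le> C" using assms(1) by (simp add: C11_on_def)
  then show "0 \<le> C'" using assms(2) by simp
  fix x assume x: "x \<in> K"
  show "linear (H' x)" by (rule D(1)[OF x])
  show "norm (H x) \<le> C'" using D(2)[OF x] assms(2) by simp
  fix v show "norm (H' x v) \<le> C' * norm v"
    using D(3)[OF x, of v] mult_right_mono[OF assms(2), of "norm v"] by simp
next
  note D = C11_onD[OF assms(1)]
  fix x y assume x: "x \<in> K" and y: "y \<in> K"
  show "norm (H y - H x) \<le> C' * norm (y - x)"
    using D(4)[OF x y] mult_right_mono[OF assms(2), of "norm (y - x)"] by simp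
  show "norm (H y - H x - H' x (y - x)) \<le> C' * (norm (y - x))\<^sup>2"
    using D(5)[OF x y] mult_right_mono[OF assms(2), of "(norm (y - x))\<^sup>2"] by simp
  fix v
  show "norm (H' y v - H' x v) \<le> C' * norm (y - x) * norm v"
    using D(6)[OF x y, of v] mult_right_mono[OF assms(2), of "norm (y - x) * norm v"] by (simp add: mult.assoc)
qed

lemma norm_sum4_le: "norm (a + b + c + d) \<le> norm a + norm b + norm c + norm (d::'a::real_normed_vector)"
proof -
  have "norm (a + b + c + d) \<le> norm (a + b + c) + norm d" by (rule norm_triangle_ineq)
  moreover have "norm (a + b + c) \<le> norm (a + b) + norm c" by (rule norm_triangle_ineq)
  moreover have "norm (a + b) \<le> norm a + norm b" by (rule norm_triangle_ineq)
  ultimately show ?thesis by linarith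
qed

text \<open>One step of a chain, re-expanded at a fixed base point. The point y = x + v + O(t^2 + d)
  is reached already, and z follows from y by the second-order expansion of the flow of Z for time
  c. The increment z - y is then expressed by data at x, with the extra term c Z' v coming from the
  displacement. The last two conclusions have the shape of the hypotheses on v and y, so steps can
  be chained. Here t is the time scale and d an error from outside.\<close>

definition step_bound :: "'a::euclidean_space set \<Rightarrow> real \<Rightarrow> real \<Rightarrow> real \<Rightarrow> bool" where
  "step_bound K C k k' \<longleftrightarrow> (\<forall>Z Z' x y z v c t d. C11_on K Z Z' C \<longrightarrow> x \<in> K \<longrightarrow> y \<in> K \<longrightarrow>
      \<bar>c\<bar> \<le> t \<longrightarrow> 0 \<le> t \<longrightarrow> t \<le> 1 \<longrightarrow> 0 \<le> d \<longrightarrow> d \<le> 1 \<longrightarrow> norm v \<le> k * t \<longrightarrow>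
      norm (y - x - v) \<le> k * (t\<^sup>2 + d) \<longrightarrow>
      norm (z - y - c *\<^sub>R Z y - (c\<^sup>2 / 2) *\<^sub>R Z' y (Z y)) \<le> k * t^3 + d \<longrightarrow>
      norm (z - y - (c *\<^sub>R Z x + (c\<^sup>2 / 2) *\<^sub>R Z' x (Z x) + c *\<^sub>R Z' x v)) \<le> k' * (t^3 + d) \<and>
      norm (z - x - (v + c *\<^sub>R Z x)) \<le> k' * (t\<^sup>2 + d) \<and> norm (v + c *\<^sub>R Z x) \<le> k' * t)"

lemma step_bound_exists:
  fixes K :: "'a::euclidean_space set"
  assumes "C \<ge> 0" "k \<ge> 1"
  shows "\<exists>k'\<ge>1. step_bound K C k k'"
proof -
  \<comment> \<open>The summands are the error of the step itself, the Taylor remainder of Z between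
    x and y (where (2 t + d)^2 \<le> 8 (t^2 + d)), the error of v as first-order displacement, and
    the change of the term Z' Z from x to y. The additions in \<open>k'\<close> serve the two
    coarser conclusions.\<close>
  define k1 where "k1 = k + 8 * C * k\<^sup>2 + C * k + 2 * C\<^sup>2 * k"
  define k' where "k' = k1 + k + C\<^sup>2 + C * k + C"
  have kp: "k \<ge> 0" "k\<^sup>2 \<ge> 0" using assms by auto
  have k1: "k1 \<ge> k" unfolding k1_def using assms kp by simp
  have Cp: "C\<^sup>2 \<ge> 0" "C * k \<ge> 0" using assms by auto
  have k': "k' \<ge> 1" "k' \<ge> k1" "k' \<ge> k1 + k + C\<^sup>2 + C * k" "k' \<ge> k + C"
    unfolding k'_def using k1 assms Cp by linarith+
  have main: "norm (z - y - (c *\<^sub>R Z x + (c\<^sup>2 / 2) *\<^sub>R Z' x (Z x) + c *\<^sub>R Z' x v)) \<le> k' * (t^3 + d) \<and>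
      norm (z - x - (v + c *\<^sub>R Z x)) \<le> k' * (t\<^sup>2 + d) \<and> norm (v + c *\<^sub>R Z x) \<le> k' * t"
    if Z: "C11_on K Z Z' C" and x: "x \<in> K" and y: "y \<in> K" and
      c: "\<bar>c\<bar> \<le> t" and t: "0 \<le> t" "t \<le> 1" and d: "0 \<le> d" "d \<le> 1" and v: "norm v \<le> k * t" and
      yv: "norm (y - x - v) \<le> k * (t\<^sup>2 + d)" and
      z: "norm (z - y - c *\<^sub>R Z y - (c\<^sup>2 / 2) *\<^sub>R Z' y (Z y)) \<le> k * t^3 + d"
    for Z Z' and x y z v :: 'a and c t d
  proof -
    note D = C11_onD[OF Z]
    have t2: "t\<^sup>2 \<le> t" using t by (simp add: power2_eq_square mult_left_le)
    have t3: "t^3 \<le> t\<^sup>2" "0 \<le> t^3" using t by (auto simp: power3_eq_cube power2_eq_square mult_left_le)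
    have td: "t * d \<le> d" using t d by (simp add: mult_left_le_one_le)
    have d2: "d\<^sup>2 \<le> d" using d by (simp add: power2_eq_square mult_left_le)
    have c2: "c\<^sup>2 \<le> t\<^sup>2" using c t abs_le_square_iff[of c t] by simp
    define \<omega> where "\<omega> = t^3 + d"
    have w: "0 \<le> \<omega>" unfolding \<omega>_def using t3 d by simp
    have yx: "norm (y - x) \<le> k * (2 * t + d)"
    proof -
      have "norm (y - x) \<le> norm v + norm (y - x - v)" using norm_triangle_ineq[of v "y - x - v"] by simp
      also have "\<dots> \<le> k * t + k * (t + d)"
        using v yv mult_left_mono[OF add_right_mono[OF t2, of d] kp(1)] by linarith
      finally show ?thesis by (simp add: algebra_simps)
    qed
    have yx2: "(norm (y - x))\<^sup>2 \<le> 8 * k\<^sup>2 * (t\<^sup>2 + d)"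
    proof -
      have "(norm (y - x))\<^sup>2 \<le> (k * (2 * t + d))\<^sup>2" using yx by (intro power_mono) auto
      also have "\<dots> = k\<^sup>2 * (2 * t + d)\<^sup>2" by (simp add: power_mult_distrib)
      also have "(2 * t + d)\<^sup>2 \<le> 8 * (t\<^sup>2 + d)"
        using sum_squares_bound[of "2*t" d] d2 d by (simp add: power2_sum power_mult_distrib)
      then have "k\<^sup>2 * (2 * t + d)\<^sup>2 \<le> k\<^sup>2 * (8 * (t\<^sup>2 + d))" by (intro mult_left_mono) auto
      finally show ?thesis by (simp add: algebra_simps)
    qed
    have tw: "t * (t\<^sup>2 + d) \<le> \<omega>" unfolding \<omega>_def using td by (simp add: algebra_simps power2_eq_square power3_eq_cube)
    have e1: "norm (c *\<^sub>R (Z y - Z x - Z' x (y - x))) \<le> 8 * C * k\<^sup>2 * \<omega>"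
    proof -
      have "norm (c *\<^sub>R (Z y - Z x - Z' x (y - x))) \<le> t * (C * (norm (y - x))\<^sup>2)"
        using c t D(5)[OF x y] by (simp add: mult_mono)
      also have "\<dots> \<le> t * (C * (8 * k\<^sup>2 * (t\<^sup>2 + d)))"
        using t assms yx2 by (intro mult_left_mono) auto
      also have "\<dots> = 8 * C * k\<^sup>2 * (t * (t\<^sup>2 + d))" by (simp add: algebra_simps)
      also have "\<dots> \<le> 8 * C * k\<^sup>2 * \<omega>" using tw assms by (intro mult_left_mono) auto
      finally show ?thesis .
    qed
    have e2: "norm (c *\<^sub>R Z' x (y - x - v)) \<le> C * k * \<omega>"
    proof -
      have "norm (c *\<^sub>R Z' x (y - x - v)) \<le> t * (C * norm (y - x - v))"
        using c t D(3)[OF x] by (simp add: mult_mono)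
      also have "\<dots> \<le> t * (C * (k * (t\<^sup>2 + d)))"
        using t assms yv by (intro mult_left_mono) auto
      also have "\<dots> = C * k * (t * (t\<^sup>2 + d))" by (simp add: algebra_simps)
      also have "\<dots> \<le> C * k * \<omega>" using tw assms by (intro mult_left_mono) auto
      finally show ?thesis .
    qed
    have e3: "norm ((c\<^sup>2 / 2) *\<^sub>R (Z' y (Z y) - Z' x (Z x))) \<le> 2 * C\<^sup>2 * k * \<omega>"
    proof -
      have "Z' y (Z y) - Z' x (Z x) = (Z' y (Z y) - Z' x (Z y)) + Z' x (Z y - Z x)"
        using D(1)[OF x] by (simp add: linear_diff)
      then have "norm (Z' y (Z y) - Z' x (Z x)) \<le> norm (Z' y (Z y) - Z' x (Z y)) + norm (Z' x (Z y - Z x))"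
        by (simp only: norm_triangle_ineq)
      also have "\<dots> \<le> C * norm (y - x) * C + C * (C * norm (y - x))"
      proof (rule add_mono)
        show "norm (Z' y (Z y) - Z' x (Z y)) \<le> C * norm (y - x) * C"
          by (rule order_trans[OF D(6)[OF x y]]) (use assms D(2)[OF y] in \<open>auto intro!: mult_left_mono\<close>)
        show "norm (Z' x (Z y - Z x)) \<le> C * (C * norm (y - x))"
          by (rule order_trans[OF D(3)[OF x]]) (use assms D(4)[OF x y] in \<open>auto intro!: mult_left_mono\<close>)
      qed
      also have "\<dots> = 2 * C\<^sup>2 * norm (y - x)" by (simp add: power2_eq_square)
      also have "\<dots> \<le> 2 * C\<^sup>2 * (k * (2 * t + d))" using yx by (intro mult_left_mono) auto
      finally have "norm (Z' y (Z y) - Z' x (Z x)) \<le> 2 * C\<^sup>2 * (k * (2 * t + d))" .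
      then have "c\<^sup>2 / 2 * norm (Z' y (Z y) - Z' x (Z x)) \<le> (t\<^sup>2 / 2) * (2 * C\<^sup>2 * (k * (2 * t + d)))"
        using c2 by (intro mult_mono) auto
      then have "norm ((c\<^sup>2 / 2) *\<^sub>R (Z' y (Z y) - Z' x (Z x))) \<le> (t\<^sup>2 / 2) * (2 * C\<^sup>2 * (k * (2 * t + d)))"
        by simp
      also have "\<dots> = C\<^sup>2 * k * (2 * t^3 + t * (t * d))" by (simp add: algebra_simps power2_eq_square power3_eq_cube)
      also have "\<dots> \<le> C\<^sup>2 * k * (2 * \<omega>)"
      proof (intro mult_left_mono)
        have "t * (t * d) \<le> 1 * d" using td t d by (metis mult_left_le_one_le mult_nonneg_nonneg order_trans mult_1)
        then show "2 * t^3 + t * (t * d) \<le> 2 * \<omega>" unfolding \<omega>_def using d by simp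
      qed (use assms in auto)
      finally show ?thesis by simp
    qed
    have "z - y - (c *\<^sub>R Z x + (c\<^sup>2 / 2) *\<^sub>R Z' x (Z x) + c *\<^sub>R Z' x v) =
       (z - y - c *\<^sub>R Z y - (c\<^sup>2 / 2) *\<^sub>R Z' y (Z y)) + c *\<^sub>R (Z y - Z x - Z' x (y - x)) +
       c *\<^sub>R Z' x (y - x - v) + (c\<^sup>2 / 2) *\<^sub>R (Z' y (Z y) - Z' x (Z x))"
      using D(1)[OF x] by (simp add: linear_diff scaleR_diff_right scaleR_add_right)
    then have "norm (z - y - (c *\<^sub>R Z x + (c\<^sup>2 / 2) *\<^sub>R Z' x (Z x) + c *\<^sub>R Z' x v)) \<le>
       norm (z - y - c *\<^sub>R Z y - (c\<^sup>2 / 2) *\<^sub>R Z' y (Z y)) + norm (c *\<^sub>R (Z y - Z x - Z' x (y - x))) +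
       norm (c *\<^sub>R Z' x (y - x - v)) + norm ((c\<^sup>2 / 2) *\<^sub>R (Z' y (Z y) - Z' x (Z x)))"
      by (simp only: norm_sum4_le)
    also have "\<dots> \<le> k * \<omega> + 8 * C * k\<^sup>2 * \<omega> + C * k * \<omega> + 2 * C\<^sup>2 * k * \<omega>"
    proof -
      have "d \<le> k * d" using assms d by (simp add: mult_right_mono[of 1 k d, simplified])
      then have "k * t^3 + d \<le> k * \<omega>" unfolding \<omega>_def by (simp add: distrib_left)
      then show ?thesis using z e1 e2 e3 by linarith
    qed
    also have "\<dots> = k1 * \<omega>" unfolding k1_def by (simp add: algebra_simps)
    finally have r1: "norm (z - y - (c *\<^sub>R Z x + (c\<^sup>2 / 2) *\<^sub>R Z' x (Z x) + c *\<^sub>R Z' x v)) \<le> k1 * \<omega>" .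
    define \<tau> where "\<tau> = t\<^sup>2 + d"
    have wt: "\<omega> \<le> \<tau>" "0 \<le> \<tau>" "t\<^sup>2 \<le> \<tau>" unfolding \<omega>_def \<tau>_def using t3 d by auto
    have Zx: "norm (Z x) \<le> C" by (rule D(2)[OF x])
    have r2a: "norm ((c\<^sup>2 / 2) *\<^sub>R Z' x (Z x)) \<le> C\<^sup>2 * \<tau>"
    proof -
      have "norm (Z' x (Z x)) \<le> C * C" using D(3)[OF x, of "Z x"] mult_left_mono[OF Zx assms(1)] by linarith
      then have "norm ((c\<^sup>2 / 2) *\<^sub>R Z' x (Z x)) \<le> (t\<^sup>2 / 2) * (C * C)" using c2 by (simp add: mult_mono)
      also have "\<dots> \<le> \<tau> * (C * C)" using wt assms by (intro mult_right_mono) auto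
      finally show ?thesis by (simp add: power2_eq_square mult_ac)
    qed
    have r2b: "norm (c *\<^sub>R Z' x v) \<le> C * k * \<tau>"
    proof -
      have "norm (Z' x v) \<le> C * (k * t)" using D(3)[OF x, of v] mult_left_mono[OF v assms(1)] by linarith
      then have "norm (c *\<^sub>R Z' x v) \<le> t * (C * (k * t))" using c t by (simp add: mult_mono)
      also have "\<dots> = C * k * t\<^sup>2" by (simp add: power2_eq_square)
      also have "\<dots> \<le> C * k * \<tau>" using wt assms by (intro mult_left_mono) auto
      finally show ?thesis .
    qed
    have "z - x - (v + c *\<^sub>R Z x) = (z - y - (c *\<^sub>R Z x + (c\<^sup>2 / 2) *\<^sub>R Z' x (Z x) + c *\<^sub>R Z' x v)) +
        (y - x - v) + (c\<^sup>2 / 2) *\<^sub>R Z' x (Z x) + c *\<^sub>R Z' x v" by simp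
    then have "norm (z - x - (v + c *\<^sub>R Z x)) \<le> norm (z - y - (c *\<^sub>R Z x + (c\<^sup>2 / 2) *\<^sub>R Z' x (Z x) + c *\<^sub>R Z' x v)) +
        norm (y - x - v) + norm ((c\<^sup>2 / 2) *\<^sub>R Z' x (Z x)) + norm (c *\<^sub>R Z' x v)"
      by (simp only: norm_sum4_le)
    also have "\<dots> \<le> k1 * \<tau> + k * \<tau> + C\<^sup>2 * \<tau> + C * k * \<tau>"
      using r1 r2a r2b yv mult_left_mono[OF wt(1), of k1] k1 kp unfolding \<tau>_def by linarith
    also have "\<dots> = (k1 + k + C\<^sup>2 + C * k) * \<tau>" by (simp add: algebra_simps)
    also have "\<dots> \<le> k' * \<tau>" by (intro mult_right_mono k' wt)
    finally have r2: "norm (z - x - (v + c *\<^sub>R Z x)) \<le> k' * \<tau>" .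
    have "norm (v + c *\<^sub>R Z x) \<le> norm v + \<bar>c\<bar> * norm (Z x)" using norm_triangle_ineq[of v "c *\<^sub>R Z x"] by simp
    also have "\<dots> \<le> k * t + t * C" by (intro add_mono v mult_mono c Zx t) auto
    also have "\<dots> = (k + C) * t" by (simp add: algebra_simps)
    also have "\<dots> \<le> k' * t" by (intro mult_right_mono k' t)
    finally have r3: "norm (v + c *\<^sub>R Z x) \<le> k' * t" .
    show ?thesis using r1 r2 r3 mult_right_mono[OF k'(2) w] unfolding \<tau>_def \<omega>_def by auto
  qed
  show ?thesis unfolding step_bound_def
    by (intro exI[of _ k'] conjI k'(1) allI impI; drule (10) main; simp)
qed

text \<open>The points x0 to x4 are the corners of the path along a A, b B, - a A, - b B, each leg
  known to second order up to k0 t^3 + d. The factors a and b are separate so that their product may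
  have either sign.\<close>

definition comm_bound :: "'a::euclidean_space set \<Rightarrow> real \<Rightarrow> real \<Rightarrow> real \<Rightarrow> bool" where
  "comm_bound K C k0 k \<longleftrightarrow> (\<forall>A A' B B' x0 x1 x2 x3 x4 a b t d. C11_on K A A' C \<longrightarrow> C11_on K B B' C \<longrightarrow>
      x0 \<in> K \<longrightarrow> x1 \<in> K \<longrightarrow> x2 \<in> K \<longrightarrow> x3 \<in> K \<longrightarrow>
      \<bar>a\<bar> \<le> t \<longrightarrow> \<bar>b\<bar> \<le> t \<longrightarrow> 0 \<le> t \<longrightarrow> t \<le> 1 \<longrightarrow> 0 \<le> d \<longrightarrow> d \<le> 1 \<longrightarrow>
      norm (x1 - x0 - a *\<^sub>R A x0 - (a\<^sup>2 / 2) *\<^sub>R A' x0 (A x0)) \<le> k0 * t^3 + d \<longrightarrow>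
      norm (x2 - x1 - b *\<^sub>R B x1 - (b\<^sup>2 / 2) *\<^sub>R B' x1 (B x1)) \<le> k0 * t^3 + d \<longrightarrow>
      norm (x3 - x2 - (-a) *\<^sub>R A x2 - ((-a)\<^sup>2 / 2) *\<^sub>R A' x2 (A x2)) \<le> k0 * t^3 + d \<longrightarrow>
      norm (x4 - x3 - (-b) *\<^sub>R B x3 - ((-b)\<^sup>2 / 2) *\<^sub>R B' x3 (B x3)) \<le> k0 * t^3 + d \<longrightarrow>
      norm (x4 - x0 - (a * b) *\<^sub>R (B' x0 (A x0) - A' x0 (B x0))) \<le> k * (t^3 + d))"

text \<open>Once the four increments are expanded at x0, only second-order terms survive their sum:
  the displacements before the legs are 0, a A, a A + b B and b B, and the mixed terms leave a b
  times the bracket.\<close>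

lemma commutator_estimate:
  fixes K :: "'a::euclidean_space set"
  assumes "C \<ge> 0" "k0 \<ge> 1"
  shows "\<exists>k\<ge>1. comm_bound K C k0 k"
proof -
  obtain k1 where k1: "k1 \<ge> 1" and s1: "step_bound K C k0 k1"
    using step_bound_exists[OF assms] by blast
  \<comment> \<open>Each leg enlarges the displacement constant passed to the next one. Taking
    maxima keeps it above k0, so the accuracy assumed for every leg remains available.\<close>
  define m1 where "m1 = max k0 k1"
  have m1: "m1 \<ge> 1" "m1 \<ge> k0" "m1 \<ge> k1" using k1 unfolding m1_def by auto
  obtain k2 where k2: "k2 \<ge> 1" and s2: "step_bound K C m1 k2"
    using step_bound_exists[OF assms(1) m1(1)] by blast
  define m2 where "m2 = max m1 k2"
  have m2: "m2 \<ge> 1" "m2 \<ge> k0" "m2 \<ge> k2" using m1 unfolding m2_def by auto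
  obtain k3 where k3: "k3 \<ge> 1" and s3: "step_bound K C m2 k3"
    using step_bound_exists[OF assms(1) m2(1)] by blast
  define m3 where "m3 = max m2 k3"
  have m3: "m3 \<ge> 1" "m3 \<ge> k0" "m3 \<ge> k3" using m2 unfolding m3_def by auto
  obtain k4 where k4: "k4 \<ge> 1" and s4: "step_bound K C m3 k4"
    using step_bound_exists[OF assms(1) m3(1)] by blast
  note s1 = s1[unfolded step_bound_def, rule_format]
  note s2 = s2[unfolded step_bound_def, rule_format]
  note s3 = s3[unfolded step_bound_def, rule_format]
  note s4 = s4[unfolded step_bound_def, rule_format]
  define k where "k = k1 + k2 + k3 + k4"
  show ?thesis
    unfolding comm_bound_def
  proof (intro exI[of _ k] conjI allI impI)
    show "k \<ge> 1" unfolding k_def using k1 k2 k3 k4 by simp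
    fix A A' B B' and x0 x1 x2 x3 x4 :: 'a and a b t d
    assume A: "C11_on K A A' C" and B: "C11_on K B B' C" and
      x: "x0 \<in> K" "x1 \<in> K" "x2 \<in> K" "x3 \<in> K" and
      ab: "\<bar>a\<bar> \<le> t" "\<bar>b\<bar> \<le> t" and t: "0 \<le> t" "t \<le> 1" and d: "0 \<le> d" "d \<le> 1" and
      h1: "norm (x1 - x0 - a *\<^sub>R A x0 - (a\<^sup>2 / 2) *\<^sub>R A' x0 (A x0)) \<le> k0 * t^3 + d" and
      h2: "norm (x2 - x1 - b *\<^sub>R B x1 - (b\<^sup>2 / 2) *\<^sub>R B' x1 (B x1)) \<le> k0 * t^3 + d" and
      h3: "norm (x3 - x2 - (-a) *\<^sub>R A x2 - ((-a)\<^sup>2 / 2) *\<^sub>R A' x2 (A x2)) \<le> k0 * t^3 + d" and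
      h4: "norm (x4 - x3 - (-b) *\<^sub>R B x3 - ((-b)\<^sup>2 / 2) *\<^sub>R B' x3 (B x3)) \<le> k0 * t^3 + d"
    have t3: "0 \<le> t^3" "0 \<le> t\<^sup>2 + d" using t d by auto
    have up: "e \<le> m * t^3 + d" if "e \<le> k0 * t^3 + d" "k0 \<le> m" for e m
      using that mult_right_mono[OF that(2) t3(1)] by linarith
    have up2: "e \<le> m * (t\<^sup>2 + d)" if "e \<le> k * (t\<^sup>2 + d)" "k \<le> m" for e m k
      using that mult_right_mono[OF that(2) t3(2)] by linarith
    have up1: "e \<le> m * t" if "e \<le> k * t" "k \<le> m" for e m k
      using that mult_right_mono[OF that(2) t(1)] by linarith
    have ab': "\<bar>-a\<bar> \<le> t" "\<bar>-b\<bar> \<le> t" using ab by auto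
    \<comment> \<open>The first leg starts at the base point itself: y = x and v = 0.\<close>
    note r1 = s1[OF A x(1) x(1) ab(1) t d, of 0 x1, OF _ _ h1]
    have r1: "norm (x1 - x0 - (a *\<^sub>R A x0 + (a\<^sup>2 / 2) *\<^sub>R A' x0 (A x0) + a *\<^sub>R A' x0 0)) \<le> k1 * (t^3 + d)"
      "norm (x1 - x0 - (0 + a *\<^sub>R A x0)) \<le> k1 * (t\<^sup>2 + d)" "norm (0 + a *\<^sub>R A x0) \<le> k1 * t"
      using r1 t t3 assms by auto
    define v1 where "v1 = 0 + a *\<^sub>R A x0"
    note r2 = s2[OF B x(1) x(2) ab(2) t d up1[OF r1(3) m1(3)] up2[OF r1(2) m1(3)] up[OF h2 m1(2)], folded v1_def]
    define v2 where "v2 = v1 + b *\<^sub>R B x0"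
    note r3 = s3[OF A x(1) x(3) ab'(1) t d up1[OF r2[THEN conjunct2, THEN conjunct2] m2(3)]
        up2[OF r2[THEN conjunct2, THEN conjunct1] m2(3)] up[OF h3 m2(2)], folded v2_def]
    define v3 where "v3 = v2 + (-a) *\<^sub>R A x0"
    note r4 = s4[OF B x(1) x(4) ab'(2) t d up1[OF r3[THEN conjunct2, THEN conjunct2] m3(3)]
        up2[OF r3[THEN conjunct2, THEN conjunct1] m3(3)] up[OF h4 m3(2)], folded v3_def]
    define e1 where "e1 = x1 - x0 - (a *\<^sub>R A x0 + (a\<^sup>2 / 2) *\<^sub>R A' x0 (A x0) + a *\<^sub>R A' x0 0)"
    define e2 where "e2 = x2 - x1 - (b *\<^sub>R B x0 + (b\<^sup>2 / 2) *\<^sub>R B' x0 (B x0) + b *\<^sub>R B' x0 v1)"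
    define e3 where "e3 = x3 - x2 - ((-a) *\<^sub>R A x0 + ((-a)\<^sup>2 / 2) *\<^sub>R A' x0 (A x0) + (-a) *\<^sub>R A' x0 v2)"
    define e4 where "e4 = x4 - x3 - ((-b) *\<^sub>R B x0 + ((-b)\<^sup>2 / 2) *\<^sub>R B' x0 (B x0) + (-b) *\<^sub>R B' x0 v3)"
    note lA = C11_onD(1)[OF A x(1)] note lB = C11_onD(1)[OF B x(1)]
    have half: "(c\<^sup>2 / 2) *\<^sub>R z + (c\<^sup>2 / 2) *\<^sub>R z = (c * c) *\<^sub>R z" for c and z :: 'a
      by (simp add: scaleR_add_left[symmetric] power2_eq_square)
    have vs: "v1 = a *\<^sub>R A x0" "v2 = a *\<^sub>R A x0 + b *\<^sub>R B x0" "v3 = b *\<^sub>R B x0"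
      unfolding v3_def v2_def v1_def by simp_all
    \<comment> \<open>The first-order terms cancel in pairs. The halves a^2/2 of the two A legs
      cancel against the a^2 produced by the displacement in the third leg, and likewise b^2 in the
      fourth.\<close>
    have "e1 + e2 + e3 + e4 = x4 - x0 - ((a\<^sup>2 / 2) *\<^sub>R A' x0 (A x0) + (a\<^sup>2 / 2) *\<^sub>R A' x0 (A x0) - (a * a) *\<^sub>R A' x0 (A x0)
       + ((b\<^sup>2 / 2) *\<^sub>R B' x0 (B x0) + (b\<^sup>2 / 2) *\<^sub>R B' x0 (B x0) - (b * b) *\<^sub>R B' x0 (B x0))
       + (a * b) *\<^sub>R (B' x0 (A x0) - A' x0 (B x0)))"
      unfolding e1_def e2_def e3_def e4_def vs
      by (simp add: linear_0[OF lA] linear_add[OF lA] linear_cmul[OF lA] linear_add[OF lB] linear_cmul[OF lB] 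
          algebra_simps del: real_scaleR_def)
    then have "x4 - x0 - (a * b) *\<^sub>R (B' x0 (A x0) - A' x0 (B x0)) = e1 + e2 + e3 + e4"
      unfolding half by simp
    then have "norm (x4 - x0 - (a * b) *\<^sub>R (B' x0 (A x0) - A' x0 (B x0))) \<le> norm e1 + norm e2 + norm e3 + norm e4"
      by (simp only: norm_sum4_le)
    also have "\<dots> \<le> k1 * (t^3 + d) + k2 * (t^3 + d) + k3 * (t^3 + d) + k4 * (t^3 + d)"
      using r1(1) r2[THEN conjunct1] r3[THEN conjunct1] r4[THEN conjunct1]
      unfolding e1_def[symmetric] e2_def[symmetric] e3_def[symmetric] e4_def[symmetric] by linarith
    also have "\<dots> = k * (t^3 + d)" unfolding k_def by (simp add: algebra_simps)
    finally show "norm (x4 - x0 - (a * b) *\<^sub>R (B' x0 (A x0) - A' x0 (B x0))) \<le> k * (t^3 + d)" .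
  qed
qed

section \<open>Words of constant controls in a chart\<close>

text \<open>The subspace \<open>W\<close> stands for the tangent directions of the state space,
  which is open only relative to symmetric matrices. The gap between \<open>r\<close> and
  \<open>R\<close> is a reserve: words without drift are kept in the small ball, and the
  displacement by the drift uses up the rest.\<close>

locale control_chart =
  fixes W :: "'a::euclidean_space set" and p :: 'a and r R B :: real
    and F0 :: "'a \<Rightarrow> 'a" and F :: "'u::finite \<Rightarrow> 'a \<Rightarrow> 'a"
  assumes subspace: "subspace W" and p: "p \<in> W" and r: "0 < r" "r < R"
    and F_W: "\<And>i x. x \<in> W \<inter> cball p R \<Longrightarrow> F i x \<in> W"
    and F_le: "\<And>i x. x \<in> W \<inter> cball p R \<Longrightarrow> norm (F i x) \<le> B"
    and F_lip: "\<And>i. B-lipschitz_on (W \<inter> cball p R) (F i)"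
    and F0_W: "\<And>x. x \<in> W \<inter> cball p R \<Longrightarrow> F0 x \<in> W"
    and F0_le: "\<And>x. x \<in> W \<inter> cball p R \<Longrightarrow> norm (F0 x) \<le> B"
    and F0_lip: "B-lipschitz_on (W \<inter> cball p R) F0"
begin

definition D :: "real \<Rightarrow> 'a set" where "D \<rho> = W \<inter> cball p \<rho>"

text \<open>Precomposing with the projection to \<open>D R\<close> makes the fields globally Lipschitz; trajectories that stay in \<open>D R\<close> do not notice.\<close>

definition cut :: "('a \<Rightarrow> 'a) \<Rightarrow> 'a \<Rightarrow> 'a" where
  "cut H y = H (closest_point (D R) y)"

text \<open>
  A letter \<open>u\<close> is run for unit time along \<open>\<epsilon> F0 + \<Sum>i. u\<^sub>i F i\<close>. In the time scale of the original system
  this is a trajectory of duration \<open>\<epsilon>\<close> with constant control \<open>u / \<epsilon>\<close>; \<open>\<epsilon> = 0\<close> is the driftless system.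
\<close>

definition vf :: "real \<Rightarrow> real^'u \<Rightarrow> 'a \<Rightarrow> 'a" where
  "vf \<epsilon> u y = \<epsilon> *\<^sub>R cut F0 y + (\<Sum>i\<in>UNIV. u $ i *\<^sub>R cut (F i) y)"

definition vlip :: "real \<Rightarrow> real^'u \<Rightarrow> real" where
  "vlip \<epsilon> u = (\<bar>\<epsilon>\<bar> + CARD('u) * norm u) * B"

primrec wflow :: "real \<Rightarrow> (real^'u) list \<Rightarrow> 'a \<Rightarrow> 'a" where
  "wflow \<epsilon> [] x = x"
| "wflow \<epsilon> (u # us) x = wflow \<epsilon> us (flow1 (vf \<epsilon> u) x)"

primrec stays :: "real \<Rightarrow> 'a set \<Rightarrow> (real^'u) list \<Rightarrow> 'a \<Rightarrow> bool" where
  "stays \<epsilon> S [] x \<longleftrightarrow> x \<in> S"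
| "stays \<epsilon> S (u # us) x \<longleftrightarrow> (\<forall>\<sigma>\<in>{0..1}. sol (vf \<epsilon> u) x \<sigma> \<in> S) \<and> stays \<epsilon> S us (flow1 (vf \<epsilon> u) x)"

definition nice :: "('a \<Rightarrow> 'a) \<Rightarrow> ('a \<Rightarrow> 'a \<Rightarrow> 'a) \<Rightarrow> bool" where
  "nice H H' \<longleftrightarrow> (\<exists>C. C11_on (D R) H H' C) \<and> (\<forall>x\<in>D R. H x \<in> W)"

text \<open>One list of letter functions serves all starting points and all parameters: its length
  is fixed and its letters are continuous, so its endpoint is continuous in the parameter, and the
  effect of the drift can be bounded uniformly. The parameter s may be negative.\<close>

definition word_family :: "real \<Rightarrow> real \<Rightarrow> (real \<Rightarrow> 'a \<Rightarrow> 'a \<Rightarrow> bool) \<Rightarrow> bool" where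
  "word_family \<rho> s0 E \<longleftrightarrow> (\<exists>ws :: (real \<Rightarrow> real^'u) list. (\<forall>w\<in>set ws. continuous_on UNIV w) \<and>
     (\<forall>x\<in>D \<rho>. \<forall>s. \<bar>s\<bar> \<le> s0 \<longrightarrow>
        E s x (wflow 0 (map (\<lambda>w. w s) ws) x) \<and> stays 0 (D r) (map (\<lambda>w. w s) ws) x))"

text \<open>
  Words run without the drift realise \<open>H\<close> to first order (\<open>tangent\<close>), or its flow up to an
  arbitrarily small error (\<open>follow\<close>). The time bound must not depend on the error \<open>\<eta>\<close>.
\<close>

definition tangent :: "('a \<Rightarrow> 'a) \<Rightarrow> bool" where
  "tangent H \<longleftrightarrow> (\<forall>r'<r. \<forall>\<kappa>>0. \<exists>s0>0. \<forall>\<eta>>0. word_family r' s0 (\<lambda>s x y. norm (y - x - s *\<^sub>R H x) \<le> \<kappa> * \<bar>s\<bar> + \<eta>))"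

definition follow :: "('a \<Rightarrow> 'a) \<Rightarrow> bool" where
  "follow H \<longleftrightarrow> (\<forall>r'<r. \<exists>T0>0. \<forall>\<eta>>0. word_family r' T0 (\<lambda>t x y. norm (y - flow1 (\<lambda>y. t *\<^sub>R cut H y) x) \<le> \<eta>))"

section \<open>Cut-off fields and their flows\<close>

lemma D_mono: "a \<le> b \<Longrightarrow> D a \<subseteq> D b"
  unfolding D_def by auto

lemma mem_D: "x \<in> D a \<longleftrightarrow> x \<in> W \<and> norm (x - p) \<le> a"
  unfolding D_def by (auto simp: dist_norm norm_minus_commute)

lemma D_nonempty: "a \<ge> 0 \<Longrightarrow> D a \<noteq> {}"
  using p mem_D[of p a] by auto

lemma D_closed: "closed (D a)" and D_convex: "convex (D a)"
proof -
  show "closed (D a)" unfolding D_def by (rule closed_Int[OF closed_subspace[OF subspace] closed_cball])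
  show "convex (D a)" unfolding D_def by (rule convex_Int[OF subspace_imp_convex[OF subspace] convex_cball])
qed

lemma cp_mem: "closest_point (D R) y \<in> D R"
  using r by (intro closest_point_in_set D_closed D_nonempty) auto

lemma cut_eq: "y \<in> D R \<Longrightarrow> cut H y = H y"
  unfolding cut_def by (simp add: closest_point_self)

lemma cut_lipschitz:
  assumes "C-lipschitz_on (D R) H"
  shows "C-lipschitz_on UNIV (cut H)"
proof (rule lipschitz_onI)
  fix y z
  have "dist (cut H y) (cut H z) \<le> C * dist (closest_point (D R) y) (closest_point (D R) z)"
    unfolding cut_def by (intro lipschitz_onD[OF assms] cp_mem)
  also have "\<dots> \<le> C * dist y z"
    using r by (intro mult_left_mono closest_point_lipschitz D_convex D_closed D_nonempty lipschitz_on_nonneg[OF assms]) auto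
  finally show "dist (cut H y) (cut H z) \<le> C * dist y z" .
qed (rule lipschitz_on_nonneg[OF assms])

lemma B_nonneg: "B \<ge> 0"
  using F0_lip by (rule lipschitz_on_nonneg)

lemma cutF: "cut (F i) y \<in> W" "norm (cut (F i) y) \<le> B" "B-lipschitz_on UNIV (cut (F i))"
  using F_W[OF cp_mem[unfolded D_def]] F_le[OF cp_mem[unfolded D_def]] cut_lipschitz[of B "F i"] F_lip[of i]
  unfolding cut_def D_def by auto

lemma cutF0: "cut F0 y \<in> W" "norm (cut F0 y) \<le> B" "B-lipschitz_on UNIV (cut F0)"
  using F0_W[OF cp_mem[unfolded D_def]] F0_le[OF cp_mem[unfolded D_def]] cut_lipschitz[of B F0] F0_lip
  unfolding cut_def D_def by auto

lemma sum_abs_le: "(\<Sum>i\<in>UNIV. \<bar>u $ i\<bar> * b) \<le> CARD('u) * norm (u :: real^'u) * b" if "b \<ge> 0"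
proof -
  have "(\<Sum>i\<in>UNIV. \<bar>u $ i\<bar> * b) \<le> (\<Sum>i\<in>(UNIV::'u set). norm u * b)"
    using that by (intro sum_mono mult_right_mono component_le_norm_cart) auto
  then show ?thesis by simp
qed

lemma vf_diff: "norm (vf \<epsilon> u y - vf \<epsilon>' u' y) \<le> (\<bar>\<epsilon> - \<epsilon>'\<bar> + CARD('u) * norm (u - u')) * B"
proof -
  have "vf \<epsilon> u y - vf \<epsilon>' u' y = (\<epsilon> - \<epsilon>') *\<^sub>R cut F0 y + (\<Sum>i\<in>UNIV. (u - u') $ i *\<^sub>R cut (F i) y)"
    unfolding vf_def by (simp add: algebra_simps sum_subtractf)
  then have "norm (vf \<epsilon> u y - vf \<epsilon>' u' y) \<le> norm ((\<epsilon> - \<epsilon>') *\<^sub>R cut F0 y) + norm (\<Sum>i\<in>UNIV. (u - u') $ i *\<^sub>R cut (F i) y)"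
    by (simp only: norm_triangle_ineq)
  also have "\<dots> \<le> \<bar>\<epsilon> - \<epsilon>'\<bar> * B + (\<Sum>i\<in>UNIV. \<bar>(u - u') $ i\<bar> * B)"
    using cutF0(2) cutF(2) by (intro add_mono order_trans[OF norm_sum] sum_mono) (auto intro!: mult_left_mono)
  also have "\<dots> \<le> \<bar>\<epsilon> - \<epsilon>'\<bar> * B + CARD('u) * norm (u - u') * B"
    by (intro add_left_mono sum_abs_le B_nonneg)
  finally show ?thesis by (simp add: algebra_simps)
qed

lemma vf_lipschitz: "(vlip \<epsilon> u)-lipschitz_on UNIV (vf \<epsilon> u)"
proof (rule lipschitz_onI)
  fix y z
  have "vf \<epsilon> u y - vf \<epsilon> u z = \<epsilon> *\<^sub>R (cut F0 y - cut F0 z) + (\<Sum>i\<in>UNIV. u $ i *\<^sub>R (cut (F i) y - cut (F i) z))"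
    unfolding vf_def by (simp add: algebra_simps sum_subtractf)
  then have "norm (vf \<epsilon> u y - vf \<epsilon> u z) \<le> norm (\<epsilon> *\<^sub>R (cut F0 y - cut F0 z)) + norm (\<Sum>i\<in>UNIV. u $ i *\<^sub>R (cut (F i) y - cut (F i) z))"
    by (simp only: norm_triangle_ineq)
  also have "\<dots> \<le> \<bar>\<epsilon>\<bar> * (B * dist y z) + (\<Sum>i\<in>UNIV. \<bar>u $ i\<bar> * (B * dist y z))"
    using lipschitz_onD[OF cutF0(3), of y z] lipschitz_onD[OF cutF(3), of y z]
    by (intro add_mono order_trans[OF norm_sum] sum_mono) (auto simp: dist_norm intro!: mult_left_mono)
  also have "\<dots> \<le> \<bar>\<epsilon>\<bar> * (B * dist y z) + CARD('u) * norm u * (B * dist y z)"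
    using B_nonneg by (intro add_left_mono sum_abs_le) auto
  finally show "dist (vf \<epsilon> u y) (vf \<epsilon> u z) \<le> vlip \<epsilon> u * dist y z"
    unfolding vlip_def by (simp add: algebra_simps dist_norm)
qed (use B_nonneg in \<open>auto simp: vlip_def\<close>)

lemma vf_W: "vf \<epsilon> u y \<in> W"
  unfolding vf_def using cutF cutF0 subspace by (intro subspace_add subspace_mul subspace_sum) auto

lemma sol_vf_W: "x \<in> W \<Longrightarrow> t \<ge> 0 \<Longrightarrow> sol (vf \<epsilon> u) x t \<in> W"
  by (rule sol_in_subspace[OF vf_lipschitz subspace vf_W])

lemma flow1_vf_W: "x \<in> W \<Longrightarrow> flow1 (vf \<epsilon> u) x \<in> W"
  unfolding flow1_def by (rule sol_vf_W) auto

lemma wflow_W: "x \<in> W \<Longrightarrow> wflow \<epsilon> us x \<in> W"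
  by (induction us arbitrary: x) (auto simp: flow1_vf_W)

lemma wflow_append: "wflow \<epsilon> (us @ vs) x = wflow \<epsilon> vs (wflow \<epsilon> us x)"
  by (induction us arbitrary: x) auto

lemma stays_append: "stays \<epsilon> S us x \<Longrightarrow> stays \<epsilon> S vs (wflow \<epsilon> us x) \<Longrightarrow> stays \<epsilon> S (us @ vs) x"
  by (induction us arbitrary: x) auto

lemma stays_mono: "stays \<epsilon> S us x \<Longrightarrow> S \<subseteq> S' \<Longrightarrow> stays \<epsilon> S' us x"
  by (induction us arbitrary: x) auto

lemma flow1_vf_dist:
  "norm (flow1 (vf \<epsilon> u) x - flow1 (vf \<epsilon>' u') x')
     \<le> exp (vlip \<epsilon> u + 1) * (norm (x - x') + (\<bar>\<epsilon> - \<epsilon>'\<bar> + CARD('u) * norm (u - u')) * B)"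
  by (rule flow1_dist[OF vf_lipschitz vf_lipschitz vf_diff])

text \<open>The Gronwall constant in \<open>flow1_vf_dist\<close> involves only the first of the two
  fields. Putting the fixed parameter there keeps it constant while the other parameter
  converges.\<close>

lemma continuous_on_flow1_vf:
  assumes "continuous_on S w" "continuous_on S \<xi>"
  shows "continuous_on S (\<lambda>z. flow1 (vf \<epsilon> (w z)) (\<xi> z))"
  unfolding continuous_on_def
proof
  fix z assume z: "z \<in> S"
  let ?f = "\<lambda>z. flow1 (vf \<epsilon> (w z)) (\<xi> z)"
  let ?b = "\<lambda>y. exp (vlip \<epsilon> (w z) + 1) * (norm (\<xi> z - \<xi> y) + (\<bar>\<epsilon> - \<epsilon>\<bar> + CARD('u) * norm (w z - w y)) * B)"
  have w: "(w \<longlongrightarrow> w z) (at z within S)" "(\<xi> \<longlongrightarrow> \<xi> z) (at z within S)"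
    using assms z by (auto simp: continuous_on_def)
  have "(?b \<longlongrightarrow> exp (vlip \<epsilon> (w z) + 1) * (norm (\<xi> z - \<xi> z) + (\<bar>\<epsilon> - \<epsilon>\<bar> + CARD('u) * norm (w z - w z)) * B)) (at z within S)"
    by (intro tendsto_intros w)
  then have b: "(?b \<longlongrightarrow> 0) (at z within S)" by simp
  have "((\<lambda>y. ?f y - ?f z) \<longlongrightarrow> 0) (at z within S)"
    by (rule Lim_null_comparison[OF _ b], rule always_eventually, rule allI,
        subst norm_minus_commute, rule flow1_vf_dist)
  then show "(?f \<longlongrightarrow> ?f z) (at z within S)" by (rule LIM_zero_cancel)
qed

lemma continuous_on_wflow:
  assumes "\<forall>w\<in>set ws. continuous_on S w" "continuous_on S \<xi>"
  shows "continuous_on S (\<lambda>z. wflow \<epsilon> (map (\<lambda>w. w z) ws) (\<xi> z))"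
  using assms by (induction ws arbitrary: \<xi>) (auto simp: continuous_on_flow1_vf)

lemma nice_constant:
  assumes "nice H H'"
  obtains C where "C \<ge> 0" "C11_on (D R) H H' C" "C-lipschitz_on UNIV (cut H)"
    "\<And>y. norm (cut H y) \<le> C" "\<And>y. cut H y \<in> W"
proof -
  obtain C where C: "C11_on (D R) H H' C" and W: "\<And>x. x \<in> D R \<Longrightarrow> H x \<in> W"
    using assms unfolding nice_def by blast
  have C0: "C \<ge> 0" using C by (simp add: C11_on_def)
  have "C-lipschitz_on (D R) H"
  proof (rule lipschitz_onI)
    fix x y assume "x \<in> D R" "y \<in> D R"
    then show "dist (H x) (H y) \<le> C * dist x y" using C11_onD(4)[OF C, of y x] by (simp add: dist_norm)
  qed fact
  then show ?thesis
    using cp_mem by (intro that[of C] C0 C cut_lipschitz) (auto simp: cut_def intro: W C11_onD(2)[OF C])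
qed

text \<open>Taylor expansion of the flow in s, for s of either sign. The mean value inequality is
  applied to the curve minus its Taylor polynomial, and the first-order bound feeds the second-order
  one. The room condition keeps the curve in \<open>D R\<close>, where cutting off changes
  nothing.\<close>

lemma cut_flow_bounds:
  assumes C: "C \<ge> 0" "C11_on (D R) H H' C" "C-lipschitz_on UNIV (cut H)"
    "\<And>y. norm (cut H y) \<le> C" "\<And>y. cut H y \<in> W"
    and x: "x \<in> D \<rho>" and s: "\<rho> + C * \<bar>s\<bar> \<le> R"
  shows "norm (flow1 (\<lambda>y. s *\<^sub>R cut H y) x - x) \<le> C * \<bar>s\<bar>"
    and "flow1 (\<lambda>y. s *\<^sub>R cut H y) x \<in> D (\<rho> + C * \<bar>s\<bar>)"
    and "norm (flow1 (\<lambda>y. s *\<^sub>R cut H y) x - x - s *\<^sub>R H x) \<le> C\<^sup>2 * s\<^sup>2"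
    and "norm (flow1 (\<lambda>y. s *\<^sub>R cut H y) x - x - s *\<^sub>R H x - (s\<^sup>2 / 2) *\<^sub>R H' x (H x)) \<le> 2 * C^3 * \<bar>s\<bar>^3"
proof -
  let ?X = "\<lambda>s. flow1 (\<lambda>y. s *\<^sub>R cut H y) x"
  note c11 = C11_onD[OF C(2)]
  have lip: "(\<bar>s\<bar> * C)-lipschitz_on UNIV (\<lambda>y. s *\<^sub>R cut H y)" for s
    by (rule lipschitz_on_scaleR_field[OF C(3)])
  have near: "norm (?X s - x) \<le> C * \<bar>s\<bar>" for s
    by (rule norm_flow1_diff_le[OF lip]) (use C(4) in \<open>auto simp: mult.commute[of C] intro!: mult_left_mono\<close>)
  then show "norm (?X s - x) \<le> C * \<bar>s\<bar>" .
  have xW: "x \<in> W" "norm (x - p) \<le> \<rho>" using x by (auto simp: mem_D)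
  have XW: "?X s \<in> W" for s
    unfolding flow1_def by (rule sol_in_subspace[OF lip subspace _ xW(1)]) (use C(5) subspace in \<open>auto intro: subspace_mul\<close>)
  have XD: "?X s \<in> D (\<rho> + C * \<bar>s\<bar>)" for s
    using norm_triangle_ineq[of "?X s - x" "x - p"] near[of s] xW(2) XW[of s] by (auto simp: mem_D)
  then show "?X s \<in> D (\<rho> + C * \<bar>s\<bar>)" .
  have "0 \<le> C * \<bar>s\<bar>" using C(1) by simp
  then have "\<rho> \<le> R" using s by linarith
  then have xR: "x \<in> D R" using x D_mono by blast
  have XR: "?X s' \<in> D R" if "\<bar>s'\<bar> \<le> \<bar>s\<bar>" for s'
  proof -
    have "C * \<bar>s'\<bar> \<le> C * \<bar>s\<bar>" using that C(1) by (intro mult_left_mono)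
    then show ?thesis using XD[of s'] D_mono[of "\<rho> + C * \<bar>s'\<bar>" R] s by auto
  qed
  have der: "((\<lambda>\<sigma>. ?X (\<sigma> * s')) has_vector_derivative s' *\<^sub>R cut H (?X (\<sigma> * s'))) (at \<sigma> within {0..1})"
    if "\<sigma> \<in> {0..1}" for \<sigma> s'
  proof -
    have eq: "sol (\<lambda>y. s' *\<^sub>R cut H y) x t = ?X (t * s')" if "t \<ge> 0" for t
      using sol_eq_flow1[OF lip that] by simp
    have "(sol (\<lambda>y. s' *\<^sub>R cut H y) x has_vector_derivative s' *\<^sub>R cut H (sol (\<lambda>y. s' *\<^sub>R cut H y) x \<sigma>)) (at \<sigma> within {0..})"
      using sol_solves(2)[OF lip] that by (auto simp: solves_def)
    then have "(sol (\<lambda>y. s' *\<^sub>R cut H y) x has_vector_derivative s' *\<^sub>R cut H (sol (\<lambda>y. s' *\<^sub>R cut H y) x \<sigma>)) (at \<sigma> within {0..1})"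
      by (rule has_vector_derivative_within_subset) auto
    then have "((\<lambda>\<sigma>. ?X (\<sigma> * s')) has_vector_derivative s' *\<^sub>R cut H (sol (\<lambda>y. s' *\<^sub>R cut H y) x \<sigma>)) (at \<sigma> within {0..1})"
      by (rule has_vector_derivative_transform[rotated 2]) (use that eq in auto)
    then show ?thesis using eq[of \<sigma>] that by simp
  qed
  have X0: "?X 0 = x" using flow1_zero[of x] by simp
  have first: "norm (?X s' - x - s' *\<^sub>R H x) \<le> C\<^sup>2 * s'\<^sup>2" if s': "\<bar>s'\<bar> \<le> \<bar>s\<bar>" for s'
  proof -
    have "norm ((?X (1 * s') - 1 *\<^sub>R s' *\<^sub>R H x) - (?X (0 * s') - 0 *\<^sub>R s' *\<^sub>R H x)) \<le> (C\<^sup>2 * s'\<^sup>2) * norm (1 - 0 :: real)"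
    proof (rule differentiable_bound[of "{0..1}"])
      fix \<sigma> :: real assume \<sigma>: "\<sigma> \<in> {0..1}"
      show "((\<lambda>\<sigma>. ?X (\<sigma> * s') - \<sigma> *\<^sub>R s' *\<^sub>R H x) has_derivative
         (\<lambda>h. h *\<^sub>R (s' *\<^sub>R cut H (?X (\<sigma> * s')) - s' *\<^sub>R H x))) (at \<sigma> within {0..1})"
        using der[OF \<sigma>, of s'] unfolding has_vector_derivative_def
        by (auto intro!: derivative_eq_intros simp: algebra_simps)
      have le: "\<bar>\<sigma> * s'\<bar> \<le> \<bar>s'\<bar>" using \<sigma> by (simp add: abs_mult mult_left_le_one_le)
      have XR': "?X (\<sigma> * s') \<in> D R" using XR le s' by auto
      have "norm (H (?X (\<sigma> * s')) - H x) \<le> C * norm (?X (\<sigma> * s') - x)"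
        by (rule c11(4)[OF xR XR'])
      also have "\<dots> \<le> C * (C * \<bar>s'\<bar>)"
        using near[of "\<sigma> * s'"] mult_left_mono[OF le C(1)] C(1) by (intro mult_left_mono) auto
      finally have "\<bar>s'\<bar> * norm (H (?X (\<sigma> * s')) - H x) \<le> \<bar>s'\<bar> * (C * (C * \<bar>s'\<bar>))" by (intro mult_left_mono) auto
      then have "norm (s' *\<^sub>R cut H (?X (\<sigma> * s')) - s' *\<^sub>R H x) \<le> C\<^sup>2 * s'\<^sup>2"
        by (simp add: cut_eq[OF XR'] scaleR_diff_right[symmetric] power2_eq_square mult_ac)
      then show "onorm (\<lambda>h. h *\<^sub>R (s' *\<^sub>R cut H (?X (\<sigma> * s')) - s' *\<^sub>R H x)) \<le> C\<^sup>2 * s'\<^sup>2"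
        by (intro onorm_bound) (auto simp: mult.commute[of "C\<^sup>2 * s'\<^sup>2"] intro!: mult_left_mono)
    qed auto
    then show ?thesis using X0 by (simp add: algebra_simps)
  qed
  show "norm (?X s - x - s *\<^sub>R H x) \<le> C\<^sup>2 * s\<^sup>2" by (rule first) simp
  define Y where "Y = (\<lambda>\<sigma>. ?X (\<sigma> * s) - \<sigma> *\<^sub>R s *\<^sub>R H x - (\<sigma>\<^sup>2 / 2) *\<^sub>R s\<^sup>2 *\<^sub>R H' x (H x))"
  have "norm (Y 1 - Y 0) \<le> (2 * C^3 * \<bar>s\<bar>^3) * norm (1 - 0 :: real)"
  proof (rule differentiable_bound[of "{0..1}"])
    fix \<sigma> :: real assume \<sigma>: "\<sigma> \<in> {0..1}"
    show "(Y has_derivative (\<lambda>h. h *\<^sub>R (s *\<^sub>R cut H (?X (\<sigma> * s)) - s *\<^sub>R H x - \<sigma> *\<^sub>R s\<^sup>2 *\<^sub>R H' x (H x)))) (at \<sigma> within {0..1})"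
      using der[OF \<sigma>, of s] unfolding has_vector_derivative_def Y_def
      by (auto intro!: derivative_eq_intros simp: algebra_simps)
    have le: "\<bar>\<sigma> * s\<bar> \<le> \<bar>s\<bar>" using \<sigma> by (simp add: abs_mult mult_left_le_one_le)
    have XR': "?X (\<sigma> * s) \<in> D R" using XR le by auto
    let ?y = "?X (\<sigma> * s)"
    have n: "norm (?y - x) \<le> C * \<bar>s\<bar>" using near[of "\<sigma> * s"] mult_left_mono[OF le C(1)] by linarith
    have "H ?y - H x - (\<sigma> * s) *\<^sub>R H' x (H x) = (H ?y - H x - H' x (?y - x)) + H' x (?y - x - (\<sigma> * s) *\<^sub>R H x)"
      using c11(1)[OF xR] by (simp add: linear_diff linear_cmul)
    then have "norm (H ?y - H x - (\<sigma> * s) *\<^sub>R H' x (H x)) \<le> norm (H ?y - H x - H' x (?y - x)) + norm (H' x (?y - x - (\<sigma> * s) *\<^sub>R H x))"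
      by (simp only: norm_triangle_ineq)
    also have "\<dots> \<le> C * (C * \<bar>s\<bar>)\<^sup>2 + C * (C\<^sup>2 * s\<^sup>2)"
    proof (rule add_mono)
      show "norm (H ?y - H x - H' x (?y - x)) \<le> C * (C * \<bar>s\<bar>)\<^sup>2"
        using c11(5)[OF xR XR'] mult_left_mono[OF power_mono[OF n norm_ge_zero] C(1), of 2] by linarith
      have "norm (?y - x - (\<sigma> * s) *\<^sub>R H x) \<le> C\<^sup>2 * (\<sigma> * s)\<^sup>2" by (rule first[OF le])
      also have "\<dots> \<le> C\<^sup>2 * s\<^sup>2" using le by (intro mult_left_mono) (auto simp: abs_le_square_iff)
      finally show "norm (H' x (?y - x - (\<sigma> * s) *\<^sub>R H x)) \<le> C * (C\<^sup>2 * s\<^sup>2)"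
        using c11(3)[OF xR, of "?y - x - (\<sigma> * s) *\<^sub>R H x"] mult_left_mono[OF _ C(1)] by (meson order_trans)
    qed
    also have "\<dots> = 2 * C^3 * s\<^sup>2" by (simp add: power2_eq_square power3_eq_cube)
    finally have "\<bar>s\<bar> * norm (H ?y - H x - (\<sigma> * s) *\<^sub>R H' x (H x)) \<le> \<bar>s\<bar> * (2 * C^3 * s\<^sup>2)" by (intro mult_left_mono) auto
    moreover have "s *\<^sub>R cut H ?y - s *\<^sub>R H x - \<sigma> *\<^sub>R s\<^sup>2 *\<^sub>R H' x (H x) = s *\<^sub>R (H ?y - H x - (\<sigma> * s) *\<^sub>R H' x (H x))"
      by (simp add: cut_eq[OF XR'] algebra_simps power2_eq_square)
    moreover have "\<bar>s\<bar> * (2 * C^3 * s\<^sup>2) = 2 * C^3 * \<bar>s\<bar>^3" by (simp add: power3_eq_cube power2_eq_square)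
    ultimately have "norm (s *\<^sub>R cut H ?y - s *\<^sub>R H x - \<sigma> *\<^sub>R s\<^sup>2 *\<^sub>R H' x (H x)) \<le> 2 * C^3 * \<bar>s\<bar>^3" by simp
    then show "onorm (\<lambda>h. h *\<^sub>R (s *\<^sub>R cut H ?y - s *\<^sub>R H x - \<sigma> *\<^sub>R s\<^sup>2 *\<^sub>R H' x (H x))) \<le> 2 * C^3 * \<bar>s\<bar>^3"
      by (intro onorm_bound) (use C(1) in \<open>auto simp: mult.commute[of "2 * C^3 * \<bar>s\<bar>^3"] intro!: mult_left_mono\<close>)
  qed auto
  moreover have "Y 1 - Y 0 = ?X s - x - s *\<^sub>R H x - (s\<^sup>2 / 2) *\<^sub>R H' x (H x)"
    unfolding Y_def using X0 by simp
  ultimately show "norm (?X s - x - s *\<^sub>R H x - (s\<^sup>2 / 2) *\<^sub>R H' x (H x)) \<le> 2 * C^3 * \<bar>s\<bar>^3" by simp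
qed

section \<open>Closure properties of the realisable fields\<close>

lemma tangentD:
  assumes "tangent H" "r' < r" "\<kappa> > 0"
  shows "\<exists>s0>0. \<forall>\<eta>>0. word_family r' s0 (\<lambda>s x y. norm (y - x - s *\<^sub>R H x) \<le> \<kappa> * \<bar>s\<bar> + \<eta>)"
  using assms unfolding tangent_def by blast

lemma followD:
  assumes "follow H" "r' < r"
  shows "\<exists>T0>0. \<forall>\<eta>>0. word_family r' T0 (\<lambda>t x y. norm (y - flow1 (\<lambda>y. t *\<^sub>R cut H y) x) \<le> \<eta>)"
  using assms unfolding follow_def by blast

text \<open>Identities such as that for the lift of a bracket hold only over V, so fields are
  compared on \<open>D r\<close> alone.\<close>

lemma tangent_cong:
  assumes H: "tangent H" and eq: "\<And>x. x \<in> D r \<Longrightarrow> H' x = H x"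
  shows "tangent H'"
  unfolding tangent_def
proof (intro allI impI)
  fix r' \<kappa> :: real assume r': "r' < r" and \<kappa>: "0 < \<kappa>"
  have eq': "H' x = H x" if "x \<in> D r'" for x using that D_mono[of r' r] r' by (intro eq) auto
  show "\<exists>s0>0. \<forall>\<eta>>0. word_family r' s0 (\<lambda>s x y. norm (y - x - s *\<^sub>R H' x) \<le> \<kappa> * \<bar>s\<bar> + \<eta>)"
    using H r' \<kappa> unfolding tangent_def word_family_def by (simp add: eq')
qed

lemma tangent_zero: "tangent (\<lambda>x. 0)"
  unfolding tangent_def
proof (intro allI impI)
  fix r' \<kappa> :: real assume r': "r' < r" and \<kappa>: "0 < \<kappa>"
  then show "\<exists>s0>0. \<forall>\<eta>>0. word_family r' s0 (\<lambda>s x y. norm (y - x - s *\<^sub>R (0::'a)) \<le> \<kappa> * \<bar>s\<bar> + \<eta>)"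
    using D_mono[of r' r] unfolding word_family_def
    by (intro exI[of _ 1] conjI allI impI exI[of _ "[]"]) auto
qed

text \<open>The single letter \<open>axis i s\<close> already runs the exact flow of s F i, whose
  deviation from the tangent is quadratic in s.\<close>

lemma tangent_generator:
  assumes "nice (F i) H'"
  shows "tangent (F i)"
  unfolding tangent_def
proof (intro allI impI)
  fix r' \<kappa> :: real assume r': "r' < r" and \<kappa>: "0 < \<kappa>"
  obtain C where C: "C \<ge> 0" "C11_on (D R) (F i) H' C" "C-lipschitz_on UNIV (cut (F i))"
    "\<And>y. norm (cut (F i) y) \<le> C" "\<And>y. cut (F i) y \<in> W"
    using nice_constant[OF assms] by blast
  \<comment> \<open>The first bound keeps the arc in \<open>D r\<close>, the second turns C^2 s^2
    into \<kappa> |s|; adding 1 avoids division by zero.\<close>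
  define s0 where "s0 = min ((r - r') / (C + 1)) (\<kappa> / (C\<^sup>2 + 1))"
  have "C\<^sup>2 + 1 > 0" by (rule add_nonneg_pos) auto
  then have s0: "s0 > 0" unfolding s0_def using r' \<kappa> C(1) by auto
  have "s0 * (C + 1) \<le> r - r'" unfolding s0_def min_mult_distrib_right using C(1) by auto
  then have Cs0: "C * s0 \<le> r - r'" using s0 by (simp add: algebra_simps)
  have "s0 * (C\<^sup>2 + 1) \<le> \<kappa>" unfolding s0_def min_mult_distrib_right using \<open>C\<^sup>2 + 1 > 0\<close> by auto
  then have C2s0: "C\<^sup>2 * s0 \<le> \<kappa>" using s0 by (simp add: algebra_simps)
  have vf: "vf 0 (axis i s) = (\<lambda>y. s *\<^sub>R cut (F i) y)" for s
  proof
    fix y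
    have "(\<Sum>j\<in>UNIV. axis i s $ j *\<^sub>R cut (F j) y) = (\<Sum>j\<in>UNIV. if j = i then s *\<^sub>R cut (F i) y else 0)"
      by (rule sum.cong) (auto simp: axis_def)
    then show "vf 0 (axis i s) y = s *\<^sub>R cut (F i) y" unfolding vf_def by simp
  qed
  have lip: "(\<bar>s\<bar> * C)-lipschitz_on UNIV (\<lambda>y. s *\<^sub>R cut (F i) y)" for s
    by (rule lipschitz_on_scaleR_field[OF C(3)])
  have "norm (wflow 0 (map (\<lambda>w. w s) [axis i]) x - x - s *\<^sub>R F i x) \<le> \<kappa> * \<bar>s\<bar> + \<eta> \<and>
        stays 0 (D r) (map (\<lambda>w. w s) [axis i]) x"
    if x: "x \<in> D r'" and s: "\<bar>s\<bar> \<le> s0" and \<eta>: "\<eta> > 0" for x s \<eta>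
  proof -
    have le: "r' + C * \<bar>\<sigma>\<bar> \<le> r" if "\<bar>\<sigma>\<bar> \<le> \<bar>s\<bar>" for \<sigma>
    proof -
      have "C * \<bar>\<sigma>\<bar> \<le> C * s0" using that s C(1) by (intro mult_left_mono) auto
      then show ?thesis using Cs0 by simp
    qed
    have leR: "r' + C * \<bar>\<sigma>\<bar> \<le> R" if "\<bar>\<sigma>\<bar> \<le> \<bar>s\<bar>" for \<sigma> using le[OF that] r by simp
    have fin: "flow1 (\<lambda>y. \<sigma> *\<^sub>R cut (F i) y) x \<in> D r" if "\<bar>\<sigma>\<bar> \<le> \<bar>s\<bar>" for \<sigma>
      using cut_flow_bounds(2)[OF C x leR[OF that]] D_mono[OF le[OF that]] by auto
    have "sol (\<lambda>y. s *\<^sub>R cut (F i) y) x \<sigma> \<in> D r" if "\<sigma> \<in> {0..1}" for \<sigma>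
    proof -
      have "\<bar>\<sigma> * s\<bar> \<le> \<bar>s\<bar>" using that by (simp add: abs_mult mult_left_le_one_le)
      from fin[OF this] show ?thesis using sol_eq_flow1[OF lip, of \<sigma> s x] that by simp
    qed
    moreover have "norm (flow1 (\<lambda>y. s *\<^sub>R cut (F i) y) x - x - s *\<^sub>R F i x) \<le> \<kappa> * \<bar>s\<bar> + \<eta>"
    proof -
      have "C\<^sup>2 * s\<^sup>2 = (C\<^sup>2 * \<bar>s\<bar>) * \<bar>s\<bar>" by (simp add: power2_eq_square)
      also have "\<dots> \<le> \<kappa> * \<bar>s\<bar>"
        using C2s0 mult_left_mono[OF s, of "C\<^sup>2"] by (intro mult_right_mono) auto
      finally show ?thesis using cut_flow_bounds(3)[OF C x leR[OF order_refl]] \<eta> by linarith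
    qed
    ultimately show ?thesis using fin[OF order_refl] by (simp add: vf)
  qed
  moreover have "continuous_on UNIV (axis i :: real \<Rightarrow> real^'u)"
  proof -
    have *: "(axis i :: real \<Rightarrow> real^'u) = (\<lambda>s. s *\<^sub>R axis i 1)" by (auto simp: axis_def vec_eq_iff fun_eq_iff)
    have "continuous_on UNIV (\<lambda>s. s *\<^sub>R (axis i 1 :: real^'u))" by (intro continuous_intros)
    then show ?thesis by (simp only: *[symmetric])
  qed
  ultimately show "\<exists>s0>0. \<forall>\<eta>>0. word_family r' s0 (\<lambda>s x y. norm (y - x - s *\<^sub>R F i x) \<le> \<kappa> * \<bar>s\<bar> + \<eta>)"
    using s0 unfolding word_family_def
    by (intro exI[of _ s0] conjI allI impI exI[of _ "[axis i]"] ballI) auto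
qed

text \<open>Reparametrising the word by c s suffices, also for negative c, because word families
  cover both signs of s.\<close>

lemma tangent_scale:
  assumes H: "tangent H"
  shows "tangent (\<lambda>x. c *\<^sub>R H x)"
  unfolding tangent_def
proof (intro allI impI)
  fix r' \<kappa> :: real assume r': "r' < r" and \<kappa>: "0 < \<kappa>"
  define k where "k = \<bar>c\<bar> + 1"
  have k: "k > 0" "\<bar>c\<bar> \<le> k" unfolding k_def by auto
  obtain s1 where s1: "s1 > 0" and ex: "\<forall>\<eta>>0. word_family r' s1 (\<lambda>s x y. norm (y - x - s *\<^sub>R H x) \<le> \<kappa> / k * \<bar>s\<bar> + \<eta>)"
    using tangentD[OF H r' divide_pos_pos[OF \<kappa> k(1)]] by blast
  show "\<exists>s0>0. \<forall>\<eta>>0. word_family r' s0 (\<lambda>s x y. norm (y - x - s *\<^sub>R c *\<^sub>R H x) \<le> \<kappa> * \<bar>s\<bar> + \<eta>)"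
  proof (intro exI[of _ "s1 / k"] conjI allI impI)
    show "0 < s1 / k" using s1 k by simp
    fix \<eta> :: real assume \<eta>: "\<eta> > 0"
    obtain ws :: "(real \<Rightarrow> real^'u) list" where cont: "\<forall>w\<in>set ws. continuous_on UNIV w"
      and ws: "\<And>x s. x \<in> D r' \<Longrightarrow> \<bar>s\<bar> \<le> s1 \<Longrightarrow>
        norm (wflow 0 (map (\<lambda>w. w s) ws) x - x - s *\<^sub>R H x) \<le> \<kappa> / k * \<bar>s\<bar> + \<eta> \<and>
        stays 0 (D r) (map (\<lambda>w. w s) ws) x"
      using ex[rule_format, OF \<eta>] unfolding word_family_def by auto
    define ws' where "ws' = map (\<lambda>w s. w (c * s)) ws"
    have m: "map (\<lambda>w. w s) ws' = map (\<lambda>w. w (c * s)) ws" for s unfolding ws'_def by simp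
    have c1: "\<forall>w\<in>set ws'. continuous_on UNIV w"
      unfolding ws'_def using cont by (auto intro!: continuous_on_compose2[of UNIV _ UNIV "\<lambda>s. c * s"] continuous_intros)
    have c2: "norm (wflow 0 (map (\<lambda>w. w s) ws') x - x - s *\<^sub>R c *\<^sub>R H x) \<le> \<kappa> * \<bar>s\<bar> + \<eta> \<and>
        stays 0 (D r) (map (\<lambda>w. w s) ws') x" if x: "x \<in> D r'" and s: "\<bar>s\<bar> \<le> s1 / k" for x s
    proof -
      have "\<bar>c * s\<bar> \<le> k * \<bar>s\<bar>" using k by (simp add: abs_mult mult_right_mono)
      moreover have "k * \<bar>s\<bar> \<le> s1" using s k by (simp add: field_simps)
      ultimately have "\<bar>c * s\<bar> \<le> s1" by simp
      note w = ws[OF x this]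
      have "\<kappa> / k * \<bar>c * s\<bar> \<le> \<kappa> / k * (k * \<bar>s\<bar>)"
        using \<open>\<bar>c * s\<bar> \<le> k * \<bar>s\<bar>\<close> \<kappa> k by (intro mult_left_mono) auto
      then have "\<kappa> / k * \<bar>c * s\<bar> \<le> \<kappa> * \<bar>s\<bar>" using k by simp
      then show ?thesis using w unfolding m by (auto simp: mult.commute[of c s])
    qed
    show "word_family r' (s1 / k) (\<lambda>s x y. norm (y - x - s *\<^sub>R c *\<^sub>R H x) \<le> \<kappa> * \<bar>s\<bar> + \<eta>)"
      unfolding word_family_def by (rule exI[of _ ws'], rule conjI[OF c1], intro ballI allI impI, rule c2)
  qed
qed

lemma nice_common_constant:
  assumes "nice A A'" "nice Q Q'"
  obtains C where "C \<ge> 0" "C11_on (D R) A A' C" "C11_on (D R) Q Q' C"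
    "C-lipschitz_on UNIV (cut A)" "\<And>y. norm (cut A y) \<le> C" "\<And>y. cut A y \<in> W"
    "C-lipschitz_on UNIV (cut Q)" "\<And>y. norm (cut Q y) \<le> C" "\<And>y. cut Q y \<in> W"
proof -
  obtain C1 where C1: "C1 \<ge> 0" "C11_on (D R) A A' C1" "C1-lipschitz_on UNIV (cut A)"
    "\<And>y. norm (cut A y) \<le> C1" "\<And>y. cut A y \<in> W"
    using nice_constant[OF assms(1)] by blast
  obtain C2 where C2: "C2 \<ge> 0" "C11_on (D R) Q Q' C2" "C2-lipschitz_on UNIV (cut Q)"
    "\<And>y. norm (cut Q y) \<le> C2" "\<And>y. cut Q y \<in> W"
    using nice_constant[OF assms(2)] by blast
  define C where "C = max C1 C2"
  have le: "C1 \<le> C" "C2 \<le> C" unfolding C_def by auto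
  show ?thesis
  proof (rule that[of C])
    show "0 \<le> C" using C1(1) le by simp
    show "C11_on (D R) A A' C" "C11_on (D R) Q Q' C"
      using C11_on_mono[OF C1(2) le(1)] C11_on_mono[OF C2(2) le(2)] by auto
    show "C-lipschitz_on UNIV (cut A)" "C-lipschitz_on UNIV (cut Q)"
      using lipschitz_on_le[OF C1(3) le(1)] lipschitz_on_le[OF C2(3) le(2)] by auto
    show "norm (cut A y) \<le> C" "norm (cut Q y) \<le> C" for y
      using C1(4)[of y] C2(4)[of y] le by auto
  qed (rule C1(5) C2(5))+
qed

text \<open>Concatenating the two words evaluates Q at the intermediate point instead of x. The
  difference is of order |s| (|s| + e), which the time bound and the choice of e absorb.\<close>

lemma tangent_add:
  assumes tA: "tangent A" and tB: "tangent Q" and nA: "nice A A'" and nB: "nice Q Q'"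
  shows "tangent (\<lambda>x. A x + Q x)"
  unfolding tangent_def
proof (intro allI impI)
  fix r' \<kappa> :: real assume r': "r' < r" and \<kappa>: "0 < \<kappa>"
  obtain C where C: "C \<ge> 0" "C11_on (D R) A A' C" "C11_on (D R) Q Q' C"
    by (rule nice_common_constant[OF nA nB]) (rule that)
  define \<rho> where "\<rho> = (r' + r) / 2"
  have \<rho>: "r' < \<rho>" "\<rho> < r" unfolding \<rho>_def using r' by auto
  have \<kappa>3: "\<kappa> / 3 > 0" using \<kappa> by simp
  obtain s1 where s1: "s1 > 0" and exA: "\<forall>\<eta>>0. word_family r' s1 (\<lambda>s x y. norm (y - x - s *\<^sub>R A x) \<le> \<kappa> / 3 * \<bar>s\<bar> + \<eta>)"
    using tangentD[OF tA r' \<kappa>3] by blast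
  obtain s2 where s2: "s2 > 0" and exB: "\<forall>\<eta>>0. word_family \<rho> s2 (\<lambda>s x y. norm (y - x - s *\<^sub>R Q x) \<le> \<kappa> / 3 * \<bar>s\<bar> + \<eta>)"
    using tangentD[OF tB \<rho>(2) \<kappa>3] by blast
  define M where "M = C + \<kappa>"
  have M: "M > 0" "M \<ge> 0" "C \<le> M" "\<kappa> / 3 \<le> \<kappa>" unfolding M_def using C(1) \<kappa> by auto
  \<comment> \<open>(\<rho> - r') / (2 M) keeps the first word within half of the margin to \<rho>,
    leaving the other half to its additive error; \<kappa> / (3 M M) makes the shift of the base
    point of Q cost at most a third of \<kappa>.\<close>
  define s0 where "s0 = min (min s1 s2) (min (min 1 ((\<rho> - r') / (2 * M))) (\<kappa> / (3 * M * M)))"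
  have s0: "s0 > 0" "s0 \<le> s1" "s0 \<le> s2" "s0 \<le> 1" "s0 \<le> (\<rho> - r') / (2 * M)" "s0 \<le> \<kappa> / (3 * M * M)"
    unfolding s0_def using s1 s2 \<rho> M \<kappa> by auto
  have s0a: "s0 * M \<le> (\<rho> - r') / 2" using s0(5) M by (simp add: field_simps)
  have s0b: "s0 * (M * M) \<le> \<kappa> / 3" using s0(6) M by (simp add: field_simps)
  show "\<exists>s0>0. \<forall>\<eta>>0. word_family r' s0 (\<lambda>s x y. norm (y - x - s *\<^sub>R (A x + Q x)) \<le> \<kappa> * \<bar>s\<bar> + \<eta>)"
  proof (intro exI[of _ s0] conjI allI impI)
    show "0 < s0" by (rule s0)
    fix \<eta> :: real assume \<eta>: "\<eta> > 0"
    \<comment> \<open>The additive error appears once in each word and once, multiplied by C,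
      through the base point of Q: 2 e + C e \<le> \<eta>.\<close>
    define e where "e = min (\<eta> / (2 + C)) ((\<rho> - r') / 2)"
    have e: "e > 0" "e \<le> \<eta> / (2 + C)" "e \<le> (\<rho> - r') / 2"
      using \<eta> C(1) \<rho> min.cobounded1[of "\<eta> / (2 + C)" "(\<rho> - r') / 2"] min.cobounded2[of "\<eta> / (2 + C)" "(\<rho> - r') / 2"]
      by (simp_all only: e_def[symmetric]) (simp add: e_def)
    have e2: "2 * e + C * e \<le> \<eta>" using e(2) C(1) by (simp add: field_simps)
    obtain wa :: "(real \<Rightarrow> real^'u) list" where ca: "\<forall>w\<in>set wa. continuous_on UNIV w"
      and wa: "\<And>x s. x \<in> D r' \<Longrightarrow> \<bar>s\<bar> \<le> s1 \<Longrightarrow>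
        norm (wflow 0 (map (\<lambda>w. w s) wa) x - x - s *\<^sub>R A x) \<le> \<kappa> / 3 * \<bar>s\<bar> + e \<and>
        stays 0 (D r) (map (\<lambda>w. w s) wa) x"
      using exA[rule_format, OF e(1)] unfolding word_family_def by auto
    obtain wb :: "(real \<Rightarrow> real^'u) list" where cb: "\<forall>w\<in>set wb. continuous_on UNIV w"
      and wb: "\<And>x s. x \<in> D \<rho> \<Longrightarrow> \<bar>s\<bar> \<le> s2 \<Longrightarrow>
        norm (wflow 0 (map (\<lambda>w. w s) wb) x - x - s *\<^sub>R Q x) \<le> \<kappa> / 3 * \<bar>s\<bar> + e \<and>
        stays 0 (D r) (map (\<lambda>w. w s) wb) x"
      using exB[rule_format, OF e(1)] unfolding word_family_def by auto
    have c2: "norm (wflow 0 (map (\<lambda>w. w s) (wa @ wb)) x - x - s *\<^sub>R (A x + Q x)) \<le> \<kappa> * \<bar>s\<bar> + \<eta> \<and>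
        stays 0 (D r) (map (\<lambda>w. w s) (wa @ wb)) x" if x: "x \<in> D r'" and s: "\<bar>s\<bar> \<le> s0" for x s
    proof -
      have xR: "x \<in> D R" using x D_mono[of r' R] r' r by auto
      have s12: "\<bar>s\<bar> \<le> s1" "\<bar>s\<bar> \<le> s2" using s s0 by auto
      define x1 where "x1 = wflow 0 (map (\<lambda>w. w s) wa) x"
      define x2 where "x2 = wflow 0 (map (\<lambda>w. w s) wb) x1"
      have a: "norm (x1 - x - s *\<^sub>R A x) \<le> \<kappa> / 3 * \<bar>s\<bar> + e" "stays 0 (D r) (map (\<lambda>w. w s) wa) x"
        using wa[OF x s12(1)] unfolding x1_def by auto
      have "\<bar>s\<bar> * norm (A x) \<le> \<bar>s\<bar> * C" using C11_onD(2)[OF C(2) xR] by (intro mult_left_mono) auto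
      then have "norm (x1 - x) \<le> \<bar>s\<bar> * C + (\<kappa> / 3 * \<bar>s\<bar> + e)"
        using norm_triangle_ineq[of "x1 - x - s *\<^sub>R A x" "s *\<^sub>R A x"] a(1) by simp
      also have "\<dots> \<le> \<bar>s\<bar> * M + e" unfolding M_def using \<kappa> by (simp add: algebra_simps)
      finally have x1x: "norm (x1 - x) \<le> \<bar>s\<bar> * M + e" .
      have "\<bar>s\<bar> * M \<le> s0 * M" using s M by (intro mult_right_mono) auto
      from order_trans[OF x1x add_mono[OF order_trans[OF this s0a] e(3)]]
      have "norm (x1 - x) \<le> \<rho> - r'" by simp
      moreover have "x \<in> W" "norm (x - p) \<le> r'" using x by (auto simp: mem_D)
      ultimately have x1D: "x1 \<in> D \<rho>"
        using wflow_W[of x] norm_triangle_ineq[of "x1 - x" "x - p"] unfolding x1_def by (auto simp: mem_D)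
      then have x1R: "x1 \<in> D R" using D_mono[of \<rho> R] \<rho> r by auto
      have b: "norm (x2 - x1 - s *\<^sub>R Q x1) \<le> \<kappa> / 3 * \<bar>s\<bar> + e" "stays 0 (D r) (map (\<lambda>w. w s) wb) x1"
        using wb[OF x1D s12(2)] unfolding x2_def by auto
      have "\<bar>s\<bar> * norm (Q x1 - Q x) \<le> \<bar>s\<bar> * (C * (\<bar>s\<bar> * M + e))"
        using C11_onD(4)[OF C(3) xR x1R] mult_left_mono[OF x1x C(1)] by (intro mult_left_mono) auto
      also have "\<dots> = \<bar>s\<bar> * (\<bar>s\<bar> * (C * M)) + \<bar>s\<bar> * (C * e)" by (simp add: algebra_simps)
      also have "\<dots> \<le> \<bar>s\<bar> * (\<kappa> / 3) + 1 * (C * e)"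
      proof (intro add_mono mult_left_mono mult_right_mono)
        have "\<bar>s\<bar> * (C * M) \<le> s0 * (M * M)" using s s0 M C(1) by (intro mult_mono) auto
        then show "\<bar>s\<bar> * (C * M) \<le> \<kappa> / 3" using s0b by simp
      qed (use s s0 C(1) e in auto)
      finally have c: "norm (s *\<^sub>R (Q x1 - Q x)) \<le> \<bar>s\<bar> * (\<kappa> / 3) + C * e" by simp
      have "x2 - x - s *\<^sub>R (A x + Q x) = (x1 - x - s *\<^sub>R A x) + (x2 - x1 - s *\<^sub>R Q x1) + s *\<^sub>R (Q x1 - Q x) + 0"
        by (simp add: algebra_simps)
      then have "norm (x2 - x - s *\<^sub>R (A x + Q x)) \<le> norm (x1 - x - s *\<^sub>R A x) + norm (x2 - x1 - s *\<^sub>R Q x1) + norm (s *\<^sub>R (Q x1 - Q x)) + norm (0::'a)"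
        by (simp only: norm_sum4_le)
      also have "\<dots> \<le> (\<kappa> / 3 * \<bar>s\<bar> + e) + (\<kappa> / 3 * \<bar>s\<bar> + e) + (\<bar>s\<bar> * (\<kappa> / 3) + C * e) + 0"
        using a(1) b(1) c by (intro add_mono) auto
      also have "\<dots> = \<kappa> * \<bar>s\<bar> + (2 * e + C * e)" by (simp add: algebra_simps)
      also have "\<dots> \<le> \<kappa> * \<bar>s\<bar> + \<eta>" using e2 by simp
      finally have "norm (x2 - x - s *\<^sub>R (A x + Q x)) \<le> \<kappa> * \<bar>s\<bar> + \<eta>" .
      then show ?thesis using stays_append[OF a(2), of "map (\<lambda>w. w s) wb"] b(2)
        unfolding x2_def x1_def map_append wflow_append by simp
    qed
    have c1: "\<forall>w\<in>set (wa @ wb). continuous_on UNIV w" using ca cb by auto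
    show "word_family r' s0 (\<lambda>s x y. norm (y - x - s *\<^sub>R (A x + Q x)) \<le> \<kappa> * \<bar>s\<bar> + \<eta>)"
      unfolding word_family_def by (rule exI[of _ "wa @ wb"], rule conjI[OF c1], intro ballI allI impI, rule c2)
  qed
qed

lemma concat_replicate_Suc: "concat (replicate (Suc k) us) = concat (replicate k us) @ us"
  by (induction k) auto

text \<open>An Euler scheme: the word for time t / N is repeated N times, and a discrete Gronwall
  estimate compares it with the exact flow. The admissible time comes from the speed bound and the
  distance to the boundary alone, hence not from \<eta>.\<close>

lemma follow_of_tangent:
  assumes tH: "tangent H" and nH: "nice H H'"
  shows "follow H"
  unfolding follow_def
proof (intro allI impI)
  fix r' assume r': "r' < r"
  obtain C where C: "C \<ge> 0" "C11_on (D R) H H' C" "C-lipschitz_on UNIV (cut H)"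
    "\<And>y. norm (cut H y) \<le> C" "\<And>y. cut H y \<in> W"
    using nice_constant[OF nH] by blast
  \<comment> \<open>The exact flow uses one h of the margin and the Euler points deviate by at most
    another, so all of them lie in \<open>D \<rho>\<close>, where the short words are
    available.\<close>
  define h where "h = (r - r') / 4"
  define \<rho> where "\<rho> = r' + 2 * h"
  have h: "h > 0" "\<rho> < r" "r' + h \<le> R" "r' + h + h \<le> R" "r' + h + h = \<rho>" unfolding h_def \<rho>_def using r' r by (auto simp: field_simps)
  define T0 where "T0 = h / (C + 1)"
  have T0: "T0 > 0" unfolding T0_def using h C(1) by auto
  have "T0 * (C + 1) = h" unfolding T0_def using C(1) by simp
  then have CT0: "C * T0 \<le> h" using T0 by (simp add: algebra_simps)
  define E where "E = exp (C * T0)"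
  have E: "E > 0" unfolding E_def by simp
  show "\<exists>T0>0. \<forall>\<eta>>0. word_family r' T0 (\<lambda>t x y. norm (y - flow1 (\<lambda>y. t *\<^sub>R cut H y) x) \<le> \<eta>)"
  proof (intro exI[of _ T0] conjI allI impI)
    show "0 < T0" by (rule T0)
    fix \<eta> :: real assume \<eta>: "\<eta> > 0"
    define e where "e = min \<eta> h"
    have e: "e > 0" "e \<le> \<eta>" "e \<le> h" unfolding e_def using \<eta> h by auto
    \<comment> \<open>A third of the error budget for the part proportional to time, whose total
      over N steps is \<kappa> |t|; E bounds the growth of errors.\<close>
    define \<kappa> where "\<kappa> = e / (3 * E * (T0 + 1))"
    have \<kappa>: "\<kappa> > 0" unfolding \<kappa>_def using e E T0 by simp
    have "3 * E * (T0 + 1) \<noteq> 0" using E T0 by simp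
    then have "\<kappa> * (3 * E * (T0 + 1)) = e" unfolding \<kappa>_def by simp
    moreover have "E * \<kappa> > 0" using E \<kappa> by simp
    ultimately have \<kappa>T: "E * (\<kappa> * T0) \<le> e / 3" by (simp add: algebra_simps)
    obtain s0 where s0: "s0 > 0" and ex: "\<forall>\<eta>>0. word_family \<rho> s0 (\<lambda>s x y. norm (y - x - s *\<^sub>R H x) \<le> \<kappa> * \<bar>s\<bar> + \<eta>)"
      using tangentD[OF tH h(2) \<kappa>] by blast
    \<comment> \<open>N has to bring the step below s0 and the accumulated second-order error of the
      exact flow below a third of the budget.\<close>
    obtain N0 :: nat where N0: "max (T0 / s0) (3 * E * C\<^sup>2 * T0\<^sup>2 / e) \<le> real N0"
      using real_arch_simple by blast
    define N where "N = Suc N0"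
    have N: "real N > 0" "T0 / s0 \<le> real N" "3 * E * C\<^sup>2 * T0\<^sup>2 / e \<le> real N" unfolding N_def using N0 by auto
    have Ns: "T0 / N \<le> s0" using N(1,2) s0 by (simp add: field_simps)
    have NC: "E * (C\<^sup>2 * T0\<^sup>2 / N) \<le> e / 3" using N(1,3) e by (simp add: field_simps)
    \<comment> \<open>The last third, divided among the N steps. N was chosen from s0, so this
      choice is legitimate only because s0 in \<open>tangent\<close> precedes the additive
      error.\<close>
    define \<eta>' where "\<eta>' = e / (3 * E * N)"
    have \<eta>': "\<eta>' > 0" "E * (N * \<eta>') = e / 3" unfolding \<eta>'_def using e E N by auto
    obtain ws :: "(real \<Rightarrow> real^'u) list" where cont: "\<forall>w\<in>set ws. continuous_on UNIV w"
      and ws: "\<And>x s. x \<in> D \<rho> \<Longrightarrow> \<bar>s\<bar> \<le> s0 \<Longrightarrow>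
        norm (wflow 0 (map (\<lambda>w. w s) ws) x - x - s *\<^sub>R H x) \<le> \<kappa> * \<bar>s\<bar> + \<eta>' \<and>
        stays 0 (D r) (map (\<lambda>w. w s) ws) x"
      using ex[rule_format, OF \<eta>'(1)] unfolding word_family_def by auto
    define ws' where "ws' = concat (replicate N (map (\<lambda>w t. w (t / N)) ws))"
    have m: "map (\<lambda>w. w t) ws' = concat (replicate N (map (\<lambda>w. w (t / N)) ws))" for t
      unfolding ws'_def by (simp add: map_concat o_def)
    have cont': "\<forall>w\<in>set ws'. continuous_on UNIV w"
      unfolding ws'_def using cont N(1)
      by (auto intro!: continuous_on_compose2[of UNIV _ UNIV "\<lambda>t. t / real N"] continuous_intros)
    have main: "norm (wflow 0 (map (\<lambda>w. w t) ws') x - flow1 (\<lambda>y. t *\<^sub>R cut H y) x) \<le> \<eta> \<and>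
        stays 0 (D r) (map (\<lambda>w. w t) ws') x" if x: "x \<in> D r'" and t: "\<bar>t\<bar> \<le> T0" for x t
    proof -
      define s where "s = t / N"
      have sN: "\<bar>s\<bar> * N = \<bar>t\<bar>" unfolding s_def using N by (simp add: abs_divide)
      have ss0: "\<bar>s\<bar> \<le> s0"
      proof -
        have "\<bar>s\<bar> \<le> T0 / N" unfolding s_def using t N by (simp add: abs_divide divide_right_mono)
        then show ?thesis using Ns by simp
      qed
      define us where "us = map (\<lambda>w. w s) ws"
      \<comment> \<open>Error of one step: the two errors of the word, and the deviation of the
        exact flow from its tangent.\<close>
      define q where "q = \<kappa> * \<bar>s\<bar> + \<eta>' + C\<^sup>2 * s\<^sup>2"
      have q: "q \<ge> 0" unfolding q_def using \<kappa> \<eta>' by (intro add_nonneg_nonneg) auto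
      define \<theta> where "\<theta> = (\<lambda>k::nat. sol (\<lambda>y. s *\<^sub>R cut H y) x k)"
      define X where "X = (\<lambda>k::nat. wflow 0 (concat (replicate k us)) x)"
      have lip: "(\<bar>s\<bar> * C)-lipschitz_on UNIV (\<lambda>y. s *\<^sub>R cut H y)"
        by (rule lipschitz_on_scaleR_field[OF C(3)])
      have xW: "x \<in> W" "norm (x - p) \<le> r'" using x by (auto simp: mem_D)
      have Csk: "C * \<bar>k * s\<bar> \<le> h" if "k \<le> N" for k :: nat
      proof -
        have "\<bar>k * s\<bar> \<le> \<bar>s\<bar> * N" using that by (simp add: abs_mult mult.commute[of "\<bar>s\<bar>"] mult_right_mono)
        then have "\<bar>k * s\<bar> \<le> T0" using sN t by linarith
        then have "C * \<bar>k * s\<bar> \<le> C * T0" using C(1) by (intro mult_left_mono)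
        then show ?thesis using CT0 by simp
      qed
      have \<theta>D: "\<theta> k \<in> D (r' + h)" if "k \<le> N" for k
      proof -
        have eq: "\<theta> k = flow1 (\<lambda>y. (k * s) *\<^sub>R cut H y) x"
          unfolding \<theta>_def using sol_eq_flow1[OF lip, of "real k" x] by simp
        have "r' + C * \<bar>k * s\<bar> \<le> R" using Csk[OF that] h by linarith
        from cut_flow_bounds(2)[OF C x this] show ?thesis
          using D_mono[of "r' + C * \<bar>k * s\<bar>" "r' + h"] Csk[OF that] unfolding eq by auto
      qed
      have bnd: "k * q * exp (C * \<bar>s\<bar> * k) \<le> e" if "k \<le> N" for k :: nat
      proof -
        have "C * \<bar>s\<bar> * k \<le> C * (\<bar>s\<bar> * N)"
          using that C(1) by (simp add: mult.assoc mult_left_mono)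
        also have "\<dots> \<le> C * T0" unfolding sN using t C(1) by (intro mult_left_mono)
        finally have 1: "exp (C * \<bar>s\<bar> * k) \<le> E" unfolding E_def by simp
        have "k * q * exp (C * \<bar>s\<bar> * k) \<le> N * q * E"
          using that q 1 by (intro mult_mono) auto
        also have "N * q * E = E * (\<kappa> * (\<bar>s\<bar> * N)) + E * (N * \<eta>') + E * (C\<^sup>2 * (\<bar>s\<bar> * N)\<^sup>2 / N)"
          unfolding q_def using N(1) by (simp add: field_simps power2_eq_square)
        also have "\<dots> \<le> E * (\<kappa> * T0) + E * (N * \<eta>') + E * (C\<^sup>2 * T0\<^sup>2 / N)"
          unfolding sN using t \<kappa> E N(1)
          by (intro add_mono mult_left_mono divide_right_mono) (auto intro!: power_mono simp: abs_le_square_iff[symmetric])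
        also have "\<dots> \<le> e" using \<kappa>T \<eta>'(2) NC by linarith
        finally show ?thesis .
      qed
      have "norm (X k - \<theta> k) \<le> k * q * exp (C * \<bar>s\<bar> * k) \<and> stays 0 (D r) (concat (replicate k us)) x"
        if "k \<le> N" for k
        using that
      proof (induction k)
        case 0
        have "x \<in> D r" using x D_mono[of r' r] r' by auto
        then show ?case unfolding X_def \<theta>_def using sol_solves(1)[OF lip, of x] by simp
      next
        case (Suc k)
        then have k: "k \<le> N" and IH: "norm (X k - \<theta> k) \<le> k * q * exp (C * \<bar>s\<bar> * k)"
          "stays 0 (D r) (concat (replicate k us)) x" by auto
        have Xe: "norm (X k - \<theta> k) \<le> h" using IH(1) bnd[OF k] e by linarith
        have XW: "X k \<in> W" unfolding X_def by (rule wflow_W[OF xW(1)])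
        have "norm (\<theta> k - p) \<le> r' + h" using \<theta>D[OF k] by (simp add: mem_D)
        then have "norm (X k - p) \<le> \<rho>"
          using norm_triangle_ineq[of "X k - \<theta> k" "\<theta> k - p"] Xe h(5) by simp
        then have XD: "X k \<in> D \<rho>" using XW by (simp add: mem_D)
        have XSuc: "X (Suc k) = wflow 0 us (X k)" unfolding X_def concat_replicate_Suc wflow_append ..
        have \<theta>Suc: "\<theta> (Suc k) = flow1 (\<lambda>y. s *\<^sub>R cut H y) (\<theta> k)" unfolding \<theta>_def by (rule sol_Suc[OF lip])
        have w: "norm (X (Suc k) - X k - s *\<^sub>R H (X k)) \<le> \<kappa> * \<bar>s\<bar> + \<eta>'" "stays 0 (D r) us (X k)"
          using ws[OF XD ss0] unfolding XSuc us_def by auto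
        have "N \<ge> 1" unfolding N_def by simp
        then have "r' + h + C * \<bar>s\<bar> \<le> R" using Csk[of 1] h by simp
        then have f: "norm (\<theta> (Suc k) - \<theta> k - s *\<^sub>R H (\<theta> k)) \<le> C\<^sup>2 * s\<^sup>2"
          unfolding \<theta>Suc by (rule cut_flow_bounds(3)[OF C \<theta>D[OF k]])
        have "\<theta> k \<in> D R" "X k \<in> D R" using \<theta>D[OF k] XD D_mono[of "r' + h" R] D_mono[of \<rho> R] h r by auto
        then have "\<bar>s\<bar> * norm (H (X k) - H (\<theta> k)) \<le> \<bar>s\<bar> * (C * norm (X k - \<theta> k))"
          using C11_onD(4)[OF C(2)] by (intro mult_left_mono) auto
        then have l: "norm (s *\<^sub>R (H (X k) - H (\<theta> k))) \<le> C * \<bar>s\<bar> * norm (X k - \<theta> k)" by (simp add: mult_ac)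
        have "X (Suc k) - \<theta> (Suc k) = (X (Suc k) - X k - s *\<^sub>R H (X k)) + (- (\<theta> (Suc k) - \<theta> k - s *\<^sub>R H (\<theta> k)))
           + s *\<^sub>R (H (X k) - H (\<theta> k)) + (X k - \<theta> k)" by (simp add: algebra_simps)
        then have "norm (X (Suc k) - \<theta> (Suc k)) \<le> norm (X (Suc k) - X k - s *\<^sub>R H (X k)) + norm (- (\<theta> (Suc k) - \<theta> k - s *\<^sub>R H (\<theta> k)))
           + norm (s *\<^sub>R (H (X k) - H (\<theta> k))) + norm (X k - \<theta> k)" by (simp only: norm_sum4_le)
        also have "\<dots> \<le> q + (1 + C * \<bar>s\<bar>) * norm (X k - \<theta> k)"
          using w(1) f l unfolding q_def norm_minus_cancel by (simp add: algebra_simps)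
        also have "\<dots> \<le> q + exp (C * \<bar>s\<bar>) * (k * q * exp (C * \<bar>s\<bar> * k))"
          using IH(1) exp_ge_add_one_self[of "C * \<bar>s\<bar>"] by (intro add_left_mono mult_mono) auto
        also have "\<dots> \<le> q * exp (C * \<bar>s\<bar> * Suc k) + k * q * exp (C * \<bar>s\<bar> * Suc k)"
        proof (rule add_mono)
          have "1 \<le> exp (C * \<bar>s\<bar> * Suc k)" using C(1) by simp
          then show "q \<le> q * exp (C * \<bar>s\<bar> * Suc k)" using q mult_left_mono[of 1 _ q] by fastforce
          have "exp (C * \<bar>s\<bar> * Suc k) = exp (C * \<bar>s\<bar>) * exp (C * \<bar>s\<bar> * k)"
            by (simp add: exp_add[symmetric] algebra_simps)
          then show "exp (C * \<bar>s\<bar>) * (k * q * exp (C * \<bar>s\<bar> * k)) \<le> k * q * exp (C * \<bar>s\<bar> * Suc k)" by simp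
        qed
        also have "\<dots> = Suc k * q * exp (C * \<bar>s\<bar> * Suc k)" by (simp add: algebra_simps)
        finally have "norm (X (Suc k) - \<theta> (Suc k)) \<le> Suc k * q * exp (C * \<bar>s\<bar> * Suc k)" .
        moreover have "stays 0 (D r) (concat (replicate (Suc k) us)) x"
          unfolding concat_replicate_Suc by (rule stays_append[OF IH(2)]) (use w(2) in \<open>simp add: X_def\<close>)
        ultimately show ?case by blast
      qed
      from this[OF order_refl] bnd[OF order_refl]
      have "norm (X N - \<theta> N) \<le> \<eta>" "stays 0 (D r) (concat (replicate N us)) x" using e(2) by auto
      moreover have "\<theta> N = flow1 (\<lambda>y. t *\<^sub>R cut H y) x"
        unfolding \<theta>_def using sol_eq_flow1[OF lip, of "real N" x] N(1) by (simp add: s_def)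
      ultimately show ?thesis unfolding m X_def us_def s_def by simp
    qed
    show "word_family r' T0 (\<lambda>t x y. norm (y - flow1 (\<lambda>y. t *\<^sub>R cut H y) x) \<le> \<eta>)"
      unfolding word_family_def by (rule exI[of _ ws'], rule conjI[OF cont'], intro ballI allI impI, rule main)
  qed
qed

text \<open>Puts a word that follows a flow up to d into the form of a leg of the commutator path.
  The 1 in 2 C^3 + 1 makes the constant at least 1, as the commutator estimate asks.\<close>

lemma follow_step:
  assumes C: "C \<ge> 0" "C11_on (D R) H H' C" "C-lipschitz_on UNIV (cut H)"
    "\<And>y. norm (cut H y) \<le> C" "\<And>y. cut H y \<in> W"
    and w: "norm (wflow 0 us y - flow1 (\<lambda>x. c *\<^sub>R cut H x) y) \<le> d"
    and y: "y \<in> D \<rho>" and c: "\<rho> + C * \<bar>c\<bar> \<le> R" "\<bar>c\<bar> \<le> t"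
  shows "norm (wflow 0 us y - y - c *\<^sub>R H y - (c\<^sup>2 / 2) *\<^sub>R H' y (H y)) \<le> (2 * C^3 + 1) * t^3 + d"
    and "norm (wflow 0 us y - y) \<le> C * t + d"
proof -
  let ?f = "flow1 (\<lambda>x. c *\<^sub>R cut H x) y"
  note b = cut_flow_bounds[OF C y c(1)]
  have t: "t \<ge> 0" using c(2) by linarith
  have "wflow 0 us y - y - c *\<^sub>R H y - (c\<^sup>2 / 2) *\<^sub>R H' y (H y) =
     (wflow 0 us y - ?f) + (?f - y - c *\<^sub>R H y - (c\<^sup>2 / 2) *\<^sub>R H' y (H y))" by simp
  then have "norm (wflow 0 us y - y - c *\<^sub>R H y - (c\<^sup>2 / 2) *\<^sub>R H' y (H y)) \<le>
     norm (wflow 0 us y - ?f) + norm (?f - y - c *\<^sub>R H y - (c\<^sup>2 / 2) *\<^sub>R H' y (H y))"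
    by (simp only: norm_triangle_ineq)
  also have "\<dots> \<le> d + 2 * C^3 * t^3"
  proof (rule add_mono[OF w])
    have "2 * C^3 * \<bar>c\<bar>^3 \<le> 2 * C^3 * t^3" using c(2) C(1) by (intro mult_left_mono power_mono) auto
    then show "norm (?f - y - c *\<^sub>R H y - (c\<^sup>2 / 2) *\<^sub>R H' y (H y)) \<le> 2 * C^3 * t^3" using b(4) by linarith
  qed
  also have "\<dots> \<le> (2 * C^3 + 1) * t^3 + d" using t by (simp add: algebra_simps)
  finally show "norm (wflow 0 us y - y - c *\<^sub>R H y - (c\<^sup>2 / 2) *\<^sub>R H' y (H y)) \<le> (2 * C^3 + 1) * t^3 + d" .
  have "C * \<bar>c\<bar> \<le> C * t" using c(2) C(1) by (intro mult_left_mono)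
  then have "norm (?f - y) \<le> C * t" by (rule order_trans[OF b(1)])
  then show "norm (wflow 0 us y - y) \<le> C * t + d"
    using norm_triangle_ineq[of "wflow 0 us y - ?f" "?f - y"] w by simp
qed

lemma abs_sqrt_eq: "\<bar>sqrt s\<bar> = sqrt \<bar>s\<bar>"
  by (cases "s \<ge> 0") (auto simp: real_sqrt_minus[symmetric] simp del: real_sqrt_minus)

lemma sqrt_mult_sqrt_abs: "sqrt s * sqrt \<bar>s\<bar> = s"
proof (cases "s \<ge> 0")
  case False
  then have "sqrt s = - sqrt \<bar>s\<bar>" by (simp add: real_sqrt_minus[symmetric] del: real_sqrt_minus)
  then show ?thesis using False by simp
qed simp

text \<open>The commutator path is run with a = sqrt s and b = sqrt |s|. In Isabelle
  \<open>sqrt\<close> is odd, so a b = s for both signs and both factors are continuous at 0. The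
  cubic error in t = sqrt |s| is then o(|s|), which is what tangency asks.\<close>

lemma tangent_bracket:
  assumes fA: "follow A" and fQ: "follow Q" and nA: "nice A A'" and nQ: "nice Q Q'"
  shows "tangent (\<lambda>x. Q' x (A x) - A' x (Q x))"
  unfolding tangent_def
proof (intro allI impI)
  fix r' \<kappa> :: real assume r': "r' < r" and \<kappa>: "0 < \<kappa>"
  obtain C where C: "C \<ge> 0" "C11_on (D R) A A' C" "C11_on (D R) Q Q' C"
    "C-lipschitz_on UNIV (cut A)" "\<And>y. norm (cut A y) \<le> C" "\<And>y. cut A y \<in> W"
    "C-lipschitz_on UNIV (cut Q)" "\<And>y. norm (cut Q y) \<le> C" "\<And>y. cut Q y \<in> W"
    by (rule nice_common_constant[OF nA nQ]) (rule that)
  define k0 where "k0 = 2 * C^3 + 1"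
  have k0: "k0 \<ge> 1" unfolding k0_def using C(1) by simp
  obtain k where k: "k \<ge> 1" and cb: "comm_bound (D R) C k0 k"
    using commutator_estimate[OF C(1) k0] by blast
  note comm = cb[unfolded comm_bound_def, rule_format, OF C(2,3)]
  define \<rho> where "\<rho> = (r' + r) / 2"
  have \<rho>: "r' < \<rho>" "\<rho> < r" unfolding \<rho>_def using r' by auto
  \<comment> \<open>Four legs, each allowed to move by h: half of it by the flow and half by the
    error d.\<close>
  define h where "h = (\<rho> - r') / 4"
  have h: "h > 0" "r' + 4 * h = \<rho>" "\<rho> + h \<le> R" unfolding h_def \<rho>_def using r' r by (auto simp: field_simps)
  obtain TA where TA: "TA > 0" and exA: "\<forall>\<eta>>0. word_family \<rho> TA (\<lambda>t x y. norm (y - flow1 (\<lambda>y. t *\<^sub>R cut A y) x) \<le> \<eta>)"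
    using followD[OF fA \<rho>(2)] by blast
  obtain TQ where TQ: "TQ > 0" and exQ: "\<forall>\<eta>>0. word_family \<rho> TQ (\<lambda>t x y. norm (y - flow1 (\<lambda>y. t *\<^sub>R cut Q y) x) \<le> \<eta>)"
    using followD[OF fQ \<rho>(2)] by blast
  \<comment> \<open>\<kappa> / k turns k t^3 = k t |s| into at most \<kappa> |s|; h / (2 (C + 1))
    limits each leg. The error \<eta> does not enter here, only in the choice of d.\<close>
  define t0 where "t0 = Min {TA, TQ, 1, h / (2 * (C + 1)), \<kappa> / k}"
  have t0: "t0 \<le> TA" "t0 \<le> TQ" "t0 \<le> 1" "t0 \<le> h / (2 * (C + 1))" "t0 \<le> \<kappa> / k"
    unfolding t0_def by (intro Min_le; simp)+
  have t0p: "t0 > 0" unfolding t0_def using TA TQ h C(1) \<kappa> k by (subst Min_gr_iff) auto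
  have "t0 * (C + 1) \<le> h / 2" using t0(4) C(1) by (simp add: field_simps)
  then have Ct0: "C * t0 \<le> h / 2" using t0p by (simp add: algebra_simps)
  have kt0: "k * t0 \<le> \<kappa>" using t0(5) k by (simp add: field_simps)
  show "\<exists>s0>0. \<forall>\<eta>>0. word_family r' s0 (\<lambda>s x y. norm (y - x - s *\<^sub>R (Q' x (A x) - A' x (Q x))) \<le> \<kappa> * \<bar>s\<bar> + \<eta>)"
  proof (intro exI[of _ "t0\<^sup>2"] conjI allI impI)
    show "0 < t0\<^sup>2" using t0p by simp
    fix \<eta> :: real assume \<eta>: "\<eta> > 0"
    define d where "d = Min {1, h / 2, \<eta> / k}"
    have d: "d \<le> 1" "d \<le> h / 2" "d \<le> \<eta> / k" unfolding d_def by (intro Min_le; simp)+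
    have dp: "d > 0" unfolding d_def using h \<eta> k by (subst Min_gr_iff) auto
    have kd: "k * d \<le> \<eta>" using d(3) k by (simp add: field_simps)
    obtain wa :: "(real \<Rightarrow> real^'u) list" where ca: "\<forall>w\<in>set wa. continuous_on UNIV w"
      and wa: "\<And>x t. x \<in> D \<rho> \<Longrightarrow> \<bar>t\<bar> \<le> TA \<Longrightarrow>
        norm (wflow 0 (map (\<lambda>w. w t) wa) x - flow1 (\<lambda>y. t *\<^sub>R cut A y) x) \<le> d \<and>
        stays 0 (D r) (map (\<lambda>w. w t) wa) x"
      using exA[rule_format, OF dp] unfolding word_family_def by auto
    obtain wq :: "(real \<Rightarrow> real^'u) list" where cq: "\<forall>w\<in>set wq. continuous_on UNIV w"
      and wq: "\<And>x t. x \<in> D \<rho> \<Longrightarrow> \<bar>t\<bar> \<le> TQ \<Longrightarrow>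
        norm (wflow 0 (map (\<lambda>w. w t) wq) x - flow1 (\<lambda>y. t *\<^sub>R cut Q y) x) \<le> d \<and>
        stays 0 (D r) (map (\<lambda>w. w t) wq) x"
      using exQ[rule_format, OF dp] unfolding word_family_def by auto
    define ws where "ws = map (\<lambda>w s. w (sqrt s)) wa @ map (\<lambda>w s. w (sqrt \<bar>s\<bar>)) wq
      @ map (\<lambda>w s. w (- sqrt s)) wa @ map (\<lambda>w s. w (- sqrt \<bar>s\<bar>)) wq"
    have c1: "\<forall>w\<in>set ws. continuous_on UNIV w"
    proof -
      have comp: "continuous_on UNIV (\<lambda>s. w (g s))" if "continuous_on UNIV w" "continuous_on UNIV g"
        for w :: "real \<Rightarrow> real^'u" and g :: "real \<Rightarrow> real"
        using that by (rule continuous_on_compose2) auto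
      have g: "continuous_on UNIV (\<lambda>s::real. sqrt s)" "continuous_on UNIV (\<lambda>s::real. sqrt \<bar>s\<bar>)"
        "continuous_on UNIV (\<lambda>s::real. - sqrt s)" "continuous_on UNIV (\<lambda>s::real. - sqrt \<bar>s\<bar>)"
        by (intro continuous_intros)+
      show ?thesis using ca cq comp[OF _ g(1)] comp[OF _ g(2)] comp[OF _ g(3)] comp[OF _ g(4)]
        unfolding ws_def by auto
    qed
    have c2: "norm (wflow 0 (map (\<lambda>w. w s) ws) x - x - s *\<^sub>R (Q' x (A x) - A' x (Q x))) \<le> \<kappa> * \<bar>s\<bar> + \<eta> \<and>
        stays 0 (D r) (map (\<lambda>w. w s) ws) x" if x: "x \<in> D r'" and s: "\<bar>s\<bar> \<le> t0\<^sup>2" for x s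
    proof -
      define t where "t = sqrt \<bar>s\<bar>"
      define a where "a = sqrt s"
      have t: "0 \<le> t" "t \<le> t0" "t * t = \<bar>s\<bar>"
        unfolding t_def using real_le_lsqrt[OF less_imp_le[OF t0p] s] by auto
      have a: "\<bar>a\<bar> = t" "a * t = s" unfolding a_def t_def by (rule abs_sqrt_eq, rule sqrt_mult_sqrt_abs)
      have t1: "t \<le> 1" "t \<le> TA" "t \<le> TQ" using t(2) t0 by auto
      have Ct: "C * t \<le> h / 2" using Ct0 mult_left_mono[OF t(2) C(1)] by linarith
      have room: "\<rho> + C * \<bar>c\<bar> \<le> R" if "\<bar>c\<bar> = t" for c using Ct h that by simp
      have D\<rho>: "y \<in> D \<rho>" if "y \<in> D (r' + j * h)" "j \<le> 4" for y j
      proof -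
        have "j * h \<le> 4 * h" using that h by (intro mult_right_mono) auto
        then show ?thesis using that D_mono[of "r' + j * h" \<rho>] h by auto
      qed
      have D\<rho>R: "y \<in> D R" if "y \<in> D \<rho>" for y using that D_mono[of \<rho> R] \<rho> r by auto
      have move: "wflow 0 us y \<in> D (r' + (j + 1) * h)"
        if "y \<in> D (r' + j * h)" "norm (wflow 0 us y - y) \<le> C * t + d" for y j us
      proof -
        have "norm (wflow 0 us y - p) \<le> norm (wflow 0 us y - y) + norm (y - p)"
          using norm_triangle_ineq[of "wflow 0 us y - y" "y - p"] by simp
        also have "\<dots> \<le> (h / 2 + h / 2) + (r' + j * h)"
          using that Ct d by (intro add_mono) (auto simp: mem_D)
        finally show ?thesis using that wflow_W[of y] by (auto simp: mem_D algebra_simps)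
      qed
      have hopA: "norm (wflow 0 (map (\<lambda>w. w c) wa) y - y - c *\<^sub>R A y - (c\<^sup>2 / 2) *\<^sub>R A' y (A y)) \<le> k0 * t^3 + d"
        "norm (wflow 0 (map (\<lambda>w. w c) wa) y - y) \<le> C * t + d" "stays 0 (D r) (map (\<lambda>w. w c) wa) y"
        if "y \<in> D \<rho>" "\<bar>c\<bar> = t" for y c
      proof -
        note w = wa[OF that(1), of c]
        have w1: "norm (wflow 0 (map (\<lambda>w. w c) wa) y - flow1 (\<lambda>y. c *\<^sub>R cut A y) y) \<le> d" using w that(2) t1 by auto
        note f = follow_step[OF C(1,2,4,5,6) w1 that(1) room[OF that(2)], of t]
        show "norm (wflow 0 (map (\<lambda>w. w c) wa) y - y - c *\<^sub>R A y - (c\<^sup>2 / 2) *\<^sub>R A' y (A y)) \<le> k0 * t^3 + d"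
          "norm (wflow 0 (map (\<lambda>w. w c) wa) y - y) \<le> C * t + d" "stays 0 (D r) (map (\<lambda>w. w c) wa) y"
          using f w that(2) t1 unfolding k0_def by auto
      qed
      have hopQ: "norm (wflow 0 (map (\<lambda>w. w c) wq) y - y - c *\<^sub>R Q y - (c\<^sup>2 / 2) *\<^sub>R Q' y (Q y)) \<le> k0 * t^3 + d"
        "norm (wflow 0 (map (\<lambda>w. w c) wq) y - y) \<le> C * t + d" "stays 0 (D r) (map (\<lambda>w. w c) wq) y"
        if "y \<in> D \<rho>" "\<bar>c\<bar> = t" for y c
      proof -
        note w = wq[OF that(1), of c]
        have w1: "norm (wflow 0 (map (\<lambda>w. w c) wq) y - flow1 (\<lambda>y. c *\<^sub>R cut Q y) y) \<le> d" using w that(2) t1 by auto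
        note f = follow_step[OF C(1,3,7,8,9) w1 that(1) room[OF that(2)], of t]
        show "norm (wflow 0 (map (\<lambda>w. w c) wq) y - y - c *\<^sub>R Q y - (c\<^sup>2 / 2) *\<^sub>R Q' y (Q y)) \<le> k0 * t^3 + d"
          "norm (wflow 0 (map (\<lambda>w. w c) wq) y - y) \<le> C * t + d" "stays 0 (D r) (map (\<lambda>w. w c) wq) y"
          using f w that(2) t1 unfolding k0_def by auto
      qed
      have tt: "\<bar>t\<bar> = t" "\<bar>-t\<bar> = t" "\<bar>-a\<bar> = t" using t(1) a(1) by auto
      define x1 where "x1 = wflow 0 (map (\<lambda>w. w a) wa) x"
      define x2 where "x2 = wflow 0 (map (\<lambda>w. w t) wq) x1"
      define x3 where "x3 = wflow 0 (map (\<lambda>w. w (-a)) wa) x2"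
      define x4 where "x4 = wflow 0 (map (\<lambda>w. w (-t)) wq) x3"
      have x0: "x \<in> D (r' + 0 * h)" using x by simp
      have p0: "x \<in> D \<rho>" by (rule D\<rho>[OF x0]) simp
      note m0 = hopA[OF p0 a(1), folded x1_def]
      have x1: "x1 \<in> D (r' + 1 * h)" using move[OF x0] m0(2) unfolding x1_def by simp
      have p1: "x1 \<in> D \<rho>" by (rule D\<rho>[OF x1]) simp
      note m1 = hopQ[OF p1 tt(1), folded x2_def]
      have x2: "x2 \<in> D (r' + 2 * h)" using move[OF x1] m1(2) unfolding x2_def by simp
      have p2: "x2 \<in> D \<rho>" by (rule D\<rho>[OF x2]) simp
      note m2 = hopA[OF p2 tt(3), folded x3_def]
      have x3: "x3 \<in> D (r' + 3 * h)" using move[OF x2] m2(2) unfolding x3_def by simp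
      have p3: "x3 \<in> D \<rho>" by (rule D\<rho>[OF x3]) simp
      note m3 = hopQ[OF p3 tt(2), folded x4_def]
      have "norm (x4 - x - (a * t) *\<^sub>R (Q' x (A x) - A' x (Q x))) \<le> k * (t^3 + d)"
        by (rule comm[of x x1 x2 x3 a t t d x4])
          (use D\<rho>R[OF p0] D\<rho>R[OF p1] D\<rho>R[OF p2] D\<rho>R[OF p3] m0(1) m1(1) m2(1) m3(1) a(1) tt t(1) t1(1) d(1) dp in simp_all)
      also have "k * (t^3 + d) \<le> \<kappa> * \<bar>s\<bar> + \<eta>"
      proof -
        have "k * t^3 = (k * t) * \<bar>s\<bar>" unfolding t(3)[symmetric] by (simp add: power3_eq_cube)
        also have "\<dots> \<le> \<kappa> * \<bar>s\<bar>"
        proof (rule mult_right_mono)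
          show "k * t \<le> \<kappa>" using mult_left_mono[OF t(2), of k] k kt0 by linarith
        qed auto
        finally show ?thesis using kd by (simp add: distrib_left)
      qed
      finally have fin: "norm (x4 - x - s *\<^sub>R (Q' x (A x) - A' x (Q x))) \<le> \<kappa> * \<bar>s\<bar> + \<eta>" unfolding a(2) .
      have word: "map (\<lambda>w. w s) ws = map (\<lambda>w. w a) wa @ (map (\<lambda>w. w t) wq @ (map (\<lambda>w. w (-a)) wa @ map (\<lambda>w. w (-t)) wq))"
        unfolding ws_def a_def t_def by (simp add: o_def)
      have "stays 0 (D r) (map (\<lambda>w. w s) ws) x"
      proof -
        have s2: "stays 0 (D r) (map (\<lambda>w. w (-a)) wa @ map (\<lambda>w. w (-t)) wq) x2"
          by (rule stays_append[OF m2(3)]) (use m3(3) in \<open>simp add: x3_def\<close>)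
        have s1: "stays 0 (D r) (map (\<lambda>w. w t) wq @ (map (\<lambda>w. w (-a)) wa @ map (\<lambda>w. w (-t)) wq)) x1"
          by (rule stays_append[OF m1(3)]) (use s2 in \<open>simp add: x2_def\<close>)
        show ?thesis unfolding word
          by (rule stays_append[OF m0(3)]) (use s1 in \<open>simp add: x1_def\<close>)
      qed
      moreover have "wflow 0 (map (\<lambda>w. w s) ws) x = x4"
        unfolding word wflow_append x4_def x3_def x2_def x1_def ..
      ultimately show ?thesis using fin by simp
    qed
    show "word_family r' (t0\<^sup>2) (\<lambda>s x y. norm (y - x - s *\<^sub>R (Q' x (A x) - A' x (Q x))) \<le> \<kappa> * \<bar>s\<bar> + \<eta>)"
      unfolding word_family_def by (rule exI[of _ ws], rule conjI[OF c1], intro ballI allI impI, rule c2)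
  qed
qed

section \<open>Combinations of fields with parameter-dependent coefficients\<close>

definition combo :: "(('a \<Rightarrow> 'a) \<times> ('b \<Rightarrow> real)) list \<Rightarrow> 'b \<Rightarrow> 'a \<Rightarrow> 'a" where
  "combo hs z x = (\<Sum>(H, v)\<leftarrow>hs. v z *\<^sub>R H x)"

lemma combo_simps [simp]: "combo [] z x = 0" "combo ((H, v) # hs) z x = v z *\<^sub>R H x + combo hs z x"
  unfolding combo_def by simp_all

definition admissible :: "'b::topological_space set \<Rightarrow> (('a \<Rightarrow> 'a) \<times> ('b \<Rightarrow> real)) list \<Rightarrow> bool" where
  "admissible S hs \<longleftrightarrow> (\<forall>(H, v)\<in>set hs. tangent H \<and> (\<exists>H'. nice H H') \<and> continuous_on S v \<and> (\<forall>z\<in>S. \<bar>v z\<bar> \<le> 1))"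

lemma combo_lipschitz:
  assumes "admissible S hs"
  shows "\<exists>C\<ge>0. \<forall>x\<in>D R. \<forall>y\<in>D R. \<forall>z\<in>S. norm (combo hs z y - combo hs z x) \<le> C * norm (y - x)"
  using assms
proof (induction hs)
  case Nil
  show ?case by (rule exI[of _ 0]) simp
next
  case (Cons hv hs)
  obtain H v where hv: "hv = (H, v)" by force
  from Cons.prems have adm: "admissible S hs" and v: "\<And>z. z \<in> S \<Longrightarrow> \<bar>v z\<bar> \<le> 1" and "\<exists>H'. nice H H'"
    unfolding admissible_def hv by auto
  then obtain H' where "nice H H'" by blast
  then obtain C1 where C1: "C1 \<ge> 0" "C11_on (D R) H H' C1" by (rule nice_constant) (rule that)
  obtain C2 where C2: "C2 \<ge> 0" "\<And>x y z. x \<in> D R \<Longrightarrow> y \<in> D R \<Longrightarrow> z \<in> S \<Longrightarrow> norm (combo hs z y - combo hs z x) \<le> C2 * norm (y - x)"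
    using Cons.IH[OF adm] by blast
  have "norm (combo (hv # hs) z y - combo (hv # hs) z x) \<le> (C1 + C2) * norm (y - x)"
    if "x \<in> D R" "y \<in> D R" "z \<in> S" for x y z
  proof -
    have "combo (hv # hs) z y - combo (hv # hs) z x = v z *\<^sub>R (H y - H x) + (combo hs z y - combo hs z x)"
      unfolding hv by (simp add: scaleR_diff_right)
    then have "norm (combo (hv # hs) z y - combo (hv # hs) z x) \<le> norm (v z *\<^sub>R (H y - H x)) + norm (combo hs z y - combo hs z x)"
      by (simp only: norm_triangle_ineq)
    also have "\<dots> \<le> 1 * (C1 * norm (y - x)) + C2 * norm (y - x)"
      unfolding norm_scaleR
      by (intro add_mono mult_mono v[OF that(3)] C11_onD(4)[OF C1(2) that(1,2)] C2(2)[OF that]) auto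
    finally show ?thesis by (simp add: distrib_right)
  qed
  then show ?case using C1(1) C2(1) by (intro exI[of _ "C1 + C2"] conjI ballI) auto
qed

text \<open>The time s is now frozen and the word is a function of the coefficient parameter z. With
  s > 0 fixed, the additive error of \<open>tangent\<close> can be taken proportional to s, so only
  the relative error \<kappa> s remains. Fields are run one after the other, with intermediate radii
  as for sums.\<close>

lemma compose_tangent:
  fixes S :: "'b::topological_space set"
  assumes "admissible S hs" "r' < r" "\<kappa> > 0"
  shows "\<exists>s0>0. \<forall>s. 0 < s \<longrightarrow> s \<le> s0 \<longrightarrow> (\<exists>ws :: ('b \<Rightarrow> real^'u) list. (\<forall>w\<in>set ws. continuous_on S w) \<and>
     (\<forall>x\<in>D r'. \<forall>z\<in>S. norm (wflow 0 (map (\<lambda>w. w z) ws) x - x - s *\<^sub>R combo hs z x) \<le> \<kappa> * s \<and>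
        stays 0 (D r) (map (\<lambda>w. w z) ws) x))"
  using assms
proof (induction hs arbitrary: r' \<kappa>)
  case Nil
  then show ?case using D_mono[of r' r]
    by (intro exI[of _ 1] conjI allI impI exI[of _ "[]"]) auto
next
  case (Cons hv hs)
  obtain H v where hv: "hv = (H, v)" by force
  from Cons.prems have adm: "admissible S hs" and v: "\<And>z. z \<in> S \<Longrightarrow> \<bar>v z\<bar> \<le> 1" and "\<exists>H'. nice H H'"
    and tH: "tangent H" and vc: "continuous_on S v"
    unfolding admissible_def hv by auto
  then obtain H' where "nice H H'" by blast
  then obtain C1 where C1: "C1 \<ge> 0" "C11_on (D R) H H' C1" by (rule nice_constant) (rule that)
  obtain C2 where C2: "C2 \<ge> 0" "\<And>x y z. x \<in> D R \<Longrightarrow> y \<in> D R \<Longrightarrow> z \<in> S \<Longrightarrow> norm (combo hs z y - combo hs z x) \<le> C2 * norm (y - x)"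
    using combo_lipschitz[OF adm] by blast
  note r' = Cons.prems(2) note \<kappa> = Cons.prems(3)
  define \<rho> where "\<rho> = (r' + r) / 2"
  have \<rho>: "r' < \<rho>" "\<rho> < r" unfolding \<rho>_def using r' by auto
  have \<kappa>6: "\<kappa> / 6 > 0" "\<kappa> / 3 > 0" using \<kappa> by auto
  obtain s1 where s1: "s1 > 0" and exA: "\<forall>\<eta>>0. word_family r' s1 (\<lambda>s x y. norm (y - x - s *\<^sub>R H x) \<le> \<kappa> / 6 * \<bar>s\<bar> + \<eta>)"
    using tangentD[OF tH r' \<kappa>6(1)] by blast
  obtain s2 where s2: "s2 > 0" and exB: "\<forall>s. 0 < s \<longrightarrow> s \<le> s2 \<longrightarrow> (\<exists>ws :: ('b \<Rightarrow> real^'u) list. (\<forall>w\<in>set ws. continuous_on S w) \<and>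
     (\<forall>x\<in>D \<rho>. \<forall>z\<in>S. norm (wflow 0 (map (\<lambda>w. w z) ws) x - x - s *\<^sub>R combo hs z x) \<le> \<kappa> / 3 * s \<and>
        stays 0 (D r) (map (\<lambda>w. w z) ws) x))"
    using Cons.IH[OF adm \<rho>(2) \<kappa>6(2)] by blast
  define M where "M = C1 + \<kappa>"
  have M: "M > 0" unfolding M_def using C1(1) \<kappa> by auto
  \<comment> \<open>The third bound keeps the point after the first field in
    \<open>D \<rho>\<close>, the fourth limits the change of the remaining combination along that
    move to \<kappa> / 3.\<close>
  define s0 where "s0 = Min {s1, s2, (\<rho> - r') / M, \<kappa> / (3 * M * (C2 + 1))}"
  have s0: "s0 \<le> s1" "s0 \<le> s2" "s0 \<le> (\<rho> - r') / M" "s0 \<le> \<kappa> / (3 * M * (C2 + 1))"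
    unfolding s0_def by (intro Min_le; simp)+
  have s0p: "s0 > 0" unfolding s0_def using s1 s2 \<rho> M \<kappa> C2(1) by (subst Min_gr_iff) auto
  have s0a: "s0 * M \<le> \<rho> - r'" using s0(3) M by (simp add: pos_le_divide_eq)
  have "3 * M * (C2 + 1) > 0" using M C2(1) by simp
  then have "s0 * (3 * M * (C2 + 1)) \<le> \<kappa>" using s0(4) by (simp add: pos_le_divide_eq)
  moreover have "s0 * M > 0" using s0p M by simp
  ultimately have s0b: "C2 * (s0 * M) \<le> \<kappa> / 3" by (simp add: algebra_simps)
  show ?case
  proof (intro exI[of _ s0] conjI allI impI)
    show "0 < s0" by (rule s0p)
    fix s :: real assume s: "0 < s" "s \<le> s0"
    have "\<kappa> / 6 * s > 0" using \<kappa> s by simp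
    then obtain wa :: "(real \<Rightarrow> real^'u) list" where ca: "\<forall>w\<in>set wa. continuous_on UNIV w"
      and wa: "\<And>x \<sigma>. x \<in> D r' \<Longrightarrow> \<bar>\<sigma>\<bar> \<le> s1 \<Longrightarrow>
        norm (wflow 0 (map (\<lambda>w. w \<sigma>) wa) x - x - \<sigma> *\<^sub>R H x) \<le> \<kappa> / 6 * \<bar>\<sigma>\<bar> + \<kappa> / 6 * s \<and>
        stays 0 (D r) (map (\<lambda>w. w \<sigma>) wa) x"
      using exA[rule_format, of "\<kappa> / 6 * s"] unfolding word_family_def by auto
    obtain wb :: "('b \<Rightarrow> real^'u) list" where cb: "\<forall>w\<in>set wb. continuous_on S w"
      and wb: "\<And>x z. x \<in> D \<rho> \<Longrightarrow> z \<in> S \<Longrightarrow>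
        norm (wflow 0 (map (\<lambda>w. w z) wb) x - x - s *\<^sub>R combo hs z x) \<le> \<kappa> / 3 * s \<and>
        stays 0 (D r) (map (\<lambda>w. w z) wb) x"
      using exB[rule_format, of s] s s0(2) by auto
    define ws where "ws = map (\<lambda>w z. w (s * v z)) wa @ wb"
    have word: "map (\<lambda>w. w z) ws = map (\<lambda>w. w (s * v z)) wa @ map (\<lambda>w. w z) wb" for z
      unfolding ws_def by (simp add: o_def)
    have c1: "\<forall>w\<in>set ws. continuous_on S w"
    proof -
      have "continuous_on S (\<lambda>z. w (s * v z))" if "continuous_on UNIV w" for w :: "real \<Rightarrow> real^'u"
        by (rule continuous_on_compose2[OF that]) (auto intro!: continuous_intros vc)
      then show ?thesis using ca cb unfolding ws_def by auto
    qed
    have c2: "norm (wflow 0 (map (\<lambda>w. w z) ws) x - x - s *\<^sub>R combo (hv # hs) z x) \<le> \<kappa> * s \<and>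
        stays 0 (D r) (map (\<lambda>w. w z) ws) x" if x: "x \<in> D r'" and z: "z \<in> S" for x z
    proof -
      have xR: "x \<in> D R" using x D_mono[of r' R] r' r by auto
      have sv: "\<bar>s * v z\<bar> \<le> s" using v[OF z] s by (simp add: abs_mult mult_left_le)
      then have sv1: "\<bar>s * v z\<bar> \<le> s1" using s s0(1) by linarith
      define x1 where "x1 = wflow 0 (map (\<lambda>w. w (s * v z)) wa) x"
      define x2 where "x2 = wflow 0 (map (\<lambda>w. w z) wb) x1"
      have a: "norm (x1 - x - (s * v z) *\<^sub>R H x) \<le> \<kappa> / 3 * s" "stays 0 (D r) (map (\<lambda>w. w (s * v z)) wa) x"
      proof -
        note w = wa[OF x sv1, folded x1_def]
        have "\<kappa> / 6 * \<bar>s * v z\<bar> \<le> \<kappa> / 6 * s" using sv \<kappa> by (intro mult_left_mono) auto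
        then have "\<kappa> / 6 * \<bar>s * v z\<bar> + \<kappa> / 6 * s \<le> \<kappa> / 3 * s" by simp
        then show "norm (x1 - x - (s * v z) *\<^sub>R H x) \<le> \<kappa> / 3 * s" using w order_trans by blast
        show "stays 0 (D r) (map (\<lambda>w. w (s * v z)) wa) x" using w by blast
      qed
      have "norm ((s * v z) *\<^sub>R H x) \<le> s * C1"
        unfolding norm_scaleR using sv C11_onD(2)[OF C1(2) xR] s C1(1) by (intro mult_mono) auto
      then have "norm (x1 - x) \<le> s * C1 + \<kappa> / 3 * s"
        using norm_triangle_ineq[of "x1 - x - (s * v z) *\<^sub>R H x" "(s * v z) *\<^sub>R H x"] a(1) by simp
      also have "\<dots> \<le> s * M" unfolding M_def using \<kappa> s by (simp add: algebra_simps)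
      also have "s * M \<le> s0 * M" using s M by (intro mult_right_mono) auto
      finally have x1x: "norm (x1 - x) \<le> s0 * M" .
      have "x \<in> W" "norm (x - p) \<le> r'" using x by (auto simp: mem_D)
      then have x1D: "x1 \<in> D \<rho>"
        using wflow_W[of x] norm_triangle_ineq[of "x1 - x" "x - p"] x1x s0a unfolding x1_def by (auto simp: mem_D)
      then have x1R: "x1 \<in> D R" using D_mono[of \<rho> R] \<rho> r by auto
      have b: "norm (x2 - x1 - s *\<^sub>R combo hs z x1) \<le> \<kappa> / 3 * s" "stays 0 (D r) (map (\<lambda>w. w z) wb) x1"
        using wb[OF x1D z] unfolding x2_def by auto
      have c: "norm (s *\<^sub>R (combo hs z x1 - combo hs z x)) \<le> \<kappa> / 3 * s"
      proof -
        have "norm (combo hs z x1 - combo hs z x) \<le> C2 * (s0 * M)"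
          using C2(2)[OF xR x1R z] mult_left_mono[OF x1x C2(1)] by linarith
        then have "norm (combo hs z x1 - combo hs z x) \<le> \<kappa> / 3" using s0b by linarith
        then have "s * norm (combo hs z x1 - combo hs z x) \<le> s * (\<kappa> / 3)" using s by (intro mult_left_mono) auto
        then show ?thesis using s by (simp add: mult.commute)
      qed
      have "x2 - x - s *\<^sub>R combo (hv # hs) z x = (x1 - x - (s * v z) *\<^sub>R H x) + (x2 - x1 - s *\<^sub>R combo hs z x1) + s *\<^sub>R (combo hs z x1 - combo hs z x) + 0"
        unfolding hv by (simp add: algebra_simps)
      then have "norm (x2 - x - s *\<^sub>R combo (hv # hs) z x) \<le> norm (x1 - x - (s * v z) *\<^sub>R H x) + norm (x2 - x1 - s *\<^sub>R combo hs z x1) + norm (s *\<^sub>R (combo hs z x1 - combo hs z x)) + norm (0::'a)"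
        by (simp only: norm_sum4_le)
      also have "\<dots> \<le> \<kappa> / 3 * s + \<kappa> / 3 * s + \<kappa> / 3 * s + 0"
        using a(1) b(1) c by (intro add_mono) auto
      finally have "norm (x2 - x - s *\<^sub>R combo (hv # hs) z x) \<le> \<kappa> * s" by simp
      moreover have "stays 0 (D r) (map (\<lambda>w. w z) ws) x"
        unfolding word by (rule stays_append[OF a(2)]) (use b(2) in \<open>simp add: x1_def\<close>)
      ultimately show ?thesis unfolding x2_def x1_def word wflow_append by simp
    qed
    show "\<exists>ws :: ('b \<Rightarrow> real^'u) list. (\<forall>w\<in>set ws. continuous_on S w) \<and>
     (\<forall>x\<in>D r'. \<forall>z\<in>S. norm (wflow 0 (map (\<lambda>w. w z) ws) x - x - s *\<^sub>R combo (hv # hs) z x) \<le> \<kappa> * s \<and>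
        stays 0 (D r) (map (\<lambda>w. w z) ws) x)"
      by (rule exI[of _ ws], rule conjI[OF c1], intro ballI, rule c2)
  qed
qed

section \<open>Switching on the drift, and reaching all nearby points\<close>

lemma vf_scale: "(\<lambda>y. \<sigma> *\<^sub>R vf \<epsilon> u y) = vf (\<sigma> * \<epsilon>) (\<sigma> *\<^sub>R u)"
  unfolding vf_def by (auto simp: scaleR_add_right scaleR_sum_right)

text \<open>By Gronwall each letter adds at most \<epsilon> B to the distance of the two runs and
  multiplies the result by at most E, the exponential factor for letters of size \<open>Bd\<close>
  without drift. Intermediate times of a letter are covered by the same bound, since they are
  time-one flows of the scaled letter.\<close>

lemma wflow_perturb:
  fixes Bd E d \<epsilon> :: real
  assumes E: "E = exp (CARD('u) * Bd * B + 1)" and Bd: "Bd \<ge> 0" and us: "\<forall>u\<in>set us. norm u \<le> Bd"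
    and x: "norm (x - x') \<le> d" and \<epsilon>: "\<epsilon> \<ge> 0"
  shows "norm (wflow 0 us x - wflow \<epsilon> us x') \<le> E ^ length us * (d + length us * (\<epsilon> * B))"
    and "x' \<in> W \<Longrightarrow> stays 0 (D \<rho>) us x \<Longrightarrow> stays \<epsilon> (D (\<rho> + E ^ length us * (d + length us * (\<epsilon> * B)))) us x'"
  using us x
proof (induction us arbitrary: x x' d)
  case Nil
  {
    case 1
    then show ?case by simp
  next
    case 2
    then show ?case using norm_triangle_ineq[of "x' - x" "x - p"] by (auto simp: mem_D norm_minus_commute)
  }
next
  case (Cons u us)
  have E1: "E \<ge> 1" unfolding E using Bd B_nonneg by simp
  have eB: "\<epsilon> * B \<ge> 0" using \<epsilon> B_nonneg by simp
  have step: "norm (flow1 (vf 0 (\<sigma> *\<^sub>R u)) x - flow1 (vf (\<sigma> * \<epsilon>) (\<sigma> *\<^sub>R u)) x') \<le> E * (d + \<epsilon> * B)"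
    if u: "norm u \<le> Bd" and xx: "norm (x - x') \<le> d" and \<sigma>: "0 \<le> \<sigma>" "\<sigma> \<le> 1" for \<sigma> d :: real and x x'
  proof -
    have su: "norm (\<sigma> *\<^sub>R u) \<le> Bd" using \<sigma> u mult_left_le_one_le[of "norm u" \<sigma>] by simp
    have "vlip 0 (\<sigma> *\<^sub>R u) = CARD('u) * norm (\<sigma> *\<^sub>R u) * B" unfolding vlip_def by simp
    also have "\<dots> \<le> CARD('u) * Bd * B" using su B_nonneg by (intro mult_right_mono mult_left_mono) auto
    finally have e: "exp (vlip 0 (\<sigma> *\<^sub>R u) + 1) \<le> E" unfolding E by simp
    have "norm (flow1 (vf 0 (\<sigma> *\<^sub>R u)) x - flow1 (vf (\<sigma> * \<epsilon>) (\<sigma> *\<^sub>R u)) x')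
      \<le> exp (vlip 0 (\<sigma> *\<^sub>R u) + 1) * (norm (x - x') + (\<bar>0 - \<sigma> * \<epsilon>\<bar> + CARD('u) * norm (\<sigma> *\<^sub>R u - \<sigma> *\<^sub>R u)) * B)"
      by (rule flow1_vf_dist)
    also have "\<dots> = exp (vlip 0 (\<sigma> *\<^sub>R u) + 1) * (norm (x - x') + \<sigma> * (\<epsilon> * B))"
      using \<sigma> \<epsilon> by (simp add: abs_mult)
    also have "\<dots> \<le> E * (d + 1 * (\<epsilon> * B))"
      using e xx \<sigma> eB \<epsilon> B_nonneg E1 by (intro mult_mono add_mono) auto
    finally show ?thesis by simp
  qed
  have bound: "E ^ length us * (E * (d + \<epsilon> * B) + length us * (\<epsilon> * B)) \<le> E ^ length (u # us) * (d + length (u # us) * (\<epsilon> * B))" for d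
  proof -
    have "length us * (\<epsilon> * B) \<le> E * (length us * (\<epsilon> * B))"
      using mult_right_mono[OF E1, of "length us * (\<epsilon> * B)"] eB by simp
    then have "E * (d + \<epsilon> * B) + length us * (\<epsilon> * B) \<le> E * (d + length (u # us) * (\<epsilon> * B))"
      by (simp add: algebra_simps)
    then have "E ^ length us * (E * (d + \<epsilon> * B) + length us * (\<epsilon> * B)) \<le> E ^ length us * (E * (d + length (u # us) * (\<epsilon> * B)))"
      using E1 by (intro mult_left_mono) auto
    then show ?thesis by (simp add: mult_ac)
  qed
  {
    case 1
    then have u: "norm u \<le> Bd" and us: "\<forall>u\<in>set us. norm u \<le> Bd" and xx: "norm (x - x') \<le> d" by auto
    have s: "norm (flow1 (vf 0 u) x - flow1 (vf \<epsilon> u) x') \<le> E * (d + \<epsilon> * B)" using step[OF u xx, of 1] by simp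
    from order_trans[OF Cons.IH(1)[OF us s] bound] show ?case by simp
  next
    case 2
    then have u: "norm u \<le> Bd" and us: "\<forall>u\<in>set us. norm u \<le> Bd" and xx: "norm (x - x') \<le> d"
      and st: "stays 0 (D \<rho>) us (flow1 (vf 0 u) x)" and st1: "\<And>\<sigma>. 0 \<le> \<sigma> \<Longrightarrow> \<sigma> \<le> 1 \<Longrightarrow> sol (vf 0 u) x \<sigma> \<in> D \<rho>"
      and xW: "x' \<in> W" by auto
    define d' where "d' = E * (d + \<epsilon> * B)"
    have s: "norm (flow1 (vf 0 u) x - flow1 (vf \<epsilon> u) x') \<le> d'" using step[OF u xx, of 1] unfolding d'_def by simp
    have "stays \<epsilon> (D (\<rho> + E ^ length us * (d' + length us * (\<epsilon> * B)))) us (flow1 (vf \<epsilon> u) x')"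
      by (rule Cons.IH(2)[OF flow1_vf_W[OF xW] st us s])
    then have 1: "stays \<epsilon> (D (\<rho> + E ^ length (u # us) * (d + length (u # us) * (\<epsilon> * B)))) us (flow1 (vf \<epsilon> u) x')"
      by (rule stays_mono) (rule D_mono, use bound[of d, folded d'_def] in linarith)
    have d'0: "0 \<le> d'" using s norm_ge_zero order_trans by blast
    have "1 \<le> E ^ length us" using E1 by (rule one_le_power)
    then have "1 * d' \<le> E ^ length us * (d' + length us * (\<epsilon> * B))"
      using d'0 eB by (intro mult_mono) auto
    then have d'le: "d' \<le> E ^ length (u # us) * (d + length (u # us) * (\<epsilon> * B))" using bound[of d, folded d'_def] by linarith
    have "sol (vf \<epsilon> u) x' \<sigma> \<in> D (\<rho> + E ^ length (u # us) * (d + length (u # us) * (\<epsilon> * B)))"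
      if "0 \<le> \<sigma>" "\<sigma> \<le> 1" for \<sigma>
    proof -
      have "norm (sol (vf 0 u) x \<sigma> - sol (vf \<epsilon> u) x' \<sigma>) \<le> d'"
        using step[OF u xx that] unfolding d'_def sol_eq_flow1[OF vf_lipschitz that(1)] vf_scale by simp
      moreover have "norm (sol (vf 0 u) x \<sigma> - p) \<le> \<rho>" using st1[OF that] by (simp add: mem_D)
      ultimately have "norm (sol (vf \<epsilon> u) x' \<sigma> - p) \<le> \<rho> + d'"
        using norm_triangle_ineq[of "sol (vf \<epsilon> u) x' \<sigma> - sol (vf 0 u) x \<sigma>" "sol (vf 0 u) x \<sigma> - p"]
        by (simp add: norm_minus_commute)
      then show ?thesis using d'le sol_vf_W[OF xW that(1)] by (auto simp: mem_D)
    qed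
    then show ?case using 1 by simp
  }
qed

text \<open>The word length n is the same for all endpoints and all \<epsilon>, so the total time n
  \<epsilon> sweeps an interval of small times. The endpoint differs from x + s z by less than s
  uniformly in z, which leaves room to solve for any y near x by a fixed point argument on the unit
  ball of \<open>W\<close>.\<close>

lemma local_reach:
  assumes span: "\<And>w. w \<in> W \<Longrightarrow> \<exists>H H'. tangent H \<and> nice H H' \<and> H p = w"
  shows "\<exists>\<delta>>0. \<exists>\<epsilon>0>0. \<exists>n\<ge>1. \<forall>x\<in>D \<delta>. \<forall>y\<in>D \<delta>. \<forall>\<epsilon>. 0 < \<epsilon> \<longrightarrow> \<epsilon> < \<epsilon>0 \<longrightarrow>
    (\<exists>us. length us = n \<and> wflow \<epsilon> us x = y \<and> stays \<epsilon> (D R) us x)"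
proof -
  obtain Bs where Bs: "Bs \<subseteq> W" "pairwise orthogonal Bs" "\<And>b. b \<in> Bs \<Longrightarrow> norm b = 1"
    "independent Bs" "span Bs = W"
    using orthonormal_basis_subspace[OF subspace] by metis
  have finB: "finite Bs" using independent_imp_finite[OF Bs(4)] .
  obtain bs where bs: "set bs = Bs" "distinct bs" using finite_distinct_list[OF finB] by blast
  have "\<forall>b. \<exists>H. b \<in> W \<longrightarrow> tangent H \<and> (\<exists>H'. nice H H') \<and> H p = b" using span by blast
  then obtain Hf where Hf: "\<And>b. b \<in> W \<Longrightarrow> tangent (Hf b) \<and> (\<exists>H'. nice (Hf b) H') \<and> Hf b p = b" by metis
  define hs where "hs = map (\<lambda>b. (Hf b, \<lambda>z. z \<bullet> b)) bs"
  define S where "S = W \<inter> cball 0 1"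
  have S: "compact S" "convex S" "S \<noteq> {}"
    unfolding S_def
    using closed_Int_compact[OF closed_subspace[OF subspace] compact_cball]
      convex_Int[OF subspace_imp_convex[OF subspace] convex_cball] subspace_0[OF subspace] by auto
  have memS: "z \<in> S \<longleftrightarrow> z \<in> W \<and> norm z \<le> 1" for z unfolding S_def by auto
  have adm: "admissible S hs"
  proof -
    have "tangent (Hf b) \<and> (\<exists>H'. nice (Hf b) H') \<and> continuous_on S (\<lambda>z. z \<bullet> b) \<and> (\<forall>z\<in>S. \<bar>z \<bullet> b\<bar> \<le> 1)"
      if b: "b \<in> Bs" for b
    proof -
      have "\<bar>z \<bullet> b\<bar> \<le> 1" if "z \<in> S" for z
        using Cauchy_Schwarz_ineq2[of z b] Bs(3)[OF b] that memS[of z] by simp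
      moreover have "continuous_on S (\<lambda>z. z \<bullet> b)" by (intro continuous_intros)
      ultimately show ?thesis using Hf[of b] Bs(1) b by auto
    qed
    then show ?thesis unfolding admissible_def hs_def using bs(1) by auto
  qed
  \<comment> \<open>The fields have the basis vectors as values at p, so the coefficient map z is
    the identity there.\<close>
  have combo_p: "combo hs z p = z" if "z \<in> S" for z
  proof -
    have "combo hs z p = (\<Sum>b\<leftarrow>bs. (z \<bullet> b) *\<^sub>R Hf b p)"
      unfolding combo_def hs_def by (simp add: o_def)
    also have "\<dots> = (\<Sum>b\<in>Bs. (z \<bullet> b) *\<^sub>R Hf b p)"
      using bs by (simp add: sum_list_distinct_conv_sum_set)
    also have "\<dots> = (\<Sum>b\<in>Bs. (z \<bullet> b) *\<^sub>R b)"
      using Hf Bs(1) by (intro sum.cong) auto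
    also have "\<dots> = z"
      by (rule orthonormal_basis_expand[OF Bs(2,3) _ finB]) (use that memS Bs(5) in auto)
    finally show ?thesis .
  qed
  obtain C where C: "C \<ge> 0" "\<And>x y z. x \<in> D R \<Longrightarrow> y \<in> D R \<Longrightarrow> z \<in> S \<Longrightarrow> norm (combo hs z y - combo hs z x) \<le> C * norm (y - x)"
    using combo_lipschitz[OF adm] by blast
  have "r / 2 < r" "(1/8::real) > 0" using r by auto
  from compose_tangent[OF adm this] obtain s where s: "s > 0" and "\<exists>ws :: ('a \<Rightarrow> real^'u) list. (\<forall>w\<in>set ws. continuous_on S w) \<and>
     (\<forall>x\<in>D (r/2). \<forall>z\<in>S. norm (wflow 0 (map (\<lambda>w. w z) ws) x - x - s *\<^sub>R combo hs z x) \<le> 1/8 * s \<and>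
        stays 0 (D r) (map (\<lambda>w. w z) ws) x)" by blast
  then obtain ws0 :: "('a \<Rightarrow> real^'u) list" where c0: "\<forall>w\<in>set ws0. continuous_on S w"
    and ws0: "\<And>x z. x \<in> D (r/2) \<Longrightarrow> z \<in> S \<Longrightarrow> norm (wflow 0 (map (\<lambda>w. w z) ws0) x - x - s *\<^sub>R combo hs z x) \<le> 1/8 * s \<and>
        stays 0 (D r) (map (\<lambda>w. w z) ws0) x" by blast
  \<comment> \<open>the idle letter only serves to make the word nonempty\<close>
  define ws where "ws = (\<lambda>z. 0) # ws0"
  define n where "n = length ws"
  have vf0: "vf 0 0 = (\<lambda>y. 0)" unfolding vf_def by auto
  have sol0: "sol (vf 0 0) x \<sigma> = x" if "\<sigma> \<ge> 0" for x \<sigma>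
    using sol_eq_flow1[OF vf_lipschitz that, of 0 0 x] by (simp add: vf0 flow1_zero)
  have cws: "\<forall>w\<in>set ws. continuous_on S w" unfolding ws_def using c0 by auto
  have ws: "norm (wflow 0 (map (\<lambda>w. w z) ws) x - x - s *\<^sub>R combo hs z x) \<le> 1/8 * s"
    "stays 0 (D r) (map (\<lambda>w. w z) ws) x" if "x \<in> D (r/2)" "z \<in> S" for x z
  proof -
    have "flow1 (vf 0 0) x = x" by (simp add: vf0 flow1_zero)
    moreover have "x \<in> D r" using that(1) D_mono[of "r/2" r] r by auto
    ultimately show "norm (wflow 0 (map (\<lambda>w. w z) ws) x - x - s *\<^sub>R combo hs z x) \<le> 1/8 * s"
    "stays 0 (D r) (map (\<lambda>w. w z) ws) x" using ws0[OF that] sol0 unfolding ws_def by auto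
  qed
  have "bounded (\<Union>w\<in>set ws. w ` S)"
    using cws S(1) by (intro bounded_UN) (auto intro!: compact_imp_bounded compact_continuous_image)
  then obtain Bd where Bd: "\<And>w z. w \<in> set ws \<Longrightarrow> z \<in> S \<Longrightarrow> norm (w z) \<le> Bd" "Bd \<ge> 0"
    unfolding bounded_pos by (auto intro: less_imp_le)
  define E where "E = exp (CARD('u) * Bd * B + 1)"
  define K where "K = E ^ n * (n * B) + 1"
  have E0: "E > 0" unfolding E_def by simp
  have K: "K > 0" unfolding K_def using B_nonneg E0 by (intro add_nonneg_pos) auto
  \<comment> \<open>s / 4 gives |y - x| \<le> s / 2. The last entry makes the combination at x
    differ from z by at most 1/8. With 1/8 each for the word and for the drift, the total is 1/2 +
    3/8 < 1.\<close>
  define \<delta> where "\<delta> = Min {r / 2, s / 4, 1 / (8 * (C + 1))}"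
  have \<delta>: "\<delta> \<le> r / 2" "\<delta> \<le> s / 4" "\<delta> \<le> 1 / (8 * (C + 1))" unfolding \<delta>_def by (intro Min_le; simp)+
  have \<delta>p: "\<delta> > 0" unfolding \<delta>_def using r s C(1) by (subst Min_gr_iff) auto
  have "\<delta> * (8 * (C + 1)) \<le> 1" using \<delta>(3) C(1) by (simp add: pos_le_divide_eq)
  then have C\<delta>: "C * \<delta> \<le> 1 / 8" using \<delta>p by (simp add: algebra_simps)
  \<comment> \<open>\<epsilon> K bounds the displacement by the drift: at most s / 8 for the
    endpoint, and at most the margin R - r for the whole path.\<close>
  define \<epsilon>0 where "\<epsilon>0 = min (s / (8 * K)) ((R - r) / K)"
  have \<epsilon>0: "\<epsilon>0 > 0" unfolding \<epsilon>0_def using s K r by auto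
  have "\<exists>us. length us = n \<and> wflow \<epsilon> us x = y \<and> stays \<epsilon> (D R) us x"
    if x: "x \<in> D \<delta>" and y: "y \<in> D \<delta>" and \<epsilon>: "0 < \<epsilon>" "\<epsilon> < \<epsilon>0" for x y \<epsilon>
  proof -
    have "\<epsilon> \<le> s / (8 * K)" "\<epsilon> \<le> (R - r) / K" using \<epsilon>(2) unfolding \<epsilon>0_def by auto
    then have "\<epsilon> * (8 * K) \<le> s" and \<epsilon>R: "\<epsilon> * K \<le> R - r" using K by (simp_all add: pos_le_divide_eq)
    then have \<epsilon>s: "\<epsilon> * K \<le> s / 8" by simp
    have xr: "x \<in> D (r/2)" and xR: "x \<in> D R" using x D_mono[of \<delta> "r/2"] D_mono[of \<delta> R] \<delta> r by auto
    have pR: "p \<in> D R" using p r by (simp add: mem_D)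
    have xW: "x \<in> W" "norm (x - p) \<le> \<delta>" and yW: "y \<in> W" "norm (y - p) \<le> \<delta>" using x y by (auto simp: mem_D)
    define U where "U = (\<lambda>z. map (\<lambda>w. w z) ws)"
    have U: "length (U z) = n" "z \<in> S \<Longrightarrow> \<forall>u\<in>set (U z). norm u \<le> Bd" for z
      unfolding U_def n_def using Bd(1) by auto
    have xx: "norm (x - x) \<le> 0" by simp
    have Kle: "E ^ n * (0 + n * (\<epsilon> * B)) \<le> \<epsilon> * K"
      unfolding K_def using \<epsilon>(1) by (simp add: algebra_simps)
    have err: "norm (wflow \<epsilon> (U z) x - x - s *\<^sub>R z) \<le> 3 / 8 * s" if z: "z \<in> S" for z
    proof -
      have "norm (wflow 0 (U z) x - wflow \<epsilon> (U z) x) \<le> s / 8"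
        using wflow_perturb(1)[OF E_def Bd(2) U(2)[OF z] xx less_imp_le[OF \<epsilon>(1)]] Kle \<epsilon>s unfolding U(1) by linarith
      then have 1: "norm (wflow \<epsilon> (U z) x - wflow 0 (U z) x) \<le> s / 8" by (simp add: norm_minus_commute)
      have 2: "norm (wflow 0 (U z) x - x - s *\<^sub>R combo hs z x) \<le> 1/8 * s" unfolding U_def by (rule ws(1)[OF xr z])
      have "norm (combo hs z x - z) \<le> C * norm (x - p)" using C(2)[OF pR xR z] unfolding combo_p[OF z] .
      also have "\<dots> \<le> 1 / 8" using mult_left_mono[OF xW(2) C(1)] C\<delta> by linarith
      finally have "s * norm (combo hs z x - z) \<le> s * (1 / 8)" using s by (intro mult_left_mono) auto
      then have 3: "norm (s *\<^sub>R (combo hs z x - z)) \<le> 1 / 8 * s" using s by simp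
      have "wflow \<epsilon> (U z) x - x - s *\<^sub>R z = (wflow \<epsilon> (U z) x - wflow 0 (U z) x) +
         (wflow 0 (U z) x - x - s *\<^sub>R combo hs z x) + s *\<^sub>R (combo hs z x - z) + 0" by (simp add: algebra_simps)
      then have "norm (wflow \<epsilon> (U z) x - x - s *\<^sub>R z) \<le> norm (wflow \<epsilon> (U z) x - wflow 0 (U z) x) +
         norm (wflow 0 (U z) x - x - s *\<^sub>R combo hs z x) + norm (s *\<^sub>R (combo hs z x - z)) + norm (0::'a)"
        by (simp only: norm_sum4_le)
      then show ?thesis using 1 2 3 by simp
    qed
    \<comment> \<open>Its fixed points are exactly the parameters whose word ends at y; rewritten,
      it is (y - x minus the error) / s, of norm at most 7/8.\<close>
    define \<Psi> where "\<Psi> = (\<lambda>z. z + (1 / s) *\<^sub>R (y - wflow \<epsilon> (U z) x))"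
    have \<Psi>eq: "\<Psi> z = (1 / s) *\<^sub>R ((y - x) - (wflow \<epsilon> (U z) x - x - s *\<^sub>R z))" for z
      unfolding \<Psi>_def using s by (simp add: algebra_simps)
    have "continuous_on S (\<lambda>z. wflow \<epsilon> (U z) x)"
      unfolding U_def by (rule continuous_on_wflow[OF cws]) simp
    then have cont: "continuous_on S \<Psi>" unfolding \<Psi>_def by (intro continuous_intros)
    have yx: "norm (y - x) \<le> s / 2"
      using norm_triangle_ineq4[of "y - p" "x - p"] xW(2) yW(2) \<delta>(2) by simp
    have "\<Psi> z \<in> S" if z: "z \<in> S" for z
    proof -
      have "norm ((y - x) - (wflow \<epsilon> (U z) x - x - s *\<^sub>R z)) \<le> s"
        using norm_triangle_ineq4[of "y - x" "wflow \<epsilon> (U z) x - x - s *\<^sub>R z"] yx err[OF z] s by linarith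
      then have "norm (\<Psi> z) \<le> 1" unfolding \<Psi>eq norm_scaleR using s by (simp add: pos_divide_le_eq)
      moreover have "\<Psi> z \<in> W" unfolding \<Psi>_def
        using z memS yW(1) wflow_W[OF xW(1)] by (intro subspace_add subspace_mul subspace_diff subspace) auto
      ultimately show ?thesis using memS by blast
    qed
    then have "\<Psi> \<in> S \<rightarrow> S" by auto
    then obtain z where z: "z \<in> S" "\<Psi> z = z" using brouwer[OF S cont] by blast
    then have "wflow \<epsilon> (U z) x = y" unfolding \<Psi>_def using s by simp
    moreover have "stays \<epsilon> (D R) (U z) x"
    proof -
      have "stays \<epsilon> (D (r + E ^ n * (0 + n * (\<epsilon> * B)))) (U z) x"
      proof -
        have "stays 0 (D r) (U z) x" unfolding U_def by (rule ws(2)[OF xr z(1)])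
        from wflow_perturb(2)[OF E_def Bd(2) U(2)[OF z(1)] xx less_imp_le[OF \<epsilon>(1)] xW(1) this]
        show ?thesis unfolding U(1) .
      qed
      then show ?thesis by (rule stays_mono) (rule D_mono, use Kle \<epsilon>R in linarith)
    qed
    ultimately show ?thesis using U(1) by blast
  qed
  moreover have "n \<ge> 1" unfolding n_def ws_def by simp
  ultimately show ?thesis using \<delta>p \<epsilon>0
    by (intro exI[of _ \<delta>] conjI exI[of _ \<epsilon>0] exI[of _ n] ballI allI impI) auto
qed

end

section \<open>Lifted vector fields\<close>

lemma Ck_on_Pair:
  assumes "open S" "Ck_on k f S" "Ck_on k g S"
  shows "Ck_on k (\<lambda>z. (f z, g z)) S"
proof -
  have 1: "bounded_linear (\<lambda>x. (x, 0))" "bounded_linear (\<lambda>y. (0, y))"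
    by (auto intro!: bounded_linear_Pair bounded_linear_ident bounded_linear_zero)
  have "Ck_on k (\<lambda>z. (f z, 0) + (0, g z)) S"
    by (intro Ck_on_add Ck_on_linear[OF assms(1) 1(1)] Ck_on_linear[OF assms(1) 1(2)] assms)
  then show ?thesis by simp
qed

section \<open>Jacobians and smoothness of the lifts\<close>

lemma jacobian_mult_vec:
  fixes f :: "real^'n \<Rightarrow> real^'m"
  assumes "f differentiable (at x)"
  shows "jacobian f (at x) *v v = frechet_derivative f (at x) v"
  by (rule fun_cong[OF frechet_derivative_at]) (rule jacobian_works[THEN iffD1, OF assms])

lemma jacobian_eqI:
  fixes f :: "real^'n \<Rightarrow> real^'m"
  assumes "(f has_derivative (\<lambda>v. A *v v)) (at x)"
  shows "jacobian f (at x) = A"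
  by (simp add: jacobian_def frechet_derivative_at[OF assms, symmetric] matrix_of_matrix_vector_mul)

definition column_matrix :: "'n \<Rightarrow> real^'m \<Rightarrow> real^'n^'m" where
  "column_matrix j w = (\<chi> i k. if k = j then w $ i else 0)"

lemma bounded_linear_column_matrix: "bounded_linear (column_matrix j)"
  unfolding linear_conv_bounded_linear[symmetric] column_matrix_def
  by (rule linearI) (auto simp: vec_eq_iff)

lemma jacobian_columns:
  fixes f :: "real^'n \<Rightarrow> real^'m"
  shows "jacobian f (at x) = (\<Sum>j\<in>UNIV. column_matrix j (frechet_derivative f (at x) (axis j 1)))"
  by (simp add: jacobian_def matrix_def column_matrix_def vec_eq_iff)

lemma Ck_on_jacobian:
  fixes h :: "real^'n \<Rightarrow> real^'m"
  assumes "open V" "Ck_on (Suc k) h V"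
  shows "Ck_on k (\<lambda>x. jacobian h (at x)) V"
proof -
  have "Ck_on k (\<lambda>x. \<Sum>j\<in>UNIV. column_matrix j (frechet_derivative h (at x) (axis j 1))) V"
    using assms by (intro Ck_on_sum Ck_on_linear[OF _ bounded_linear_column_matrix]) auto
  then show ?thesis by (simp only: jacobian_columns[symmetric])
qed

lemma smooth_onD: "smooth_on f S \<Longrightarrow> Ck_on k f S"
  by (simp add: smooth_on_def)

lemma smooth_on_has_derivative:
  "smooth_on f S \<Longrightarrow> x \<in> S \<Longrightarrow> (f has_derivative frechet_derivative f (at x)) (at x)"
  by (rule Ck_onD[OF smooth_onD])

lemma smooth_on_differentiable: "smooth_on f S \<Longrightarrow> x \<in> S \<Longrightarrow> f differentiable (at x)"
  by (rule differentiableI[OF smooth_on_has_derivative])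

lemma smooth_on_lie_bracket:
  assumes V: "open V" and a: "smooth_on a V" and b: "smooth_on b V"
  shows "smooth_on (lie_bracket a b) V"
  unfolding smooth_on_def
proof
  fix k
  have "Ck_on k (\<lambda>x. frechet_derivative b (at x) (a x) + (- frechet_derivative a (at x) (b x))) V"
    using a b by (intro Ck_on_add V Ck_on_linear[OF V bounded_linear_minus[OF bounded_linear_ident]] Ck_on_directional smooth_onD)
  then show "Ck_on k (lie_bracket a b) V"
    by (rule Ck_on_cong[OF V, rotated])
      (simp add: lie_bracket_def jacobian_mult_vec smooth_on_differentiable[OF a] smooth_on_differentiable[OF b])
qed

lemma lie_generated_smooth:
  assumes V: "open V" and G: "\<And>h. h \<in> G \<Longrightarrow> smooth_on h V"
  shows "h \<in> lie_generated G \<Longrightarrow> smooth_on h V"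
proof (induction rule: lie_generated.induct)
  case (scale h c)
  then show ?case unfolding smooth_on_def using Ck_on_linear[OF V bounded_linear_scaleR_right[of c], of _ h] by simp
next
  case (bracket h1 h2)
  then show ?case using smooth_on_lie_bracket[OF V] by blast
qed (auto simp: smooth_on_def Ck_on_const Ck_on_add[OF V] dest: G)

lemmas mat_distrib =
  bounded_bilinear.add_left[OF bounded_bilinear_matrix_mult] bounded_bilinear.add_right[OF bounded_bilinear_matrix_mult]
  bounded_bilinear.diff_left[OF bounded_bilinear_matrix_mult] bounded_bilinear.diff_right[OF bounded_bilinear_matrix_mult]

lemma transpose_add: "transpose (A + B) = transpose A + transpose (B :: 'a::ab_group_add^'n^'m)"
  and transpose_diff: "transpose (A - B) = transpose A - transpose (B :: 'a::ab_group_add^'n^'m)"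
  by (simp_all add: transpose_def vec_eq_iff)

lemma bounded_linear_transpose: "bounded_linear (transpose :: real^'n^'m \<Rightarrow> real^'m^'n)"
  unfolding linear_conv_bounded_linear[symmetric]
  by (rule linearI) (simp_all add: transpose_def vec_eq_iff)

lemma F_field_alt: "F_field h = (\<lambda>z. (h (fst z),
    jacobian h (at (fst z)) ** snd z + snd z ** transpose (jacobian h (at (fst z)))))"
  by (auto simp: F_field_def)

lemma open_Times_UNIV: "open V \<Longrightarrow> open (V \<times> UNIV)"
  by (simp add: open_Times)

lemma Ck_on_fst: "open V \<Longrightarrow> Ck_on k f V \<Longrightarrow> Ck_on k (\<lambda>z. f (fst z)) (V \<times> UNIV)"
  using Ck_on_compose_linear[OF _ bounded_linear_fst, of V k f]
  by (simp add: vimage_fst)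

lemma Ck_on_snd: "Ck_on k snd S"
  by (rule Ck_on_subset[OF Ck_on_bounded_linear[OF bounded_linear_snd]]) simp

lemma smooth_on_F_field:
  fixes h :: "real^'n \<Rightarrow> real^'n"
  assumes V: "open V" and h: "smooth_on h V"
  shows "smooth_on (F_field h) (V \<times> UNIV)"
  unfolding smooth_on_def F_field_alt
proof
  fix k
  have o: "open (V \<times> (UNIV :: (real^'n^'n) set))" using V by (rule open_Times_UNIV)
  have J: "Ck_on k (\<lambda>z. jacobian h (at (fst z))) (V \<times> (UNIV :: (real^'n^'n) set))"
    by (intro Ck_on_fst V Ck_on_jacobian smooth_onD h)
  show "Ck_on k (\<lambda>z. (h (fst z), jacobian h (at (fst z)) ** snd z + snd z ** transpose (jacobian h (at (fst z))))) (V \<times> UNIV)"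
    by (intro Ck_on_Pair o Ck_on_add Ck_on_bilinear[OF o bounded_bilinear_matrix_mult] J Ck_on_snd Ck_on_fst V smooth_onD h
        Ck_on_linear[OF o bounded_linear_transpose])
qed

lemma smooth_on_F_drift:
  fixes h :: "real^'n \<Rightarrow> real^'n"
  assumes V: "open V" and h: "smooth_on h V" and g: "smooth_on g V"
  shows "smooth_on (F_drift h g) (V \<times> UNIV)"
  unfolding smooth_on_def
proof
  fix k
  have o: "open (V \<times> (UNIV :: (real^'n^'n) set))" using V by (rule open_Times_UNIV)
  have gg: "Ck_on k (\<lambda>z. g (fst z)) (V \<times> (UNIV :: (real^'n^'n) set))"
    by (intro Ck_on_fst V smooth_onD g)
  have "Ck_on k (\<lambda>z. F_field h z + (0, g (fst z) ** transpose (g (fst z)))) (V \<times> UNIV)"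
    by (intro Ck_on_Pair o Ck_on_add Ck_on_bilinear[OF o bounded_bilinear_matrix_mult] gg Ck_on_const
        smooth_onD[OF smooth_on_F_field[OF V h]] Ck_on_linear[OF o bounded_linear_transpose])
  moreover have "(\<lambda>z. F_field h z + (0, g (fst z) ** transpose (g (fst z)))) = F_drift h g"
    by (auto simp: F_drift_def F_field_def)
  ultimately show "Ck_on k (F_drift h g) (V \<times> UNIV)" by simp
qed

section \<open>Brackets, sums and multiples under the lift\<close>

lemma jacobian_has_derivative:
  fixes h :: "real^'n \<Rightarrow> real^'n"
  assumes V: "open V" and h: "smooth_on h V" and m: "m \<in> V"
  shows "((\<lambda>x. jacobian h (at x)) has_derivative frechet_derivative (\<lambda>x. jacobian h (at x)) (at m)) (at m)"
  by (rule Ck_onD[OF Ck_on_jacobian[OF V smooth_onD[OF h]] m])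

lemma frechet_F_field:
  fixes h :: "real^'n \<Rightarrow> real^'n"
  assumes V: "open V" and h: "smooth_on h V" and m: "m \<in> V"
  defines "J \<equiv> jacobian h (at m)" and "J' \<equiv> frechet_derivative (\<lambda>x. jacobian h (at x)) (at m)"
  shows "frechet_derivative (F_field h) (at (m, P)) (v, Q) =
    (J *v v, J' v ** P + J ** Q + (P ** transpose (J' v) + Q ** transpose J))"
proof -
  have f: "(fst has_derivative fst) (at (m, P))" "(snd has_derivative snd) (at (m, P))"
    by (auto intro: bounded_linear_imp_has_derivative bounded_linear_fst bounded_linear_snd)
  have d1: "((\<lambda>z. h (fst z)) has_derivative (\<lambda>z. frechet_derivative h (at m) (fst z))) (at (m, P))"
    using has_derivative_compose[OF f(1), of h "frechet_derivative h (at m)"] smooth_on_has_derivative[OF h m] by simp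
  have d2: "((\<lambda>z. jacobian h (at (fst z))) has_derivative (\<lambda>z. J' (fst z))) (at (m, P))"
    using has_derivative_compose[OF f(1), of "\<lambda>x. jacobian h (at x)" J'] jacobian_has_derivative[OF V h m]
    unfolding J'_def by simp
  note bb = bounded_bilinear.FDERIV[OF bounded_bilinear_matrix_mult]
  have d3: "((\<lambda>z. transpose (jacobian h (at (fst z)))) has_derivative (\<lambda>z. transpose (J' (fst z)))) (at (m, P))"
    by (rule bounded_linear.has_derivative[OF bounded_linear_transpose d2])
  have "(F_field h has_derivative (\<lambda>z. (frechet_derivative h (at m) (fst z),
      jacobian h (at (fst (m, P))) ** snd z + J' (fst z) ** snd (m, P) +
      (snd (m, P) ** transpose (J' (fst z)) + snd z ** transpose (jacobian h (at (fst (m, P)))))))) (at (m, P))"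
    unfolding F_field_alt by (intro has_derivative_Pair d1 has_derivative_add bb d2 d3 f)
  from frechet_derivative_at[OF this, symmetric] show ?thesis
    by (simp add: jacobian_mult_vec[OF smooth_on_differentiable[OF h m]] J_def add.commute)
qed

text \<open>J' v is the second derivative with one slot filled, so this is the equality of mixed
  derivatives. It allows the free vector in the derivative of a bracket to be moved to the last
  place, where the Jacobian can be read off.\<close>

lemma jacobian_derivative_symmetric:
  fixes h :: "real^'n \<Rightarrow> real^'n"
  assumes V: "open V" and h: "smooth_on h V" and m: "m \<in> V"
  defines "J' \<equiv> frechet_derivative (\<lambda>x. jacobian h (at x)) (at m)"
  shows "J' v *v w = J' w *v v"
proof -
  have e: "J' v *v w = frechet_derivative (\<lambda>y. frechet_derivative h (at y) w) (at m) v" for v w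
  proof -
    have bl: "bounded_linear (\<lambda>A :: real^'n^'n. A *v w)"
      by (rule bounded_bilinear.bounded_linear_left[OF bounded_bilinear_matrix_vector_mult])
    have "((\<lambda>x. jacobian h (at x) *v w) has_derivative (\<lambda>v. J' v *v w)) (at m)"
      unfolding J'_def by (rule bounded_linear.has_derivative[OF bl jacobian_has_derivative[OF V h m]])
    then have "((\<lambda>x. frechet_derivative h (at x) w) has_derivative (\<lambda>v. J' v *v w)) (at m)"
      by (rule has_derivative_transform_within_open[OF _ V m])
        (simp add: jacobian_mult_vec smooth_on_differentiable[OF h])
    from frechet_derivative_at[OF this] show ?thesis by metis
  qed
  show ?thesis unfolding e by (rule frechet_derivative_commute[OF smooth_onD[OF h] V m])
qed

lemma jacobian_lie_bracket:
  fixes a b :: "real^'n \<Rightarrow> real^'n"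
  assumes V: "open V" and a: "smooth_on a V" and b: "smooth_on b V" and m: "m \<in> V"
  shows "jacobian (lie_bracket a b) (at m) =
    frechet_derivative (\<lambda>x. jacobian b (at x)) (at m) (a m) + jacobian b (at m) ** jacobian a (at m)
    - (frechet_derivative (\<lambda>x. jacobian a (at x)) (at m) (b m) + jacobian a (at m) ** jacobian b (at m))"
proof (rule jacobian_eqI)
  let ?A = "frechet_derivative (\<lambda>x. jacobian a (at x)) (at m)" and ?B = "frechet_derivative (\<lambda>x. jacobian b (at x)) (at m)"
  have da: "(a has_derivative (\<lambda>v. jacobian a (at m) *v v)) (at m)" and db: "(b has_derivative (\<lambda>v. jacobian b (at m) *v v)) (at m)"
    using smooth_on_differentiable[OF a m] smooth_on_differentiable[OF b m] jacobian_works by blast+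
  have "(lie_bracket a b has_derivative
     (\<lambda>v. (jacobian b (at m) *v (jacobian a (at m) *v v) + ?B v *v a m)
        - (jacobian a (at m) *v (jacobian b (at m) *v v) + ?A v *v b m))) (at m)"
    unfolding lie_bracket_def
    by (intro has_derivative_diff bounded_bilinear.FDERIV[OF bounded_bilinear_matrix_vector_mult] jacobian_has_derivative[OF V _ m] a b da db)
  moreover have "(jacobian b (at m) *v (jacobian a (at m) *v v) + ?B v *v a m)
        - (jacobian a (at m) *v (jacobian b (at m) *v v) + ?A v *v b m) =
     (?B (a m) + jacobian b (at m) ** jacobian a (at m) - (?A (b m) + jacobian a (at m) ** jacobian b (at m))) *v v" for v
    unfolding jacobian_derivative_symmetric[OF V a m, of v] jacobian_derivative_symmetric[OF V b m, of v]
    by (simp add: matrix_vector_mult_add_rdistrib matrix_vector_mult_diff_rdistrib matrix_vector_mul_assoc algebra_simps)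
  ultimately show "(lie_bracket a b has_derivative
     (\<lambda>v. (?B (a m) + jacobian b (at m) ** jacobian a (at m) - (?A (b m) + jacobian a (at m) ** jacobian b (at m))) *v v)) (at m)"
    by simp
qed

text \<open>In the matrix component the products J_b P J_a^T and J_a P J_b^T occur on both sides of
  the difference and cancel; what is left is the Jacobian of the bracket and its transpose acting on
  P.\<close>

lemma F_field_lie_bracket:
  fixes a b :: "real^'n \<Rightarrow> real^'n"
  assumes V: "open V" and a: "smooth_on a V" and b: "smooth_on b V" and m: "m \<in> V"
  shows "F_field (lie_bracket a b) (m, P) =
    frechet_derivative (F_field b) (at (m, P)) (F_field a (m, P)) - frechet_derivative (F_field a) (at (m, P)) (F_field b (m, P))"
proof -
  have F: "F_field h (m, P) = (h m, jacobian h (at m) ** P + P ** transpose (jacobian h (at m)))" for h :: "real^'n \<Rightarrow> real^'n"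
    by (simp add: F_field_def)
  show ?thesis
    unfolding F frechet_F_field[OF V a m] frechet_F_field[OF V b m] jacobian_lie_bracket[OF V a b m]
      transpose_add transpose_diff matrix_transpose_mul mat_distrib
    by (simp add: lie_bracket_def matrix_mul_assoc algebra_simps)
qed

lemma F_field_add:
  fixes a b :: "real^'n \<Rightarrow> real^'n"
  assumes "smooth_on a V" "smooth_on b V" "m \<in> V"
  shows "F_field (\<lambda>x. a x + b x) (m, P) = F_field a (m, P) + F_field b (m, P)"
    and jacobian_add: "jacobian (\<lambda>x. a x + b x) (at m) = jacobian a (at m) + jacobian b (at m)"
proof -
  have "(a has_derivative (\<lambda>v. jacobian a (at m) *v v)) (at m)" "(b has_derivative (\<lambda>v. jacobian b (at m) *v v)) (at m)"
    using smooth_on_differentiable[OF assms(1,3)] smooth_on_differentiable[OF assms(2,3)] jacobian_works by blast+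
  from has_derivative_add[OF this]
  show j: "jacobian (\<lambda>x. a x + b x) (at m) = jacobian a (at m) + jacobian b (at m)"
    by (intro jacobian_eqI) (simp add: matrix_vector_mult_add_rdistrib)
  show "F_field (\<lambda>x. a x + b x) (m, P) = F_field a (m, P) + F_field b (m, P)"
    unfolding F_field_def prod.case j transpose_add mat_distrib by simp
qed

lemma F_field_scale:
  fixes a :: "real^'n \<Rightarrow> real^'n"
  assumes "smooth_on a V" "m \<in> V"
  shows "F_field (\<lambda>x. c *\<^sub>R a x) (m, P) = c *\<^sub>R F_field a (m, P)"
    and jacobian_scale: "jacobian (\<lambda>x. c *\<^sub>R a x) (at m) = c *\<^sub>R jacobian a (at m)"
proof -
  have "(a has_derivative (\<lambda>v. jacobian a (at m) *v v)) (at m)"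
    using smooth_on_differentiable[OF assms] jacobian_works by blast
  from has_derivative_scaleR_right[OF this, of c]
  show j: "jacobian (\<lambda>x. c *\<^sub>R a x) (at m) = c *\<^sub>R jacobian a (at m)"
    by (intro jacobian_eqI) (simp add: scaleR_matrix_vector_assoc)
  show "F_field (\<lambda>x. c *\<^sub>R a x) (m, P) = c *\<^sub>R F_field a (m, P)"
    unfolding F_field_def prod.case j
    by (simp add: transpose_def matrix_matrix_mult_def vec_eq_iff sum_distrib_left algebra_simps)
qed

lemma jacobian_zero: "jacobian (\<lambda>x. 0 :: real^'n) (at (m :: real^'n)) = 0"
  by (rule jacobian_eqI) simp

lemma F_field_zero: "F_field (\<lambda>x. 0) z = 0"
  unfolding F_field_def by (cases z) (simp add: jacobian_zero zero_prod_def transpose_def matrix_matrix_mult_def vec_eq_iff)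

section \<open>Controllability\<close>

lemma attainable_atI:
  assumes "piecewise_constant_on u 0 T" "trajectory M F0 F T u X" "X 0 = x" "X T = y"
  shows "y \<in> attainable_at M F0 F x T"
  unfolding attainable_at_def using assms by blast

lemma attainable_at_refl:
  fixes F :: "'u::finite \<Rightarrow> 's::real_normed_vector \<Rightarrow> 's"
  assumes "x \<in> M"
  shows "x \<in> attainable_at M F0 F x 0"
proof -
  have "piecewise_constant_on (\<lambda>t. 0 :: real^'u) 0 0"
    unfolding piecewise_constant_on_def constant_on_def by (intro exI[of _ "{}"]) auto
  moreover have "trajectory M F0 F 0 (\<lambda>t. 0) (\<lambda>t. x)"
    \<comment> \<open>The only time of a trajectory of length zero is declared exceptional.\<close>
    unfolding trajectory_def using assms by (auto intro!: exI[of _ "{0}"])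
  ultimately show ?thesis by (rule attainable_atI) simp_all
qed

lemma piecewise_constant_on_concat:
  assumes "piecewise_constant_on u1 0 T1" "piecewise_constant_on u2 0 T2"
  shows "piecewise_constant_on (\<lambda>t. if t < T1 then u1 t else u2 (t - T1)) 0 (T1 + T2)"
proof -
  let ?u = "\<lambda>t. if t < T1 then u1 t else u2 (t - T1)"
  obtain S1 where S1: "finite S1" "\<And>c d. {c<..<d} \<subseteq> {0..T1} - S1 \<Longrightarrow> u1 constant_on {c<..<d}"
    using assms(1) unfolding piecewise_constant_on_def by blast
  obtain S2 where S2: "finite S2" "\<And>c d. {c<..<d} \<subseteq> {0..T2} - S2 \<Longrightarrow> u2 constant_on {c<..<d}"
    using assms(2) unfolding piecewise_constant_on_def by blast
  \<comment> \<open>T1 is made a switching time, so an interval that avoids \<open>S\<close> lies on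
    one side of it.\<close>
  define S where "S = S1 \<union> {T1} \<union> (\<lambda>s. s + T1) ` S2"
  have "?u constant_on {c<..<d}" if sub: "{c<..<d} \<subseteq> {0..T1 + T2} - S" for c d
  proof -
    have "T1 \<notin> {c<..<d}" using sub unfolding S_def by blast
    then consider "d \<le> T1" | "T1 \<le> c" by fastforce
    then show ?thesis
    proof cases
      case 1
      have "{c<..<d} \<subseteq> {0..T1} - S1"
      proof
        fix t assume t: "t \<in> {c<..<d}"
        then have "t \<in> {0..T1 + T2} - S" using sub by blast
        then show "t \<in> {0..T1} - S1" using t 1 unfolding S_def by auto
      qed
      from S1(2)[OF this] obtain y where "\<forall>t\<in>{c<..<d}. u1 t = y" unfolding constant_on_def by blast
      then have "\<forall>t\<in>{c<..<d}. ?u t = y" using 1 by auto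
      then show ?thesis unfolding constant_on_def by blast
    next
      case 2
      have "{c - T1<..<d - T1} \<subseteq> {0..T2} - S2"
      proof
        fix t assume t: "t \<in> {c - T1<..<d - T1}"
        then have "t + T1 \<in> {c<..<d}" by auto
        then have "t + T1 \<in> {0..T1 + T2} - S" using sub by blast
        then show "t \<in> {0..T2} - S2" using t 2 unfolding S_def by auto
      qed
      from S2(2)[OF this] obtain y where y: "\<forall>t\<in>{c - T1<..<d - T1}. u2 t = y" unfolding constant_on_def by blast
      have "?u t = y" if "t \<in> {c<..<d}" for t using y 2 that by auto
      then show ?thesis unfolding constant_on_def by blast
    qed
  qed
  then show ?thesis unfolding piecewise_constant_on_def using S1(1) S2(1)
    by (intro exI[of _ S]) (auto simp: S_def)
qed

lemma attainable_at_trans: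
  assumes y: "y \<in> attainable_at M F0 F x T1" and z: "z \<in> attainable_at M F0 F y T2"
    and T: "T1 \<ge> 0" "T2 \<ge> 0"
  shows "z \<in> attainable_at M F0 F x (T1 + T2)"
proof -
  obtain u1 X1 where 1: "piecewise_constant_on u1 0 T1" "trajectory M F0 F T1 u1 X1" "X1 0 = x" "X1 T1 = y"
    using y unfolding attainable_at_def by blast
  obtain u2 X2 where 2: "piecewise_constant_on u2 0 T2" "trajectory M F0 F T2 u2 X2" "X2 0 = y" "X2 T2 = z"
    using z unfolding attainable_at_def by blast
  define u where "u = (\<lambda>t. if t < T1 then u1 t else u2 (t - T1))"
  define X where "X = (\<lambda>t. if t \<le> T1 then X1 t else X2 (t - T1))"
  let ?rhs = "\<lambda>u X t. F0 (X t) + (\<Sum>i\<in>UNIV. (u t $ i) *\<^sub>R F i (X t))"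
  obtain S1 where S1: "continuous_on {0..T1} X1" "X1 ` {0..T1} \<subseteq> M" "finite S1"
    "\<And>t. t \<in> {0..T1} - S1 \<Longrightarrow> (X1 has_vector_derivative ?rhs u1 X1 t) (at t within {0..T1})"
    using 1(2) unfolding trajectory_def by blast
  obtain S2 where S2: "continuous_on {0..T2} X2" "X2 ` {0..T2} \<subseteq> M" "finite S2"
    "\<And>t. t \<in> {0..T2} - S2 \<Longrightarrow> (X2 has_vector_derivative ?rhs u2 X2 t) (at t within {0..T2})"
    using 2(2) unfolding trajectory_def by blast
  define S where "S = S1 \<union> {T1} \<union> (\<lambda>s. s + T1) ` S2"
  have X2eq: "X t = X2 (t - T1)" if "t \<ge> T1" for t
    using that 1(4) 2(3) unfolding X_def by (cases "t = T1") auto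
  have "continuous_on ({0..T1} \<union> {T1..T1 + T2}) X"
  proof (rule continuous_on_closed_Un)
    show "continuous_on {0..T1} X" using S1(1) by (rule continuous_on_eq) (simp add: X_def)
    have "continuous_on {T1..T1 + T2} (\<lambda>t. X2 (t - T1))"
      by (rule continuous_on_compose2[OF S2(1)]) (auto intro!: continuous_intros)
    then show "continuous_on {T1..T1 + T2} X" by (rule continuous_on_eq) (simp add: X2eq)
  qed auto
  moreover have "{0..T1} \<union> {T1..T1 + T2} = {0..T1 + T2}" using T by auto
  ultimately have cont: "continuous_on {0..T1 + T2} X" by simp
  have im: "X ` {0..T1 + T2} \<subseteq> M"
  proof
    fix w assume "w \<in> X ` {0..T1 + T2}"
    then obtain t where t: "t \<in> {0..T1 + T2}" "w = X t" by blast
    show "w \<in> M"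
    proof (cases "t \<le> T1")
      case True
      then have "t \<in> {0..T1}" "w = X1 t" using t unfolding X_def by auto
      then show ?thesis using S1(2) by blast
    next
      case False
      then have "t - T1 \<in> {0..T2}" "w = X2 (t - T1)" using t unfolding X_def by auto
      then show ?thesis using S2(2) by blast
    qed
  qed
  have der: "(X has_vector_derivative ?rhs u X t) (at t within {0..T1 + T2})" if t: "t \<in> {0..T1 + T2} - S" for t
  proof (cases "t < T1")
    case True
    then have t1: "t \<in> {0..T1} - S1" using t unfolding S_def by auto
    have "(X has_vector_derivative ?rhs u1 X1 t) (at t within {0..T1})"
      by (rule has_vector_derivative_transform[OF _ _ S1(4)[OF t1]]) (use t1 in \<open>auto simp: X_def\<close>)
    moreover have "at t within {0..T1} = at t within {0..T1 + T2}"
      by (rule at_within_nhd[of _ "{..<T1}"]) (use True T in auto)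
    ultimately show ?thesis using True by (simp add: u_def X_def)
  next
    case False
    have "t \<noteq> T1" using t unfolding S_def by auto
    then have tT: "t > T1" using False by simp
    have t2: "t - T1 \<in> {0..T2} - S2"
    proof -
      have "t \<notin> (\<lambda>s. s + T1) ` S2" using t unfolding S_def by blast
      then have "t - T1 \<notin> S2" by (metis diff_add_cancel image_eqI)
      then show ?thesis using t tT by auto
    qed
    have im: "(\<lambda>t. t - T1) ` {T1..T1 + T2} = {0..T2}"
    proof -
      have "(\<lambda>t. t - T1) ` {T1..T1 + T2} = (\<lambda>t. t + (- T1)) ` {T1..T1 + T2}" by simp
      then show ?thesis using T by (simp only: image_add_atLeastAtMost') simp
    qed
    have "((\<lambda>t. t - T1) has_vector_derivative 1) (at t within {T1..T1 + T2})"
      by (auto intro!: derivative_eq_intros)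
    from vector_diff_chain_within[OF this, of X2] S2(4)[OF t2]
    have "((\<lambda>t. X2 (t - T1)) has_vector_derivative ?rhs u2 X2 (t - T1)) (at t within {T1..T1 + T2})"
      by (simp add: im o_def)
    then have "(X has_vector_derivative ?rhs u2 X2 (t - T1)) (at t within {T1..T1 + T2})"
      by (rule has_vector_derivative_transform[rotated 2]) (use t tT in \<open>auto simp: X2eq\<close>)
    moreover have "at t within {T1..T1 + T2} = at t within {0..T1 + T2}"
      by (rule at_within_nhd[of _ "{T1<..}"]) (use tT T in auto)
    ultimately show ?thesis using tT by (simp add: u_def X_def)
  qed
  have "trajectory M F0 F (T1 + T2) u X"
    unfolding trajectory_def
  proof (intro conjI cont im exI[of _ S])
    show "finite S" unfolding S_def using S1(3) S2(3) by simp
  qed (use der in blast)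
  moreover have "X 0 = x" using 1(3) T unfolding X_def by simp
  moreover have "X (T1 + T2) = z" using X2eq[of "T1 + T2"] 2(4) T by simp
  ultimately show ?thesis
    unfolding attainable_at_def using piecewise_constant_on_concat[OF 1(1) 2(1), folded u_def] by blast
qed

lemma attainable_at_subset:
  assumes "T \<ge> 0"
  shows "attainable_at M F0 F x T \<subseteq> M"
  using assms unfolding attainable_at_def trajectory_def by auto

text \<open>The time change by 1 / \<epsilon> restores coefficient one for the drift and turns the
  letter into the control u / \<epsilon>; in \<open>D R\<close> the cut-off fields are the original
  ones.\<close>

lemma (in control_chart) letter_attainable:
  fixes M :: "'a set" and \<epsilon> :: real
  assumes DM: "D R \<subseteq> M" and \<epsilon>: "\<epsilon> > 0" and st: "\<And>\<sigma>. \<sigma> \<in> {0..1} \<Longrightarrow> sol (vf \<epsilon> u) x \<sigma> \<in> D R"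
  shows "flow1 (vf \<epsilon> u) x \<in> attainable_at M F0 F x \<epsilon>"
proof -
  define X where "X = (\<lambda>t. sol (vf \<epsilon> u) x (1 / \<epsilon> * t + 0))"
  note s = sol_solves[OF vf_lipschitz, of \<epsilon> u x]
  have XD: "X t \<in> D R" if "t \<in> {0..\<epsilon>}" for t
    unfolding X_def using that \<epsilon> by (intro st) auto
  have sX: "solves (\<lambda>y. (1 / \<epsilon>) *\<^sub>R vf \<epsilon> u y) X"
    unfolding X_def by (rule solves_scale_shift[OF s(2)]) (use \<epsilon> in auto)
  have rhs: "(1 / \<epsilon>) *\<^sub>R vf \<epsilon> u y = F0 y + (\<Sum>i\<in>UNIV. (((1 / \<epsilon>) *\<^sub>R u) $ i) *\<^sub>R F i y)" if "y \<in> D R" for y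
    unfolding vf_def using \<epsilon> by (simp add: cut_eq[OF that] scaleR_add_right scaleR_sum_right)
  have "trajectory M F0 F \<epsilon> (\<lambda>t. (1 / \<epsilon>) *\<^sub>R u) X"
    unfolding trajectory_def
  proof (intro conjI exI[of _ "{}"])
    show "continuous_on {0..\<epsilon>} X" by (rule continuous_on_subset[OF solves_continuous_on[OF sX]]) auto
    show "X ` {0..\<epsilon>} \<subseteq> M" using XD DM by blast
    show "\<forall>t\<in>{0..\<epsilon>} - {}. (X has_vector_derivative F0 (X t) + (\<Sum>i\<in>UNIV. ((1 / \<epsilon>) *\<^sub>R u) $ i *\<^sub>R F i (X t))) (at t within {0..\<epsilon>})"
    proof
      fix t assume t: "t \<in> {0..\<epsilon>} - {}"
      have "(X has_vector_derivative (1 / \<epsilon>) *\<^sub>R vf \<epsilon> u (X t)) (at t within {0..})"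
        using sX t unfolding solves_def by auto
      then have "(X has_vector_derivative (1 / \<epsilon>) *\<^sub>R vf \<epsilon> u (X t)) (at t within {0..\<epsilon>})"
        by (rule has_vector_derivative_within_subset) auto
      then show "(X has_vector_derivative F0 (X t) + (\<Sum>i\<in>UNIV. ((1 / \<epsilon>) *\<^sub>R u) $ i *\<^sub>R F i (X t))) (at t within {0..\<epsilon>})"
        using rhs[OF XD[of t]] t by simp
    qed
  qed simp
  moreover have "piecewise_constant_on (\<lambda>t. (1 / \<epsilon>) *\<^sub>R u) 0 \<epsilon>"
    unfolding piecewise_constant_on_def constant_on_def by (intro exI[of _ "{}"]) auto
  moreover have "X 0 = x" "X \<epsilon> = flow1 (vf \<epsilon> u) x" unfolding X_def flow1_def using s(1) \<epsilon> by auto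
  ultimately show ?thesis by (intro attainable_atI)
qed

lemma (in control_chart) word_attainable:
  fixes M :: "'a set" and \<epsilon> :: real
  assumes DM: "D R \<subseteq> M" and \<epsilon>: "\<epsilon> > 0"
  shows "stays \<epsilon> (D R) us x \<Longrightarrow> wflow \<epsilon> us x \<in> attainable_at M F0 F x (length us * \<epsilon>)"
proof (induction us arbitrary: x)
  case Nil
  then show ?case using attainable_at_refl[of x M] DM by auto
next
  case (Cons u us)
  have "flow1 (vf \<epsilon> u) x \<in> attainable_at M F0 F x \<epsilon>"
    by (rule letter_attainable[OF DM \<epsilon>]) (use Cons.prems in auto)
  moreover have "wflow \<epsilon> us (flow1 (vf \<epsilon> u) x) \<in> attainable_at M F0 F (flow1 (vf \<epsilon> u) x) (length us * \<epsilon>)"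
    using Cons by simp
  ultimately have "wflow \<epsilon> (u # us) x \<in> attainable_at M F0 F x (\<epsilon> + length us * \<epsilon>)"
    using attainable_at_trans \<epsilon> by fastforce
  then show ?case by (simp add: algebra_simps)
qed

text \<open>Asking for every small time, with a threshold depending on the two points, makes the
  relation transitive by splitting T in halves, as a connectedness argument requires.\<close>

definition small_time_reach ::
    "'s::real_normed_vector set \<Rightarrow> ('s \<Rightarrow> 's) \<Rightarrow> ('u::finite \<Rightarrow> 's \<Rightarrow> 's) \<Rightarrow> 's \<Rightarrow> 's \<Rightarrow> bool" where
  "small_time_reach M F0 F x y \<longleftrightarrow> (\<exists>e>0. \<forall>T. 0 < T \<longrightarrow> T < e \<longrightarrow> y \<in> attainable_at M F0 F x T)"

lemma small_time_reach_trans: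
  assumes "small_time_reach M F0 F x y" "small_time_reach M F0 F y z"
  shows "small_time_reach M F0 F x z"
proof -
  obtain e1 where e1: "e1 > 0" "\<And>T. 0 < T \<Longrightarrow> T < e1 \<Longrightarrow> y \<in> attainable_at M F0 F x T"
    using assms(1) unfolding small_time_reach_def by blast
  obtain e2 where e2: "e2 > 0" "\<And>T. 0 < T \<Longrightarrow> T < e2 \<Longrightarrow> z \<in> attainable_at M F0 F y T"
    using assms(2) unfolding small_time_reach_def by blast
  have "z \<in> attainable_at M F0 F x T" if "0 < T" "T < min e1 e2" for T
    using attainable_at_trans[OF e1(2)[of "T/2"] e2(2)[of "T/2"]] that by simp
  then show ?thesis unfolding small_time_reach_def using e1(1) e2(1) by (intro exI[of _ "min e1 e2"]) auto
qed

text \<open>Loops of arbitrarily short duration let the system wait at a point for any prescribed time.\<close>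

lemma controllable_of_small_time_reach:
  assumes reach: "\<And>x y. x \<in> M \<Longrightarrow> y \<in> M \<Longrightarrow> small_time_reach M F0 F x y"
  shows "controllable_free_fixed_time M F0 F"
proof -
  have all: "y \<in> attainable_at M F0 F x T" if x: "x \<in> M" and y: "y \<in> M" and T: "T > 0" for x y T
  proof -
    obtain e1 where e1: "e1 > 0" "\<And>T. 0 < T \<Longrightarrow> T < e1 \<Longrightarrow> x \<in> attainable_at M F0 F x T"
      using reach[OF x x] unfolding small_time_reach_def by blast
    obtain e2 where e2: "e2 > 0" "\<And>T. 0 < T \<Longrightarrow> T < e2 \<Longrightarrow> y \<in> attainable_at M F0 F x T"
      using reach[OF x y] unfolding small_time_reach_def by blast
    \<comment> \<open>T is cut into k + 1 equal pieces shorter than both thresholds: k loops at x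
      and a last move to y.\<close>
    obtain k :: nat where k: "T / min e1 e2 < real k" using reals_Archimedean2 by blast
    define s where "s = T / Suc k"
    have s: "s > 0" "Suc k * s = T" unfolding s_def using T by auto
    have "T < real (Suc k) * min e1 e2" using k e1(1) e2(1) by (simp add: pos_divide_less_eq algebra_simps)
    then have "s < min e1 e2" unfolding s_def
      by (simp only: pos_divide_less_eq of_nat_0_less_iff zero_less_Suc mult.commute)
    then have s12: "s < e1" "s < e2" by auto
    have loop: "x \<in> attainable_at M F0 F x (real j * s)" for j :: nat
    proof (induction j)
      case 0
      then show ?case using attainable_at_refl[OF x] by simp
    next
      case (Suc j)
      have "x \<in> attainable_at M F0 F x (s + real j * s)"
        using attainable_at_trans[OF e1(2)[OF s(1) s12(1)] Suc.IH] s(1) by simp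
      then show ?case by (simp add: algebra_simps)
    qed
    have "y \<in> attainable_at M F0 F x (real k * s + s)"
      using attainable_at_trans[OF loop[of k] e2(2)[OF s(1) s12(2)]] s(1) by simp
    then show ?thesis using s(2) by (simp add: algebra_simps)
  qed
  have eq: "attainable_at M F0 F x T = M" if "x \<in> M" "T > 0" for x T
    using all[OF that(1) _ that(2)] attainable_at_subset[of T M F0 F x] that(2) by auto
  show ?thesis
    unfolding controllable_free_fixed_time_def
  proof (intro ballI conjI)
    fix x assume x: "x \<in> M"
    have "attainable_at M F0 F x 1 \<subseteq> attainable M F0 F x" unfolding attainable_def by force
    moreover have "attainable M F0 F x \<subseteq> M" unfolding attainable_def using attainable_at_subset by fastforce
    ultimately show "attainable M F0 F x = M" using eq[OF x, of 1] by auto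
    show "\<forall>\<^sub>F T in at_right 0. attainable_at M F0 F x T = M"
      using eq[OF x] by (auto simp: eventually_at_right_less intro: eventually_mono[OF eventually_at_right_less])
  qed
qed

section \<open>Dimension and topology of symmetric and positive definite matrices\<close>

definition Symm :: "(real^'n^'n) set" where "Symm = {S. transpose S = S}"

lemma subspace_Symm: "subspace Symm"
  unfolding Symm_def subspace_def
  by (auto simp: transpose_def vec_eq_iff)

text \<open>The index type has no order, so an injection into the naturals supplies one. Ordered
  pairs and their mirror images cover all pairs and overlap in the diagonal.\<close>

lemma card_ordered_pairs:
  fixes f :: "'n::finite \<Rightarrow> nat"
  assumes "inj f"
  shows "2 * card {(i, j). f i \<le> f j} = CARD('n) * (CARD('n) + 1)"
proof -
  let ?P = "{(i, j). f i \<le> f j}"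
  have U: "?P \<union> prod.swap ` ?P = UNIV" by (auto simp: image_iff)
  have I: "?P \<inter> prod.swap ` ?P = (\<lambda>i. (i, i)) ` UNIV"
    using injD[OF assms] by (auto simp: image_iff)
  have "card ?P + card (prod.swap ` ?P) = card (?P \<union> prod.swap ` ?P) + card (?P \<inter> prod.swap ` ?P)"
    by (rule card_Un_Int) auto
  moreover have "card (prod.swap ` ?P) = card ?P" by (rule card_image) (auto intro: inj_onI)
  moreover have "card (range (\<lambda>i::'n. (i, i))) = CARD('n)" by (rule card_image) (auto intro: injI)
  moreover have "card (UNIV :: ('n \<times> 'n) set) = CARD('n) * CARD('n)"
    by (simp only: UNIV_Times_UNIV[symmetric] card_cartesian_product)
  ultimately show ?thesis unfolding U I by simp
qed

text \<open>Bounds the dimension of the target from above, so that the rank N forces the evaluated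
  fields to fill it. The matrices \<open>E\<close> with i ordered before j are the symmetrized
  elementary matrices.\<close>

lemma dim_Symm_le: "dim (Symm :: (real^'n^'n) set) \<le> CARD('n) * (CARD('n) + 1) div 2"
proof -
  obtain f :: "'n \<Rightarrow> nat" where f: "inj f" using finite_imp_inj_to_nat_seg[of "UNIV :: 'n set"] by auto
  define P where "P = {(i, j). f i \<le> f j}"
  define E :: "'n \<times> 'n \<Rightarrow> real^'n^'n" where
    "E = (\<lambda>(i, j). \<chi> a b. if (a = i \<and> b = j) \<or> (a = j \<and> b = i) then 1 else 0)"
  have "S \<in> span (E ` P)" if S: "S \<in> Symm" for S
  proof -
    have Ssym: "S $ a $ b = S $ b $ a" for a b
    proof -
      have "transpose S $ a $ b = S $ a $ b" using S by (simp add: Symm_def)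
      then show ?thesis by (simp add: transpose_def)
    qed
    have "S = (\<Sum>p\<in>P. (S $ fst p $ snd p) *\<^sub>R E p)"
    proof -
      have "(\<Sum>p\<in>P. (S $ fst p $ snd p) *\<^sub>R E p) $ a $ b = S $ a $ b" for a b
      proof -
        define p0 where "p0 = (if f a \<le> f b then (a, b) else (b, a))"
        have p0: "p0 \<in> P" unfolding p0_def P_def by auto
        have "E p $ a $ b = (if p = p0 then 1 else 0)" if "p \<in> P" for p
          using that injD[OF f] unfolding E_def p0_def P_def by (cases p) auto
        then have "(\<Sum>p\<in>P. (S $ fst p $ snd p) *\<^sub>R E p) $ a $ b = (\<Sum>p\<in>P. if p = p0 then S $ fst p0 $ snd p0 else 0)"
          unfolding sum_component by (intro sum.cong) auto
        also have "\<dots> = S $ fst p0 $ snd p0" using p0 by simp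
        also have "\<dots> = S $ a $ b" unfolding p0_def using Ssym by simp
        finally show ?thesis .
      qed
      then show ?thesis by (simp add: vec_eq_iff)
    qed
    also have "\<dots> \<in> span (E ` P)" by (intro span_sum span_scale span_base) auto
    finally show ?thesis .
  qed
  then have "dim (Symm :: (real^'n^'n) set) \<le> card (E ` P)" by (intro dim_le_card) auto
  also have "\<dots> \<le> card P" by (rule card_image_le) simp
  finally show ?thesis using card_ordered_pairs[OF f] unfolding P_def by simp
qed

lemma convex_Sym_pos: "convex Sym_pos"
proof (rule convexI)
  fix P Q :: "real^'n^'n" and a b :: real
  assume P: "P \<in> Sym_pos" and Q: "Q \<in> Sym_pos" and ab: "0 \<le> a" "0 \<le> b" "a + b = 1"
  have "transpose (a *\<^sub>R P + b *\<^sub>R Q) = a *\<^sub>R transpose P + b *\<^sub>R transpose Q" by (simp add: transpose_def vec_eq_iff)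
  then have "transpose (a *\<^sub>R P + b *\<^sub>R Q) = a *\<^sub>R P + b *\<^sub>R Q" using P Q by (simp add: Sym_pos_def)
  moreover have "x \<bullet> ((a *\<^sub>R P + b *\<^sub>R Q) *v x) > 0" if x: "x \<noteq> 0" for x
  proof -
    have pq: "x \<bullet> (P *v x) > 0" "x \<bullet> (Q *v x) > 0" using P Q x by (auto simp: Sym_pos_def)
    have "x \<bullet> ((a *\<^sub>R P + b *\<^sub>R Q) *v x) = a * (x \<bullet> (P *v x)) + b * (x \<bullet> (Q *v x))"
      by (simp add: matrix_vector_mult_add_rdistrib scaleR_matrix_vector_assoc[symmetric] inner_add_right)
    moreover have "0 < a * (x \<bullet> (P *v x)) + b * (x \<bullet> (Q *v x))"
    proof (cases "a = 0")
      case False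
      then have "0 < a * (x \<bullet> (P *v x))" using ab pq by simp
      moreover have "0 \<le> b * (x \<bullet> (Q *v x))" using ab pq by simp
      ultimately show ?thesis by linarith
    qed (use ab pq in simp)
    ultimately show ?thesis by simp
  qed
  ultimately show "a *\<^sub>R P + b *\<^sub>R Q \<in> Sym_pos" by (simp add: Sym_pos_def)
qed

text \<open>Perturbations below c / (2 k) cost at most half of the coercivity constant c; symmetry
  has to be kept, hence openness only relative to \<open>Symm\<close>.\<close>

lemma Sym_pos_rel_open:
  assumes P: "(P :: real^'n^'n) \<in> Sym_pos"
  shows "\<exists>e>0. \<forall>Q\<in>Symm. norm (Q - P) \<le> e \<longrightarrow> Q \<in> Sym_pos"
proof -
  obtain c where c: "c > 0" "\<And>x. c * (norm x)\<^sup>2 \<le> x \<bullet> (P *v x)" using Sym_pos_coercive[OF P] by blast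
  obtain k where k: "k > 0" "\<And>(A :: real^'n^'n) x. norm (A *v x) \<le> norm A * norm x * k"
    using bounded_bilinear.pos_bounded[OF bounded_bilinear_matrix_vector_mult] by blast
  have "Q \<in> Sym_pos" if Q: "Q \<in> Symm" "norm (Q - P) \<le> c / (2 * k)" for Q
  proof -
    have "x \<bullet> (Q *v x) > 0" if x: "x \<noteq> 0" for x
    proof -
      have "\<bar>x \<bullet> ((Q - P) *v x)\<bar> \<le> norm x * norm ((Q - P) *v x)" by (rule Cauchy_Schwarz_ineq2)
      also have "\<dots> \<le> norm x * (norm (Q - P) * norm x * k)" by (intro mult_left_mono k) auto
      also have "\<dots> \<le> norm x * (c / (2 * k) * norm x * k)"
        using Q(2) k(1) by (intro mult_left_mono mult_right_mono) auto
      also have "\<dots> = c / 2 * (norm x)\<^sup>2" using k(1) by (simp add: power2_eq_square)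
      finally have "\<bar>x \<bullet> ((Q - P) *v x)\<bar> \<le> c / 2 * (norm x)\<^sup>2" .
      moreover have "x \<bullet> (Q *v x) = x \<bullet> (P *v x) + x \<bullet> ((Q - P) *v x)"
        by (simp add: matrix_vector_mult_diff_rdistrib inner_diff_right)
      moreover have "c / 2 * (norm x)\<^sup>2 < c * (norm x)\<^sup>2" using c(1) x by simp
      ultimately show ?thesis using c(2)[of x] by linarith
    qed
    then show ?thesis using Q(1) by (simp add: Sym_pos_def Symm_def)
  qed
  then show ?thesis using c(1) k(1) by (intro exI[of _ "c / (2 * k)"]) auto
qed

lemma F_field_in_Symm: "snd z \<in> Symm \<Longrightarrow> F_field h z \<in> UNIV \<times> Symm"
  by (cases z) (simp add: F_field_def Symm_def transpose_add matrix_transpose_mul transpose_transpose add.commute)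

lemma F_drift_in_Symm: "snd z \<in> Symm \<Longrightarrow> F_drift h g z \<in> UNIV \<times> Symm"
  by (cases z) (simp add: F_drift_def Symm_def transpose_add matrix_transpose_mul transpose_transpose add.commute)

text \<open>A dimension count turns the rank hypothesis into surjectivity at the identity. At P the
  vector component is matched first, and the matrix component is then corrected by a field vanishing
  at m, which leaves the vector component alone.\<close>

lemma F_field_rank_everywhere:
  fixes V :: "(real^'n) set" and G :: "(real^'n \<Rightarrow> real^'n) set"
  assumes V: "open V" and G: "\<And>h. h \<in> G \<Longrightarrow> smooth_on h V" and m: "m \<in> V"
    and rank: "dim {(h m, jacobian h (at m) + transpose (jacobian h (at m))) | h. h \<in> lie_generated G}
        = CARD('n) + CARD('n) * (CARD('n) + 1) div 2"
    and P: "P \<in> Sym_pos" and w: "w \<in> UNIV \<times> Symm"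
  shows "\<exists>h\<in>lie_generated G. F_field h (m, P) = w"
proof -
  have sm: "smooth_on h V" if "h \<in> lie_generated G" for h
    by (rule lie_generated_smooth[OF V _ that]) (rule G)
  define X where "X = {(h m, jacobian h (at m) + transpose (jacobian h (at m))) | h. h \<in> lie_generated G}"
  have zero0: "transpose 0 = (0 :: real^'n^'n)" by (simp add: transpose_def vec_eq_iff)
  have tr_scale: "transpose (c *\<^sub>R A) = c *\<^sub>R transpose A" for c and A :: "real^'n^'n"
    by (simp add: transpose_def vec_eq_iff)
  have subX: "subspace X"
    unfolding subspace_def
  proof (intro conjI ballI allI)
    show "0 \<in> X" unfolding X_def mem_Collect_eq
      by (rule exI[of _ "\<lambda>x. 0"]) (simp add: jacobian_zero zero0 zero_prod_def lie_generated.zero)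
  next
    fix x y assume "x \<in> X" "y \<in> X"
    then obtain a b where a: "a \<in> lie_generated G" "x = (a m, jacobian a (at m) + transpose (jacobian a (at m)))"
      and b: "b \<in> lie_generated G" "y = (b m, jacobian b (at m) + transpose (jacobian b (at m)))"
      unfolding X_def by blast
    have "x + y = ((\<lambda>x. a x + b x) m, jacobian (\<lambda>x. a x + b x) (at m) + transpose (jacobian (\<lambda>x. a x + b x) (at m)))"
      unfolding a b jacobian_add[OF sm[OF a(1)] sm[OF b(1)] m] transpose_add by simp
    then show "x + y \<in> X" unfolding X_def mem_Collect_eq
      by (intro exI[of _ "\<lambda>x. a x + b x"] conjI lie_generated.add[OF a(1) b(1)])
  next
    fix c x assume "x \<in> X"
    then obtain a where a: "a \<in> lie_generated G" "x = (a m, jacobian a (at m) + transpose (jacobian a (at m)))"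
      unfolding X_def by blast
    have "c *\<^sub>R x = ((\<lambda>x. c *\<^sub>R a x) m, jacobian (\<lambda>x. c *\<^sub>R a x) (at m) + transpose (jacobian (\<lambda>x. c *\<^sub>R a x) (at m)))"
      unfolding a jacobian_scale[OF sm[OF a(1)] m] tr_scale by (simp add: scaleR_add_right)
    then show "c *\<^sub>R x \<in> X" unfolding X_def mem_Collect_eq
      by (intro exI[of _ "\<lambda>x. c *\<^sub>R a x"] conjI lie_generated.scale[OF a(1)])
  qed
  have XW: "X \<subseteq> UNIV \<times> Symm"
    unfolding X_def Symm_def by (auto simp: transpose_add transpose_transpose add.commute)
  have subW: "subspace (UNIV \<times> Symm :: ((real^'n) \<times> (real^'n^'n)) set)"
    by (intro subspace_Times subspace_UNIV subspace_Symm)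
  have "dim (UNIV \<times> Symm :: ((real^'n) \<times> (real^'n^'n)) set) \<le> dim X"
    using dim_Symm_le[where 'n='n] rank
    by (simp add: dim_Times[OF subspace_UNIV subspace_Symm] X_def)
  then have XeqW: "X = UNIV \<times> Symm" by (rule subspace_dim_equal[OF subX subW XW])
  have pick: "\<exists>h\<in>lie_generated G. h m = v \<and> jacobian h (at m) + transpose (jacobian h (at m)) = S"
    if "S \<in> Symm" for v S
  proof -
    have "(v, S) \<in> X" unfolding XeqW using that by simp
    then show ?thesis unfolding X_def by blast
  qed
  define L where "L = {jacobian h (at m) | h. h \<in> lie_generated G \<and> h m = 0}"
  have subL: "subspace L"
    unfolding subspace_def
  proof (intro conjI ballI allI)
    show "0 \<in> L" unfolding L_def mem_Collect_eq
      by (rule exI[of _ "\<lambda>x. 0"]) (simp add: jacobian_zero lie_generated.zero)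
  next
    fix x y assume "x \<in> L" "y \<in> L"
    then obtain a b where a: "a \<in> lie_generated G" "a m = 0" "x = jacobian a (at m)"
      and b: "b \<in> lie_generated G" "b m = 0" "y = jacobian b (at m)"
      unfolding L_def by blast
    have "x + y = jacobian (\<lambda>x. a x + b x) (at m)"
      unfolding a b jacobian_add[OF sm[OF a(1)] sm[OF b(1)] m] ..
    then show "x + y \<in> L" unfolding L_def mem_Collect_eq
      by (intro exI[of _ "\<lambda>x. a x + b x"] conjI lie_generated.add[OF a(1) b(1)]) (use a(2) b(2) in simp_all)
  next
    fix c x assume "x \<in> L"
    then obtain a where a: "a \<in> lie_generated G" "a m = 0" "x = jacobian a (at m)"
      unfolding L_def by blast
    have "c *\<^sub>R x = jacobian (\<lambda>x. c *\<^sub>R a x) (at m)"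
      unfolding a jacobian_scale[OF sm[OF a(1)] m] ..
    then show "c *\<^sub>R x \<in> L" unfolding L_def mem_Collect_eq
      by (intro exI[of _ "\<lambda>x. c *\<^sub>R a x"] conjI lie_generated.scale[OF a(1)]) (use a(2) in simp_all)
  qed
  have comm: "x ** y - y ** x \<in> L" if xy: "x \<in> L" "y \<in> L" for x y
  proof -
    obtain a b where a: "a \<in> lie_generated G" "a m = 0" "x = jacobian a (at m)"
      and b: "b \<in> lie_generated G" "b m = 0" "y = jacobian b (at m)"
      using xy unfolding L_def by blast
    have z: "frechet_derivative (\<lambda>x. jacobian h (at x)) (at m) 0 = 0" if "h \<in> lie_generated G" for h
      using jacobian_has_derivative[OF V sm[OF that] m] has_derivative_linear linear_0 by blast
    \<comment> \<open>At a common zero the second-derivative terms vanish, and with this sign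
      convention taking Jacobians reverses the order of the commutator; hence b before a.\<close>
    have "jacobian (lie_bracket b a) (at m) = x ** y - y ** x"
      unfolding jacobian_lie_bracket[OF V sm[OF b(1)] sm[OF a(1)] m] a(2) b(2) z[OF a(1)] z[OF b(1)] a(3) b(3) by simp
    moreover have "lie_bracket b a m = 0" using a(2) b(2) by (simp add: lie_bracket_def)
    ultimately show ?thesis unfolding L_def using lie_generated.bracket[OF b(1) a(1)] by force
  qed
  have onto: "\<exists>A\<in>L. A + transpose A = S" if "transpose S = S" for S
  proof -
    have "S \<in> Symm" using that by (simp add: Symm_def)
    from pick[OF this, of 0] show ?thesis unfolding L_def by blast
  qed
  obtain v S where wS: "w = (v, S)" "S \<in> Symm" using w by blast
  have "(0 :: real^'n^'n) \<in> Symm" using subspace_0[OF subspace_Symm] .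
  \<comment> \<open>Any symmetric value will do here, as the remaining matrix part is left to
    \<open>h2\<close>.\<close>
  from pick[OF this, of v] obtain h1 where h1: "h1 \<in> lie_generated G" "h1 m = v" by blast
  have "P \<in> Symm" using P by (simp add: Sym_pos_def Symm_def)
  then have "snd (F_field h1 (m, P)) \<in> Symm" using F_field_in_Symm[of "(m, P)" h1] by (auto simp: mem_Times_iff)
  then have "S - snd (F_field h1 (m, P)) \<in> Symm" by (rule subspace_diff[OF subspace_Symm wS(2)])
  then have "transpose (S - snd (F_field h1 (m, P))) = S - snd (F_field h1 (m, P))" by (simp add: Symm_def)
  from symmetrization_onto_transport[OF subL comm onto P this]
  obtain A where A: "A \<in> L" "A ** P + P ** transpose A = S - snd (F_field h1 (m, P))" by blast
  then obtain h2 where h2: "h2 \<in> lie_generated G" "h2 m = 0" "A = jacobian h2 (at m)" unfolding L_def by blast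
  have "F_field (\<lambda>x. h1 x + h2 x) (m, P) = F_field h1 (m, P) + F_field h2 (m, P)"
    by (rule F_field_add[OF sm[OF h1(1)] sm[OF h2(1)] m])
  also have "F_field h2 (m, P) = (0, S - snd (F_field h1 (m, P)))"
    using A(2) h2 by (simp add: F_field_def)
  also have "F_field h1 (m, P) = (v, snd (F_field h1 (m, P)))"
    using h1(2) by (simp add: F_field_def)
  finally have "F_field (\<lambda>x. h1 x + h2 x) (m, P) = w" unfolding wS(1) by simp
  then show ?thesis using lie_generated.add[OF h1(1) h2(1)] by blast
qed

lemma local_small_time_reach:
  fixes V :: "(real^'n) set" and f0 :: "real^'n \<Rightarrow> real^'n" and f :: "'u::finite \<Rightarrow> real^'n \<Rightarrow> real^'n"
    and g :: "real^'n \<Rightarrow> real^'d^'n"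
  assumes V: "open V" and f0: "smooth_on f0 V" and f: "\<And>i. smooth_on (f i) V" and g: "smooth_on g V"
    and m: "m \<in> V" and P: "P \<in> Sym_pos"
    and rank: "dim {(h m, jacobian h (at m) + transpose (jacobian h (at m))) | h. h \<in> lie_generated (range f)}
        = CARD('n) + CARD('n) * (CARD('n) + 1) div 2"
  defines "M \<equiv> V \<times> Sym_pos"
  shows "\<exists>T. openin (top_of_set M) T \<and> (m, P) \<in> T \<and>
    (\<forall>x\<in>T. \<forall>y\<in>T. small_time_reach M (F_drift f0 g) (\<lambda>i. F_field (f i)) x y)"
proof -
  define p where "p = (m, P)"
  define W where "W = (UNIV \<times> Symm :: ((real^'n) \<times> (real^'n^'n)) set)"
  have G: "\<And>h. h \<in> range f \<Longrightarrow> smooth_on h V" using f by auto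
  have sm: "smooth_on h V" if "h \<in> lie_generated (range f)" for h
    by (rule lie_generated_smooth[OF V _ that]) (rule G)
  obtain d1 where d1: "d1 > 0" "cball m d1 \<subseteq> V" using V m open_contains_cball by blast
  obtain d2 where d2: "d2 > 0" "\<And>Q. Q \<in> Symm \<Longrightarrow> norm (Q - P) \<le> d2 \<Longrightarrow> Q \<in> Sym_pos"
    using Sym_pos_rel_open[OF P] by blast
  \<comment> \<open>Both components of a pair are bounded by its norm, so the ball of radius R,
    intersected with \<open>W\<close>, lies in \<open>M\<close>.\<close>
  define R where "R = min d1 d2"
  define r where "r = R / 2"
  have rR: "0 < r" "r < R" unfolding r_def R_def using d1(1) d2(1) by auto
  define K where "K = W \<inter> cball p R"
  have subW: "subspace W" unfolding W_def by (intro subspace_Times subspace_UNIV subspace_Symm)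
  have PS: "P \<in> Symm" using P by (simp add: Sym_pos_def Symm_def)
  then have pW: "p \<in> W" unfolding W_def p_def by simp
  have KM: "K \<subseteq> M"
  proof
    fix z assume z: "z \<in> K"
    then have zd: "dist p z \<le> R" and zS: "snd z \<in> Symm" unfolding K_def W_def by (auto simp: mem_Times_iff)
    have "dist m (fst z) \<le> R" using order_trans[OF dist_fst_le zd] unfolding p_def by simp
    then have "fst z \<in> V" using d1(2) unfolding R_def by auto
    moreover have "dist P (snd z) \<le> R" using order_trans[OF dist_snd_le zd] unfolding p_def by simp
    then have "snd z \<in> Sym_pos" using d2(2)[OF zS] unfolding R_def by (simp add: dist_norm norm_minus_commute)
    ultimately show "z \<in> M" unfolding M_def by (simp add: mem_Times_iff)
  qed
  have KO: "K \<subseteq> V \<times> UNIV" using KM unfolding M_def by auto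
  have Kc: "compact K" "convex K"
    unfolding K_def
    using closed_Int_compact[OF closed_subspace[OF subW] compact_cball]
      convex_Int[OF subspace_imp_convex[OF subW] convex_cball] by auto
  have C11: "\<exists>C. C11_on K (F_field h) (\<lambda>x. frechet_derivative (F_field h) (at x)) C" if "smooth_on h V" for h
    by (rule C11_on_of_Ck_on[OF smooth_onD[OF smooth_on_F_field[OF V that]] Kc KO])
  obtain C0 where C0: "C11_on K (F_drift f0 g) (\<lambda>x. frechet_derivative (F_drift f0 g) (at x)) C0"
    using C11_on_of_Ck_on[OF smooth_onD[OF smooth_on_F_drift[OF V f0 g]] Kc KO] by blast
  have "\<forall>i. \<exists>C. C11_on K (F_field (f i)) (\<lambda>x. frechet_derivative (F_field (f i)) (at x)) C" using C11[OF f] by blast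
  then obtain C where C: "\<And>i. C11_on K (F_field (f i)) (\<lambda>x. frechet_derivative (F_field (f i)) (at x)) (C i)" by metis
  \<comment> \<open>A single constant dominating the drift and all controlled fields, as the chart
    expects.\<close>
  define B where "B = C0 + (\<Sum>i\<in>UNIV. C i)"
  have C0p: "C0 \<ge> 0" and Cp: "C i \<ge> 0" for i using C0 C[of i] by (auto simp: C11_on_def)
  have B0: "C11_on K (F_drift f0 g) (\<lambda>x. frechet_derivative (F_drift f0 g) (at x)) B"
    by (rule C11_on_mono[OF C0]) (simp add: B_def sum_nonneg Cp)
  have Bi: "C11_on K (F_field (f i)) (\<lambda>x. frechet_derivative (F_field (f i)) (at x)) B" for i
  proof (rule C11_on_mono[OF C])
    have "C i \<le> (\<Sum>i\<in>UNIV. C i)" using Cp by (intro member_le_sum) auto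
    then show "C i \<le> B" unfolding B_def using C0p by simp
  qed
  have lipK: "B-lipschitz_on K H" if "C11_on K H H' B" for H H'
  proof (rule lipschitz_onI)
    show "B \<ge> 0" using that by (simp add: C11_on_def)
    fix x y assume "x \<in> K" "y \<in> K"
    then show "dist (H x) (H y) \<le> B * dist x y" using C11_onD(4)[OF that, of y x] by (simp add: dist_norm)
  qed
  interpret control_chart W p r R B "F_drift f0 g" "\<lambda>i. F_field (f i)"
  proof
    fix x assume x: "x \<in> W \<inter> cball p R"
    then have xK: "x \<in> K" and xS: "snd x \<in> Symm" unfolding K_def W_def by auto
    show "F_field (f i) x \<in> W" for i unfolding W_def by (rule F_field_in_Symm[OF xS])
    show "F_drift f0 g x \<in> W" unfolding W_def by (rule F_drift_in_Symm[OF xS])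
    show "norm (F_field (f i) x) \<le> B" for i by (rule C11_onD(2)[OF Bi xK])
    show "norm (F_drift f0 g x) \<le> B" by (rule C11_onD(2)[OF B0 xK])
  next
    show "B-lipschitz_on (W \<inter> cball p R) (F_field (f i))" for i using lipK[OF Bi] unfolding K_def .
    show "B-lipschitz_on (W \<inter> cball p R) (F_drift f0 g)" using lipK[OF B0] unfolding K_def .
  qed (fact subW pW rR)+
  have DK: "D R = K" unfolding D_def K_def ..
  have nice: "nice (F_field h) (\<lambda>x. frechet_derivative (F_field h) (at x))" if "smooth_on h V" for h
    unfolding nice_def DK
  proof (intro conjI ballI)
    fix x assume "x \<in> K"
    then have "snd x \<in> Symm" unfolding K_def W_def by auto
    then show "F_field h x \<in> W" unfolding W_def by (rule F_field_in_Symm)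
  qed (rule C11[OF that])
  have DV: "fst x \<in> V" if "x \<in> D r" for x
  proof -
    have "x \<in> K" using that D_mono[of r R] rR unfolding DK by auto
    then show ?thesis using KO by auto
  qed
  \<comment> \<open>Only the bracket case has to pass from first-order approximation to following a
    flow and back; each passage shrinks the radius, but radii below r remain arbitrary.\<close>
  have tangent: "tangent (F_field h)" if "h \<in> lie_generated (range f)" for h
    using that
  proof (induction rule: lie_generated.induct)
    case (generator h)
    then obtain i where "h = f i" by blast
    then show ?case using tangent_generator[OF nice[OF f]] by simp
  next
    case zero
    then show ?case using tangent_zero by (simp add: F_field_zero)
  next
    case (add h1 h2)
    show ?case
    proof (rule tangent_cong[OF tangent_add[OF add.IH nice[OF sm[OF add.hyps(1)]] nice[OF sm[OF add.hyps(2)]]]])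
      show "F_field (\<lambda>x. h1 x + h2 x) x = F_field h1 x + F_field h2 x" if "x \<in> D r" for x
        using F_field_add(1)[OF sm[OF add.hyps(1)] sm[OF add.hyps(2)] DV[OF that], of "snd x"] by simp
    qed
  next
    case (scale h c)
    show ?case
    proof (rule tangent_cong[OF tangent_scale[OF scale.IH]])
      show "F_field (\<lambda>x. c *\<^sub>R h x) x = c *\<^sub>R F_field h x" if "x \<in> D r" for x
        using F_field_scale(1)[OF sm[OF scale.hyps] DV[OF that], of c "snd x"] by simp
    qed
  next
    case (bracket h1 h2)
    note n1 = nice[OF sm[OF bracket.hyps(1)]] and n2 = nice[OF sm[OF bracket.hyps(2)]]
    show ?case
    proof (rule tangent_cong[OF tangent_bracket[OF follow_of_tangent[OF bracket.IH(1) n1] follow_of_tangent[OF bracket.IH(2) n2] n1 n2]])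
      show "F_field (lie_bracket h1 h2) x = frechet_derivative (F_field h2) (at x) (F_field h1 x)
          - frechet_derivative (F_field h1) (at x) (F_field h2 x)" if "x \<in> D r" for x
        using F_field_lie_bracket[OF V sm[OF bracket.hyps(1)] sm[OF bracket.hyps(2)] DV[OF that], of "snd x"] by simp
    qed
  qed
  have span: "\<exists>H H'. tangent H \<and> nice H H' \<and> H p = w" if "w \<in> W" for w
  proof -
    have "\<exists>h\<in>lie_generated (range f). F_field h (m, P) = w"
      by (rule F_field_rank_everywhere[OF V _ m rank P that[unfolded W_def]]) (rule G)
    then obtain h where h: "h \<in> lie_generated (range f)" "F_field h (m, P) = w" by blast
    then show ?thesis using tangent[OF h(1)] nice[OF sm[OF h(1)]] unfolding p_def by blast
  qed
  obtain \<delta> \<epsilon>0 n where \<delta>: "\<delta> > 0" and \<epsilon>0: "\<epsilon>0 > 0" and n: "n \<ge> 1"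
    and reach: "\<forall>x\<in>D \<delta>. \<forall>y\<in>D \<delta>. \<forall>\<epsilon>. 0 < \<epsilon> \<longrightarrow> \<epsilon> < \<epsilon>0 \<longrightarrow>
       (\<exists>us. length us = n \<and> wflow \<epsilon> us x = y \<and> stays \<epsilon> (D R) us x)"
  proof -
    have "\<exists>\<delta>>0. \<exists>\<epsilon>0>0. \<exists>n\<ge>1. \<forall>x\<in>D \<delta>. \<forall>y\<in>D \<delta>. \<forall>\<epsilon>. 0 < \<epsilon> \<longrightarrow> \<epsilon> < \<epsilon>0 \<longrightarrow>
       (\<exists>us. length us = n \<and> wflow \<epsilon> us x = y \<and> stays \<epsilon> (D R) us x)"
      by (rule local_reach) (rule span)
    then show ?thesis by (elim exE conjE) (rule that)
  qed
  have DM: "D R \<subseteq> M" unfolding DK by (rule KM)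
  define T where "T = M \<inter> ball p \<delta>"
  have TD: "x \<in> D \<delta>" if "x \<in> T" for x
  proof -
    have "x \<in> W \<inter> cball p \<delta>"
      using that unfolding T_def W_def M_def by (auto simp: Sym_pos_def Symm_def)
    then show ?thesis unfolding D_def .
  qed
  have "small_time_reach M (F_drift f0 g) (\<lambda>i. F_field (f i)) x y" if xy: "x \<in> T" "y \<in> T" for x y
    unfolding small_time_reach_def
  \<comment> \<open>A prescribed time t is split evenly over the n letters, so \<epsilon> = t /
    n.\<close>
  proof (intro exI[of _ "n * \<epsilon>0"] conjI allI impI)
    show "0 < n * \<epsilon>0" using n \<epsilon>0 by simp
    fix t assume t: "0 < t" "t < n * \<epsilon>0"
    have "0 < t / n" "t / n < \<epsilon>0" using t n by (auto simp: pos_divide_less_eq mult.commute)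
    from reach[rule_format, OF TD[OF xy(1)] TD[OF xy(2)] this] obtain us
      where us: "length us = n" "wflow (t / n) us x = y" "stays (t / n) (D R) us x" by blast
    from word_attainable[OF DM \<open>0 < t / n\<close> us(3)] us(1,2) n
    show "y \<in> attainable_at M (F_drift f0 g) (\<lambda>i. F_field (f i)) x t" by simp
  qed
  moreover have "openin (top_of_set M) T" unfolding T_def by (rule openin_open_Int) simp
  moreover have "p \<in> T" unfolding T_def p_def M_def using m P \<delta> by simp
  ultimately show ?thesis unfolding p_def by blast
qed

theorem proposition2p14:
  fixes V :: "(real^'n) set"
    and f0 :: "real^'n \<Rightarrow> real^'n"
    and f :: "'u::finite \<Rightarrow> real^'n \<Rightarrow> real^'n"
    and g :: "real^'n \<Rightarrow> real^'d^'n"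
  assumes "open V" and "connected V"
    and "smooth_on f0 V" and "\<And>i. smooth_on (f i) V" and "smooth_on g V"
    and "\<And>m. m \<in> V \<Longrightarrow>
      dim {(h m, jacobian h (at m) + transpose (jacobian h (at m))) | h.
             h \<in> lie_generated (range f)}
        = CARD('n) + CARD('n) * (CARD('n) + 1) div 2"
  shows "controllable_free_fixed_time (V \<times> Sym_pos) (F_drift f0 g) (\<lambda>i. F_field (f i))"
proof (rule controllable_of_small_time_reach)
  let ?M = "V \<times> (Sym_pos :: (real^'n^'n) set)"
  let ?R = "small_time_reach ?M (F_drift f0 g) (\<lambda>i. F_field (f i))"
  fix x y assume xy: "x \<in> ?M" "y \<in> ?M"
  have conn: "connected ?M"
    by (rule connected_Times[OF assms(2) convex_connected[OF convex_Sym_pos]])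
  \<comment> \<open>With a drift, trajectories cannot simply be reversed, so the relation is
    symmetrized by hand; the local result is symmetric in its two points and supplies both
    directions.\<close>
  have "?R x y \<and> ?R y x"
  proof (rule connected_equivalence_relation[OF conn xy])
    show "?R b a \<and> ?R a b" if "?R a b \<and> ?R b a" for a b using that by blast
    show "?R a c \<and> ?R c a" if "?R a b \<and> ?R b a" "?R b c \<and> ?R c b" for a b c
      using that small_time_reach_trans by blast
    show "\<exists>T. openin (top_of_set ?M) T \<and> a \<in> T \<and> (\<forall>b\<in>T. ?R a b \<and> ?R b a)" if aM: "a \<in> ?M" for a
    proof -
      obtain m P where a: "a = (m, P)" "m \<in> V" "P \<in> Sym_pos" using aM by blast
      from local_small_time_reach[OF assms(1,3,4,5) a(2,3) assms(6)[OF a(2)]] show ?thesis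
        unfolding a(1) by blast
    qed
  qed
  then show "?R x y" by blast
qed

end
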